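(* Let $\mathcal{X},\mathcal{Y}_1,\mathcal{Y}_2$ be finite sets and consider the binary hypothesis testing system described in the context, with null pmf $P_{XY_1Y_2}$ and alternative pmf $\bar P_{XY_1Y_2}$, where $\bar P_{XY_1Y_2}(x,y_1,y_2)>0$ for all $(x,y_1,y_2)$. Let $R_1\ge 0$, $R_2\ge 0$ and $\epsilon_1,\epsilon_2\in(0,1)$. Then the error-exponents region $\mathcal{E}(R_1,R_2,\epsilon_1,\epsilon_2)$ contains every nonnegative pair $(\theta_1,\theta_2)$ for which there exists $(U,V)\in\mathcal{S}(R_1,R_2)$ such that \[ \theta_1\le \min_{(\tilde U,\tilde X,\tilde Y_1)\in\mathcal{L}_1(U)} D\big(P_{\tilde U\tilde X\tilde Y_1}\,\|\,P_{\bar U\bar X\bar Y_1}\big), \] \[ \theta_2\le \min_{(\tilde U,\tilde V,\tilde X,\tilde Y_1,\tilde Y_2)\in\mathcal{L}_2(U,V)} D\big(P_{\tilde V\tilde U\tilde X\tilde Y_1\tilde Y_2}\,\|\,P_{\bar V\bar U\bar X\bar Y_1\bar Y_2}\big). \]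
   Context: Setting: Under hypothesis $\mathcal{H}=1$ (null) the triples $(X_t,Y_{1,t},Y_{2,t})$, $t=1,\dots,n$, are i.i.d. $\sim P_{XY_1Y_2}$ on $\mathcal{X}\times\mathcal{Y}_1\times\mathcal{Y}_2$; under $\mathcal{H}=2$ (alternative) they are i.i.d. $\sim \bar P_{XY_1Y_2}$. Write $(X,Y_1,Y_2)\sim P_{XY_1Y_2}$. A code of blocklength $n$ consists of: an encoder $\phi_{1,n}:\mathcal{X}^n\to\{1,\dots,\|\phi_{1,n}\|\}$ producing $M_1=\phi_{1,n}(X^n)$, sent to both detectors; at Detector 1 (which observes $Y_1^n$) a map $\phi_{2,n}:\{1,\dots,\|\phi_{1,n}\|\}\times\mathcal{Y}_1^n\to\{1,\dots,\|\phi_{2,n}\|\}$ producing $M_2=\phi_{2,n}(M_1,Y_1^n)$, sent to Detector 2, and a decision $\hat{\mathcal H}_1=\psi_{1,n}(M_1,Y_1^n)\in\{1,2\}$; at Detector 2 (which observes $Y_2^n$) a decision $\hat{\mathcal H}_2=\psi_{2,n}(M_1,M_2,Y_2^n)\in\{1,2\}$. Let $\alpha_{k,n}=\Pr[\hat{\mathcal H}_k\neq 1\mid\mathcal H=1]$ and $\beta_{k,n}=\Pr[\hat{\mathcal H}_k\neq 2\mid \mathcal H=2]$, $k=1,2$. A pair $(\theta_1,\theta_2)$ is achievable for $(R_1,R_2,\epsilon_1,\epsilon_2)$ if there exist codes for every $n$ with $\limsup_n\alpha_{k,n}\le\epsilon_k$, $\theta_k\le\liminf_n -\frac1n\log\beta_{k,n}$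 and $\limsup_n\frac1n\log\|\phi_{k,n}\|\le R_k$ for $k=1,2$. $\mathcal{E}(R_1,R_2,\epsilon_1,\epsilon_2)$ is the closure of the set of achievable pairs. Definitions: $\mathcal{S}(R_1,R_2)$ is the set of pairs of random variables $(U,V)$ on finite alphabets, jointly distributed with $(X,Y_1,Y_2)$ so that $U - X - (Y_1,Y_2)$ and $V-(Y_1,U)-(Y_2,X)$ are Markov chains, $I(U;X)\le R_1$ and $I(V;Y_1|U)\le R_2$ (all under $P_{XY_1Y_2}$). For such $(U,V)$: $\mathcal{L}_1(U)$ is the set of joint laws of $(\tilde U,\tilde X,\tilde Y_1)$ with $P_{\tilde U\tilde X}=P_{UX}$ and $P_{\tilde U\tilde Y_1}=P_{UY_1}$; $\mathcal{L}_2(U,V)$ is the set of joint laws of $(\tilde U,\tilde V,\tilde X,\tilde Y_1,\tilde Y_2)$ with $P_{\tilde U\tilde X}=P_{UX}$, $P_{\tilde U\tilde V\tilde Y_1}=P_{UVY_1}$, $P_{\tilde U\tilde V\tilde Y_2}=P_{UVY_2}$. Further $(\bar U,\bar V,\bar X,\bar Y_1,\bar Y_2)$ has joint pmf $\bar P_{XY_1Y_2}(x,y_1,y_2)P_{U|X}(u|x)P_{V|Y_1U}(v|y_1,u)$, i.e. $(\bar X,\bar Y_1,\bar Y_2)\sim\bar P_{XY_1Y_2}$, $P_{\bar U|\bar X}=P_{U|X}$, $P_{\bar V|\bar Y_1\bar U}=P_{V|Y_1U}$, with $\bar U-\bar X-(\bar Y_1,\bar Y_2)$ and $\bar V-(\bar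 Y_1,\bar U)-(\bar X,\bar Y_2)$ Markov chains. $D(\cdot\|\cdot)$ is Kullback–Leibler divergence. *)

theory Defs
  imports "HOL-Probability.Probability"
begin

definition pr :: "'a pmf \<Rightarrow> ('a \<Rightarrow> 'b) \<Rightarrow> 'b \<Rightarrow> real" where
  "pr J f a = pmf (map_pmf f J) a"

definition markov_chain :: "'a pmf \<Rightarrow> ('a \<Rightarrow> 'b) \<Rightarrow> ('a \<Rightarrow> 'c) \<Rightarrow> ('a \<Rightarrow> 'd) \<Rightarrow> bool" where
  "markov_chain J f g h \<longleftrightarrow>
     (\<forall>a b c. pr J (\<lambda>z. (f z, g z, h z)) (a, b, c) * pr J g b
              = pr J (\<lambda>z. (f z, g z)) (a, b) * pr J (\<lambda>z. (g z, h z)) (b, c))"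

text \<open>Mutual information I(F;G) (J of finite support).\<close>
definition mutual_inf :: "'a pmf \<Rightarrow> ('a \<Rightarrow> 'b) \<Rightarrow> ('a \<Rightarrow> 'c) \<Rightarrow> real" where
  "mutual_inf J f g =
     (\<Sum>(a, b)\<in>set_pmf (map_pmf (\<lambda>z. (f z, g z)) J).
        pr J (\<lambda>z. (f z, g z)) (a, b) *
        ln (pr J (\<lambda>z. (f z, g z)) (a, b) / (pr J f a * pr J g b)))"

text \<open>Conditional mutual information I(F;G|H) (J of finite support).\<close>
definition cond_mutual_inf :: "'a pmf \<Rightarrow> ('a \<Rightarrow> 'b) \<Rightarrow> ('a \<Rightarrow> 'c) \<Rightarrow> ('a \<Rightarrow> 'd) \<Rightarrow> real" where
  "cond_mutual_inf J f g h =
     (\<Sum>(a, b, c)\<in>set_pmf (map_pmf (\<lambda>z. (f z, g z, h z)) J).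
        pr J (\<lambda>z. (f z, g z, h z)) (a, b, c) *
        ln (pr J (\<lambda>z. (f z, g z, h z)) (a, b, c) * pr J h c /
            (pr J (\<lambda>z. (f z, h z)) (a, c) * pr J (\<lambda>z. (g z, h z)) (b, c))))"

text \<open>KL divergence D(p||q) of a finitely supported pmf p from a nonnegative weight
  function q; it is +\<infinity> if p is not absolutely continuous w.r.t. q.\<close>
definition KL :: "'a pmf \<Rightarrow> ('a \<Rightarrow> real) \<Rightarrow> ereal" where
  "KL p q = (if \<forall>a\<in>set_pmf p. q a > 0
             then ereal (\<Sum>a\<in>set_pmf p. pmf p a * ln (pmf p a / q a))
             else \<infinity>)"

text \<open>A joint law J of (U,V,X,Y1,Y2); U and V take values in nat, finite alphabets are
  expressed by finiteness of the support.\<close>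

type_synonym ('x, 'y1, 'y2) aux_law = "(nat \<times> nat \<times> 'x \<times> 'y1 \<times> 'y2) pmf"

definition gU :: "nat \<times> nat \<times> 'x \<times> 'y1 \<times> 'y2 \<Rightarrow> nat" where "gU = (\<lambda>(u,v,x,y1,y2). u)"
definition gV :: "nat \<times> nat \<times> 'x \<times> 'y1 \<times> 'y2 \<Rightarrow> nat" where "gV = (\<lambda>(u,v,x,y1,y2). v)"
definition gX :: "nat \<times> nat \<times> 'x \<times> 'y1 \<times> 'y2 \<Rightarrow> 'x" where "gX = (\<lambda>(u,v,x,y1,y2). x)"
definition gY1 :: "nat \<times> nat \<times> 'x \<times> 'y1 \<times> 'y2 \<Rightarrow> 'y1" where "gY1 = (\<lambda>(u,v,x,y1,y2). y1)"
definition gY2 :: "nat \<times> nat \<times> 'x \<times> 'y1 \<times> 'y2 \<Rightarrow> 'y2" where "gY2 = (\<lambda>(u,v,x,y1,y2). y2)"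

definition in_S :: "('x \<times> 'y1 \<times> 'y2) pmf \<Rightarrow> real \<Rightarrow> real \<Rightarrow> ('x, 'y1, 'y2) aux_law \<Rightarrow> bool" where
  "in_S P R1 R2 J \<longleftrightarrow>
     finite (set_pmf J) \<and>
     map_pmf (\<lambda>(u,v,x,y1,y2). (x,y1,y2)) J = P \<and>
     markov_chain J gU gX (\<lambda>z. (gY1 z, gY2 z)) \<and>
     markov_chain J gV (\<lambda>z. (gY1 z, gU z)) (\<lambda>z. (gY2 z, gX z)) \<and>
     mutual_inf J gU gX \<le> R1 \<and>
     cond_mutual_inf J gV gY1 gU \<le> R2"

definition condU :: "('x, 'y1, 'y2) aux_law \<Rightarrow> nat \<Rightarrow> 'x \<Rightarrow> real" where
  "condU J u x = pr J (\<lambda>z. (gU z, gX z)) (u, x) / pr J gX x"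

definition condV :: "('x, 'y1, 'y2) aux_law \<Rightarrow> nat \<Rightarrow> 'y1 \<Rightarrow> nat \<Rightarrow> real" where
  "condV J v y1 u = pr J (\<lambda>z. (gV z, gY1 z, gU z)) (v, y1, u) / pr J (\<lambda>z. (gY1 z, gU z)) (y1, u)"

definition bar1 :: "('x \<times> 'y1 \<times> 'y2) pmf \<Rightarrow> ('x, 'y1, 'y2) aux_law \<Rightarrow> nat \<times> 'x \<times> 'y1 \<Rightarrow> real" where
  "bar1 Pb J = (\<lambda>(u,x,y1). pr Pb (\<lambda>(x,y1,y2). (x,y1)) (x,y1) * condU J u x)"

definition bar2 :: "('x \<times> 'y1 \<times> 'y2) pmf \<Rightarrow> ('x, 'y1, 'y2) aux_law \<Rightarrow> nat \<times> nat \<times> 'x \<times> 'y1 \<times> 'y2 \<Rightarrow> real" where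
  "bar2 Pb J = (\<lambda>(u,v,x,y1,y2). pmf Pb (x,y1,y2) * condU J u x * condV J v y1 u)"

definition L1 :: "('x, 'y1, 'y2) aux_law \<Rightarrow> (nat \<times> 'x \<times> 'y1) pmf set" where
  "L1 J = {T. map_pmf (\<lambda>(u,x,y1). (u,x)) T = map_pmf (\<lambda>z. (gU z, gX z)) J \<and>
              map_pmf (\<lambda>(u,x,y1). (u,y1)) T = map_pmf (\<lambda>z. (gU z, gY1 z)) J}"

definition L2 :: "('x, 'y1, 'y2) aux_law \<Rightarrow> ('x, 'y1, 'y2) aux_law set" where
  "L2 J = {T. map_pmf (\<lambda>z. (gU z, gX z)) T = map_pmf (\<lambda>z. (gU z, gX z)) J \<and>
              map_pmf (\<lambda>z. (gU z, gV z, gY1 z)) T = map_pmf (\<lambda>z. (gU z, gV z, gY1 z)) J \<and>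
              map_pmf (\<lambda>z. (gU z, gV z, gY2 z)) T = map_pmf (\<lambda>z. (gU z, gV z, gY2 z)) J}"

text \<open>Length-n i.i.d. sample; sequences are functions on {..<n} (fixed default elsewhere).\<close>
definition iid :: "nat \<Rightarrow> 'a pmf \<Rightarrow> (nat \<Rightarrow> 'a) pmf" where
  "iid n Q = Pi_pmf {..<n} undefined (\<lambda>_. Q)"

definition seqX :: "(nat \<Rightarrow> 'x \<times> 'y1 \<times> 'y2) \<Rightarrow> nat \<Rightarrow> 'x" where
  "seqX w = (\<lambda>t. fst (w t))"
definition seqY1 :: "(nat \<Rightarrow> 'x \<times> 'y1 \<times> 'y2) \<Rightarrow> nat \<Rightarrow> 'y1" where
  "seqY1 w = (\<lambda>t. fst (snd (w t)))"
definition seqY2 :: "(nat \<Rightarrow> 'x \<times> 'y1 \<times> 'y2) \<Rightarrow> nat \<Rightarrow> 'y2" where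
  "seqY2 w = (\<lambda>t. snd (snd (w t)))"

text \<open>A code: message set sizes M1, M2, encoder f1, relay map f2 at Detector 1,
  decisions g1 (Detector 1) and g2 (Detector 2), values in {1..M1}, {1..M2}, {1,2}.\<close>
definition code_ok :: "nat \<Rightarrow> nat \<Rightarrow> ((nat \<Rightarrow> 'x) \<Rightarrow> nat) \<Rightarrow> (nat \<Rightarrow> (nat \<Rightarrow> 'y1) \<Rightarrow> nat)
    \<Rightarrow> (nat \<Rightarrow> (nat \<Rightarrow> 'y1) \<Rightarrow> nat) \<Rightarrow> (nat \<Rightarrow> nat \<Rightarrow> (nat \<Rightarrow> 'y2) \<Rightarrow> nat) \<Rightarrow> bool" where
  "code_ok M1 M2 f1 f2 g1 g2 \<longleftrightarrow>
     (\<forall>xs. f1 xs \<in> {1..M1}) \<and>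
     (\<forall>m ys. m \<in> {1..M1} \<longrightarrow> f2 m ys \<in> {1..M2}) \<and>
     (\<forall>m ys. g1 m ys \<in> {1, 2}) \<and>
     (\<forall>m1 m2 ys. g2 m1 m2 ys \<in> {1, 2})"

definition dec1 :: "((nat \<Rightarrow> 'x) \<Rightarrow> nat) \<Rightarrow> (nat \<Rightarrow> (nat \<Rightarrow> 'y1) \<Rightarrow> nat)
    \<Rightarrow> (nat \<Rightarrow> 'x \<times> 'y1 \<times> 'y2) \<Rightarrow> nat" where
  "dec1 f1 g1 w = g1 (f1 (seqX w)) (seqY1 w)"

definition dec2 :: "((nat \<Rightarrow> 'x) \<Rightarrow> nat) \<Rightarrow> (nat \<Rightarrow> (nat \<Rightarrow> 'y1) \<Rightarrow> nat)
    \<Rightarrow> (nat \<Rightarrow> nat \<Rightarrow> (nat \<Rightarrow> 'y2) \<Rightarrow> nat) \<Rightarrow> (nat \<Rightarrow> 'x \<times> 'y1 \<times> 'y2) \<Rightarrow> nat" where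
  "dec2 f1 f2 g2 w = g2 (f1 (seqX w)) (f2 (f1 (seqX w)) (seqY1 w)) (seqY2 w)"

definition err :: "nat \<Rightarrow> ('x \<times> 'y1 \<times> 'y2) pmf \<Rightarrow> ((nat \<Rightarrow> 'x \<times> 'y1 \<times> 'y2) \<Rightarrow> nat) \<Rightarrow> nat \<Rightarrow> real" where
  "err n Q d k = measure_pmf.prob (iid n Q) {w. d w \<noteq> k}"

definition expo :: "nat \<Rightarrow> real \<Rightarrow> ereal" where
  "expo n b = (if b = 0 then \<infinity> else ereal (- ln b / real n))"

definition achievable :: "('x \<times> 'y1 \<times> 'y2) pmf \<Rightarrow> ('x \<times> 'y1 \<times> 'y2) pmf \<Rightarrow> real \<Rightarrow> real
    \<Rightarrow> real \<Rightarrow> real \<Rightarrow> real \<times> real \<Rightarrow> bool" where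
  "achievable P Pb R1 R2 e1 e2 th \<longleftrightarrow>
     (\<exists>(M1 :: nat \<Rightarrow> nat) (M2 :: nat \<Rightarrow> nat) (f1 :: nat \<Rightarrow> (nat \<Rightarrow> 'x) \<Rightarrow> nat)
        (f2 :: nat \<Rightarrow> nat \<Rightarrow> (nat \<Rightarrow> 'y1) \<Rightarrow> nat) (g1 :: nat \<Rightarrow> nat \<Rightarrow> (nat \<Rightarrow> 'y1) \<Rightarrow> nat)
        (g2 :: nat \<Rightarrow> nat \<Rightarrow> nat \<Rightarrow> (nat \<Rightarrow> 'y2) \<Rightarrow> nat).
       (\<forall>n. code_ok (M1 n) (M2 n) (f1 n) (f2 n) (g1 n) (g2 n)) \<and>
       limsup (\<lambda>n. ereal (err n P (dec1 (f1 n) (g1 n)) 1)) \<le> ereal e1 \<and>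
       limsup (\<lambda>n. ereal (err n P (dec2 (f1 n) (f2 n) (g2 n)) 1)) \<le> ereal e2 \<and>
       ereal (fst th) \<le> liminf (\<lambda>n. expo n (err n Pb (dec1 (f1 n) (g1 n)) 2)) \<and>
       ereal (snd th) \<le> liminf (\<lambda>n. expo n (err n Pb (dec2 (f1 n) (f2 n) (g2 n)) 2)) \<and>
       limsup (\<lambda>n. ereal (ln (real (M1 n)) / real n)) \<le> ereal R1 \<and>
       limsup (\<lambda>n. ereal (ln (real (M2 n)) / real n)) \<le> ereal R2)"

definition region :: "('x \<times> 'y1 \<times> 'y2) pmf \<Rightarrow> ('x \<times> 'y1 \<times> 'y2) pmf \<Rightarrow> real \<Rightarrow> real
    \<Rightarrow> real \<Rightarrow> real \<Rightarrow> (real \<times> real) set" where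
  "region P Pb R1 R2 e1 e2 = closure {th. achievable P Pb R1 R2 e1 e2 th}"

end

theory Submission
  imports Defs
begin

text \<open>
  The code is deterministic. A Feinstein-type greedy choice of codewords u with disjoint cells of
  source sequences x that are jointly typical with u covers almost all of the source: what is left
  uncovered would otherwise have small mass in every cell, whereas the test channel moves its mass
  to typical pairs. The cell of u only admits those x for which, conditionally on x and u, the
  remaining variables are typical with high probability. This replaces the Markov lemma and lets the same
  greedy choice run a second time at Detector 1, under the law of the source restricted to the cell.

  Both detectors accept if their observation is consistent with joint typicality, so an erroneous
  acceptance forces the joint type of codewords and observations to have nearly the marginals
  that define L1, respectively L2. A union bound over the codewords and the
  method of types bound its probability; since P(U,X), P(U,V,Y1) are prescribed, the
  divergence from P(U) (or P(U,V)) times the alternative exceeds the divergence in the theorem by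
  exactly I(U;X) (or I(U;X) + I(V;Y1|U)), which cancels the number of codewords.
  Letting all tolerances tend to 0 along a diagonal attains the exponents and rates exactly.
\<close>

section \<open>Greedy covering\<close>

text \<open>The null error must vanish while false acceptance stays exponentially rare, and the two
  tasks are decoupled: the bound on false acceptance is uniform in the codeword, so it survives a
  union bound over any codebook of the right size, and the choice of codewords only has to serve the
  null hypothesis. The codebook size comes from a density ratio: on typical sequences the test
  channel exceeds a reference law of u by at most a factor K = exp(n(I + \<epsilon>)), and K/\<eta>
  codewords leave at most a fraction \<eta> uncovered beyond the atypical part. For v the reference
  law depends on u, which both detectors can recover from the first message; this gives I(V;Y1|U).
  The exponents are minima under exact marginals, whereas typicality controls marginals only up to
  \<delta>. Positivity of the alternative keeps the divergence finite and continuous on the whole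
  simplex of types, so compactness bridges this gap at a loss \<epsilon>; hence \<delta> is fixed
  after \<epsilon> and before n.\<close>

text \<open>Each chosen u claims a cell of mass at least a fraction 1/L of the total, so a longest
  greedy run has at most L steps; when it stops, no u has much unclaimed mass left in its cell.\<close>
lemma greedy_covering:
  fixes q :: "'x \<Rightarrow> real" and W :: "'x \<Rightarrow> 'u \<Rightarrow> real" and r :: "'u \<Rightarrow> real"
  assumes fin: "finite Sx" "finite Su"
    and q0: "\<And>x. x \<in> Sx \<Longrightarrow> 0 \<le> q x"
    and W0: "\<And>x u. x \<in> Sx \<Longrightarrow> u \<in> Su \<Longrightarrow> 0 \<le> W x u"
    and W1: "\<And>x. x \<in> Sx \<Longrightarrow> q x > 0 \<Longrightarrow> (\<Sum>u\<in>Su. W x u) = 1"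
    and r0: "\<And>u. u \<in> Su \<Longrightarrow> 0 \<le> r u" and r1: "(\<Sum>u\<in>Su. r u) \<le> 1"
    and K: "\<And>x u. x \<in> Sx \<Longrightarrow> u \<in> Su \<Longrightarrow> x \<in> A u \<Longrightarrow> W x u \<le> K * r u" "0 \<le> K"
    and L: "0 < L"
  obtains \<phi> :: "'x \<Rightarrow> 'u option" where
    "\<And>x u. \<phi> x = Some u \<Longrightarrow> x \<in> Sx \<and> x \<in> A u \<and> u \<in> Su"
    "finite (ran \<phi>)" "real (card (ran \<phi>)) \<le> L"
    "(\<Sum>x\<in>{x\<in>Sx. \<phi> x = None}. q x)
       \<le> (\<Sum>x\<in>Sx. q x * (\<Sum>u\<in>{u\<in>Su. x \<notin> A u}. W x u)) + K * (\<Sum>x\<in>Sx. q x) / L"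
proof -
  define Q where "Q = (\<Sum>x\<in>Sx. q x)"
  have Q0: "Q \<ge> 0" unfolding Q_def by (intro sum_nonneg q0)
  have bad0: "0 \<le> (\<Sum>x\<in>Sx. q x * (\<Sum>u\<in>{u\<in>Su. x \<notin> A u}. W x u))"
    by (intro sum_nonneg mult_nonneg_nonneg q0 W0) auto
  show thesis
  proof (cases "Q = 0")
    case True
    show thesis
      by (rule that[of Map.empty]) (use True Q_def bad0 L in auto)
  next
    case False
    with Q0 have Qp: "Q > 0" by simp
    define None_mass where "None_mass \<phi> = (\<Sum>x\<in>{x\<in>Sx. \<phi> x = None}. q x)" for \<phi> :: "'x \<Rightarrow> 'u option"
    \<comment> \<open>A run of m steps is recorded only by its effect: the uncovered mass has
      dropped by m times Q/L. The number of codewords is bounded by m rather than equal to it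
      because a u may be chosen again.\<close>
    define ok where "ok m \<longleftrightarrow> (\<exists>\<phi>. (\<forall>x u. \<phi> x = Some u \<longrightarrow> x \<in> Sx \<and> x \<in> A u \<and> u \<in> Su)
       \<and> finite (ran \<phi>) \<and> card (ran \<phi>) \<le> m \<and> None_mass \<phi> \<le> Q - real m * Q / L)" for m
    have ok0: "ok 0"
      unfolding ok_def by (intro exI[of _ Map.empty]) (simp add: None_mass_def Q_def)
    have okL: "real m \<le> L" if "ok m" for m
    proof -
      from that obtain \<phi> where "None_mass \<phi> \<le> Q - real m * Q / L" unfolding ok_def by blast
      moreover have "0 \<le> None_mass \<phi>" unfolding None_mass_def by (intro sum_nonneg q0) auto
      ultimately have "real m * Q / L \<le> Q" by linarith
      with Qp L show ?thesis by (simp add: field_simps)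
    qed
    have okb: "m \<le> nat \<lfloor>L\<rfloor>" if "ok m" for m
      using okL[OF that] by linarith
    define m where "m = (GREATEST m. ok m)"
    have okm: "ok m" unfolding m_def using ok0 okb by (rule GreatestI_nat)
    have max: "\<not> ok (Suc m)"
    proof
      assume "ok (Suc m)"
      then have "Suc m \<le> m" unfolding m_def using okb by (rule Greatest_le_nat)
      then show False by simp
    qed
    obtain \<phi> where \<phi>: "\<And>x u. \<phi> x = Some u \<Longrightarrow> x \<in> Sx \<and> x \<in> A u \<and> u \<in> Su"
       "finite (ran \<phi>)" "card (ran \<phi>) \<le> m" "None_mass \<phi> \<le> Q - real m * Q / L"
      using okm unfolding ok_def by blast
    define N where "N = {x\<in>Sx. \<phi> x = None}"
    have finN: "finite N" using fin by (simp add: N_def)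
    have small: "(\<Sum>x\<in>{x\<in>N. x \<in> A u}. q x) \<le> Q / L" if u: "u \<in> Su" for u
    proof (rule ccontr)
      assume "\<not> ?thesis"
      hence big: "Q / L < (\<Sum>x\<in>{x\<in>N. x \<in> A u}. q x)" by simp
      define \<psi> where "\<psi> = (\<lambda>x. if x \<in> N \<and> x \<in> A u then Some u else \<phi> x)"
      have "ran \<psi> \<subseteq> insert u (ran \<phi>)" by (auto simp: \<psi>_def ran_def split: if_splits)
      hence "finite (ran \<psi>)" "card (ran \<psi>) \<le> card (insert u (ran \<phi>))"
        using \<phi>(2) by (auto intro: finite_subset card_mono)
      moreover have "card (insert u (ran \<phi>)) \<le> Suc m"
        using \<phi>(2,3) by (simp add: card_insert_if)
      moreover have "None_mass \<psi> \<le> Q - real (Suc m) * Q / L"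
      proof -
        have "{x\<in>Sx. \<psi> x = None} = N - {x\<in>N. x \<in> A u}"
          by (auto simp: \<psi>_def N_def)
        hence "None_mass \<psi> = None_mass \<phi> - (\<Sum>x\<in>{x\<in>N. x \<in> A u}. q x)"
          unfolding None_mass_def N_def[symmetric] using finN by (simp add: sum_diff)
        also have "\<dots> \<le> Q - real m * Q / L - Q / L" using \<phi>(4) big by simp
        finally show ?thesis by (simp add: add_divide_distrib algebra_simps)
      qed
      moreover have "\<forall>x u. \<psi> x = Some u \<longrightarrow> x \<in> Sx \<and> x \<in> A u \<and> u \<in> Su"
        using \<phi>(1) u by (auto simp: \<psi>_def N_def)
      ultimately show False using max unfolding ok_def by (meson le_trans)
    qed
    \<comment> \<open>The uncovered mass is spread over the u by the test channel. Pairs with x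
      outside the cell of u form the error term; for the others the order of summation is exchanged,
      so that \<open>small\<close> bounds the uncovered mass in each cell and the weights r u sum to
      at most 1.\<close>
    have "(\<Sum>x\<in>N. q x) = (\<Sum>x\<in>N. \<Sum>u\<in>Su. q x * W x u)"
    proof (rule sum.cong[OF refl])
      fix x assume x: "x \<in> N"
      then have "x \<in> Sx" by (simp add: N_def)
      then show "q x = (\<Sum>u\<in>Su. q x * W x u)"
        using W1[of x] q0[of x] by (cases "q x = 0") (auto simp: sum_distrib_left[symmetric])
    qed
    also have "\<dots> = (\<Sum>x\<in>N. (\<Sum>u\<in>{u\<in>Su. x \<notin> A u}. q x * W x u) + (\<Sum>u\<in>{u\<in>Su. x \<in> A u}. q x * W x u))"
    proof (rule sum.cong[OF refl])
      fix x
      have "Su = {u\<in>Su. x \<notin> A u} \<union> {u\<in>Su. x \<in> A u}" by auto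
      then show "(\<Sum>u\<in>Su. q x * W x u) = (\<Sum>u\<in>{u\<in>Su. x \<notin> A u}. q x * W x u) + (\<Sum>u\<in>{u\<in>Su. x \<in> A u}. q x * W x u)"
        using fin by (subst sum.union_disjoint[symmetric]) auto
    qed
    also have "\<dots> = (\<Sum>x\<in>N. q x * (\<Sum>u\<in>{u\<in>Su. x \<notin> A u}. W x u))
        + (\<Sum>x\<in>N. \<Sum>u\<in>{u\<in>Su. x \<in> A u}. q x * W x u)"
      by (simp add: sum.distrib sum_distrib_left)
    also have "(\<Sum>x\<in>N. q x * (\<Sum>u\<in>{u\<in>Su. x \<notin> A u}. W x u))
        \<le> (\<Sum>x\<in>Sx. q x * (\<Sum>u\<in>{u\<in>Su. x \<notin> A u}. W x u))"
      by (rule sum_mono2) (use fin in \<open>auto simp: N_def intro!: mult_nonneg_nonneg q0 sum_nonneg W0\<close>)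
    also have "(\<Sum>x\<in>N. \<Sum>u\<in>{u\<in>Su. x \<in> A u}. q x * W x u)
        \<le> (\<Sum>x\<in>N. \<Sum>u\<in>{u\<in>Su. x \<in> A u}. K * r u * q x)"
    proof (intro sum_mono)
      fix x u assume "x \<in> N" "u \<in> {u\<in>Su. x \<in> A u}"
      then have "W x u \<le> K * r u" "0 \<le> q x" using K q0 by (auto simp: N_def)
      then show "q x * W x u \<le> K * r u * q x" using mult_left_mono[of "W x u" "K * r u" "q x"]
        by (simp add: mult.commute)
    qed
    also have "\<dots> = (\<Sum>u\<in>Su. \<Sum>x\<in>{x\<in>N. x \<in> A u}. K * r u * q x)"
      by (rule sum.swap_restrict) (use fin finN in auto)
    also have "\<dots> = (\<Sum>u\<in>Su. K * r u * (\<Sum>x\<in>{x\<in>N. x \<in> A u}. q x))"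
      by (simp add: sum_distrib_left)
    also have "\<dots> \<le> (\<Sum>u\<in>Su. K * r u * (Q / L))"
      by (intro sum_mono mult_left_mono small mult_nonneg_nonneg r0 K(2))
    also have "\<dots> = (\<Sum>u\<in>Su. r u) * (K * (Q / L))"
      by (simp add: sum_distrib_right mult_ac sum_divide_distrib sum_distrib_left)
    also have "\<dots> \<le> 1 * (K * (Q / L))"
      by (rule mult_right_mono[OF r1]) (use K(2) Qp L in auto)
    finally have "(\<Sum>x\<in>N. q x) \<le> (\<Sum>x\<in>Sx. q x * (\<Sum>u\<in>{u\<in>Su. x \<notin> A u}. W x u)) + K * Q / L"
      by simp
    moreover have "real (card (ran \<phi>)) \<le> L" using \<phi>(3) okL[OF okm] by linarith
    ultimately show thesis using that[of \<phi>] \<phi>(1,2) by (simp add: N_def Q_def)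
  qed
qed

lemma sum_Un_le:
  fixes f :: "'a \<Rightarrow> real"
  assumes "finite A" "finite B" "\<And>x. 0 \<le> f x"
  shows "(\<Sum>x\<in>A \<union> B. f x) \<le> (\<Sum>x\<in>A. f x) + (\<Sum>x\<in>B. f x)"
  using sum.union_inter[OF assms(1,2), of f] sum_nonneg[of "A \<inter> B" f] assms(3) by simp

lemma prob_bind_finite:
  assumes "finite (set_pmf p)"
  shows "measure_pmf.prob (bind_pmf p f) B = (\<Sum>x\<in>set_pmf p. pmf p x * measure_pmf.prob (f x) B)"
proof -
  have "ennreal (measure_pmf.prob (bind_pmf p f) B) = (\<integral>\<^sup>+x. ennreal (measure_pmf.prob (f x) B) \<partial>p)"
    by (simp add: measure_pmf.emeasure_eq_measure[symmetric])
  also have "\<dots> = ennreal (\<integral>x. measure_pmf.prob (f x) B \<partial>p)"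
    by (rule nn_integral_eq_integral)
       (auto intro!: measure_pmf.integrable_const_bound[where B=1])
  finally have "measure_pmf.prob (bind_pmf p f) B = (\<integral>x. measure_pmf.prob (f x) B \<partial>p)"
    by (simp add: integral_nonneg)
  also have "\<dots> = (\<Sum>x\<in>set_pmf p. pmf p x * measure_pmf.prob (f x) B)"
    by (subst integral_measure_pmf_real[where A="set_pmf p"]) (auto simp: assms mult.commute)
  finally show ?thesis .
qed

text \<open>Markov's inequality turns the average badness b into a pointwise guarantee: the cell of
  u consists of the x whose conditional mean badness is at most \<eta>, and the pairs excluded by
  this have test channel mass at most the overall mean badness divided by \<eta>. The weight p is
  not normalized, so that the lemma also applies to a source restricted to a cell.\<close>

lemma threshold_covering:
  fixes p :: "'z \<Rightarrow> real" and X :: "'z \<Rightarrow> 'x" and W :: "'x \<Rightarrow> 'u pmf" and r :: "'u pmf"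
    and b :: "'u \<Rightarrow> 'z \<Rightarrow> real"
  assumes finZ: "finite Z" and finW: "\<And>x. finite (set_pmf (W x))"
    and p0: "\<And>z. z \<in> Z \<Longrightarrow> 0 \<le> p z"
    and b0: "\<And>u z. 0 \<le> b u z" and b1: "\<And>u z. b u z \<le> 1"
    and K: "\<And>u z. z \<in> Z \<Longrightarrow> b u z < 1 \<Longrightarrow> pmf (W (X z)) u \<le> K * pmf r u" and "0 < K"
    and \<eta>: "0 < \<eta>" "\<eta> < 1" and "0 < \<delta>"
  obtains \<phi> :: "'x \<Rightarrow> 'u option" where
    "\<And>x u. \<phi> x = Some u \<Longrightarrow> \<exists>z\<in>Z. X z = x \<and> b u z < 1"
    "\<And>x u. \<phi> x = Some u \<Longrightarrow> (\<Sum>z | z \<in> Z \<and> X z = x. p z * b u z) \<le> \<eta> * (\<Sum>z | z \<in> Z \<and> X z = x. p z)"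
    "finite (ran \<phi>)" "real (card (ran \<phi>)) \<le> K / \<delta>"
    "(\<Sum>z | z \<in> Z \<and> \<phi> (X z) = None. p z)
       \<le> (\<Sum>z\<in>Z. p z * measure_pmf.expectation (W (X z)) (\<lambda>u. b u z)) / \<eta> + \<delta> * (\<Sum>z\<in>Z. p z)"
proof -
  define q where "q x = (\<Sum>z | z \<in> Z \<and> X z = x. p z)" for x
  define c where "c u x = (\<Sum>z | z \<in> Z \<and> X z = x. p z * b u z)" for u x
  \<comment> \<open>If q x = 0 the threshold condition holds trivially; the existence clause secures
    even then a z at which the density bound with K is available.\<close>
  define A where "A u = {x. (\<exists>z\<in>Z. X z = x \<and> b u z < 1) \<and> c u x \<le> \<eta> * q x}" for u
  define Su where "Su = (\<Union>z\<in>Z. set_pmf (W (X z)))"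
  have finSu: "finite Su" using finZ finW by (auto simp: Su_def)
  have q0: "0 \<le> q x" for x unfolding q_def by (intro sum_nonneg p0) auto
  have c0: "0 \<le> c u x" for u x
    unfolding c_def by (intro sum_nonneg mult_nonneg_nonneg p0 b0) auto
  have notA: "\<eta> * q x \<le> c u x" if "x \<notin> A u" for u x
  proof (cases "\<exists>z\<in>Z. X z = x \<and> b u z < 1")
    case True
    with that show ?thesis by (auto simp: A_def)
  next
    case False
    then have "b u z = 1" if "z \<in> Z" "X z = x" for z using b1[of u z] that by force
    then have "c u x = q x" unfolding c_def q_def by (intro sum.cong) auto
    with \<eta> q0[of x] show ?thesis by (simp add: mult_left_le_one_le)
  qed
  have Wsum: "(\<Sum>u\<in>Su. pmf (W x) u) = 1" if "x \<in> X ` Z" for x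
    by (rule sum_pmf_eq_1) (use that finSu in \<open>auto simp: Su_def\<close>)
  have sub: "\<And>x u. x \<in> X ` Z \<Longrightarrow> u \<in> Su \<Longrightarrow> x \<in> A u \<Longrightarrow> pmf (W x) u \<le> K * pmf r u"
  proof -
    fix x u assume "x \<in> A u"
    then obtain z where "z \<in> Z" "X z = x" "b u z < 1" by (auto simp: A_def)
    with K[of z u] show "pmf (W x) u \<le> K * pmf r u" by simp
  qed
  have r1: "(\<Sum>u\<in>Su. pmf r u) \<le> 1"
    using measure_measure_pmf_finite[OF finSu, of r] by (metis measure_pmf.prob_le_1)
  have Kd: "0 < K / \<delta>" using \<open>0 < K\<close> \<open>0 < \<delta>\<close> by simp
  \<comment> \<open>With L = K/\<delta> the leftover K Q / L of the greedy covering becomes \<delta>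
    Q.\<close>
  obtain \<phi> where \<phi>: "\<And>x u. \<phi> x = Some u \<Longrightarrow> x \<in> X ` Z \<and> x \<in> A u \<and> u \<in> Su"
    "finite (ran \<phi>)" "real (card (ran \<phi>)) \<le> K / \<delta>"
    "(\<Sum>x\<in>{x\<in>X ` Z. \<phi> x = None}. q x)
       \<le> (\<Sum>x\<in>X ` Z. q x * (\<Sum>u\<in>{u\<in>Su. x \<notin> A u}. pmf (W x) u)) + K * (\<Sum>x\<in>X ` Z. q x) / (K / \<delta>)"
    by (rule greedy_covering[of "X ` Z" Su q "\<lambda>x u. pmf (W x) u" "pmf r" A K "K / \<delta>"])
      (use finZ finSu q0 Wsum sub r1 Kd \<open>0 < K\<close> in auto)
  note \<phi>(4)
  also have "(\<Sum>x\<in>X ` Z. q x * (\<Sum>u\<in>{u\<in>Su. x \<notin> A u}. pmf (W x) u))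
     \<le> (\<Sum>x\<in>X ` Z. (\<Sum>u\<in>Su. pmf (W x) u * c u x) / \<eta>)"
  proof (rule sum_mono)
    fix x assume "x \<in> X ` Z"
    have "q x * (\<Sum>u\<in>{u\<in>Su. x \<notin> A u}. pmf (W x) u) = (\<Sum>u\<in>{u\<in>Su. x \<notin> A u}. pmf (W x) u * q x)"
      by (simp add: sum_distrib_left mult.commute)
    also have "\<dots> \<le> (\<Sum>u\<in>{u\<in>Su. x \<notin> A u}. pmf (W x) u * (c u x / \<eta>))"
      by (intro sum_mono mult_left_mono) (use notA \<eta> in \<open>auto simp: field_simps\<close>)
    also have "\<dots> \<le> (\<Sum>u\<in>Su. pmf (W x) u * (c u x / \<eta>))"
      by (rule sum_mono2) (use finSu c0 \<eta> in auto)
    finally show "q x * (\<Sum>u\<in>{u\<in>Su. x \<notin> A u}. pmf (W x) u) \<le> (\<Sum>u\<in>Su. pmf (W x) u * c u x) / \<eta>"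
      by (simp add: sum_divide_distrib)
  qed
  also have "(\<Sum>x\<in>X ` Z. (\<Sum>u\<in>Su. pmf (W x) u * c u x) / \<eta>)
     = (\<Sum>x\<in>X ` Z. \<Sum>z | z \<in> Z \<and> X z = x. p z * (\<Sum>u\<in>Su. pmf (W (X z)) u * b u z)) / \<eta>"
    unfolding c_def sum_divide_distrib[symmetric] sum_distrib_left
    by (subst sum.swap) (auto intro!: arg_cong[where f="\<lambda>x. x / \<eta>"] sum.cong simp: mult_ac)
  also have "(\<Sum>x\<in>X ` Z. \<Sum>z | z \<in> Z \<and> X z = x. p z * (\<Sum>u\<in>Su. pmf (W (X z)) u * b u z))
     = (\<Sum>z\<in>Z. p z * (\<Sum>u\<in>Su. pmf (W (X z)) u * b u z))"
    by (rule sum.image_gen[symmetric]) (rule finZ)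
  also have "\<dots> = (\<Sum>z\<in>Z. p z * measure_pmf.expectation (W (X z)) (\<lambda>u. b u z))"
    by (intro sum.cong refl arg_cong2[where f=times], subst integral_measure_pmf_real[OF finSu])
       (auto simp: Su_def mult.commute)
  finally have "(\<Sum>x\<in>{x\<in>X ` Z. \<phi> x = None}. q x)
     \<le> (\<Sum>z\<in>Z. p z * measure_pmf.expectation (W (X z)) (\<lambda>u. b u z)) / \<eta> + K * (\<Sum>x\<in>X ` Z. q x) / (K / \<delta>)" by simp
  moreover have "(\<Sum>z | z \<in> Z \<and> \<phi> (X z) = None. p z) = (\<Sum>x\<in>{x\<in>X ` Z. \<phi> x = None}. q x)"
  proof -
    have "(\<Sum>z | z \<in> Z \<and> \<phi> (X z) = None. p z) = (\<Sum>x\<in>X ` {z. z \<in> Z \<and> \<phi> (X z) = None}. \<Sum>z | z \<in> {z. z \<in> Z \<and> \<phi> (X z) = None} \<and> X z = x. p z)"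
      by (rule sum.image_gen) (use finZ in simp)
    also have "\<dots> = (\<Sum>x\<in>{x\<in>X ` Z. \<phi> x = None}. q x)"
      unfolding q_def by (rule sum.cong) (auto intro!: sum.cong)
    finally show ?thesis .
  qed
  moreover have "(\<Sum>x\<in>X ` Z. q x) = (\<Sum>z\<in>Z. p z)"
    unfolding q_def by (rule sum.image_gen[symmetric]) (rule finZ)
  ultimately show thesis
    using that[of \<phi>] \<phi>(1-3) \<open>0 < K\<close> \<open>0 < \<delta>\<close>
    by (simp add: A_def q_def c_def mult.commute)
qed

text \<open>The error budget \<open>\<eta>\<^sup>2\<close> in the first stage leaves \<open>\<eta>\<close> for the
  second stage after one more application of Markov's inequality.\<close>
lemma two_stage_covering:
  fixes p :: "'z pmf" and X :: "'z \<Rightarrow> 'x" and Y :: "'z \<Rightarrow> 'y"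
    and W1 :: "'x \<Rightarrow> 'u pmf" and W2 :: "'u \<Rightarrow> 'y \<Rightarrow> 'v pmf"
    and r1 :: "'u pmf" and r2 :: "'u \<Rightarrow> 'v pmf" and T :: "'u \<Rightarrow> 'v \<Rightarrow> 'z \<Rightarrow> bool"
  assumes fin: "finite (set_pmf p)" "\<And>x. finite (set_pmf (W1 x))" "\<And>u y. finite (set_pmf (W2 u y))"
    and err: "measure_pmf.prob (bind_pmf p (\<lambda>z. bind_pmf (W1 (X z)) (\<lambda>u.
        map_pmf (\<lambda>v. (u, v, z)) (W2 u (Y z))))) {(u, v, z). \<not> T u v z} \<le> \<zeta>"
    and K1: "\<And>u v z. T u v z \<Longrightarrow> pmf (W1 (X z)) u \<le> K1 * pmf r1 u" "0 < K1"
    and K2: "\<And>u v z. T u v z \<Longrightarrow> pmf (W2 u (Y z)) v \<le> K2 * pmf (r2 u) v" "0 < K2"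
    and \<eta>: "0 < \<eta>" "\<eta> < 1"
  obtains \<phi>1 :: "'x \<Rightarrow> 'u option" and \<phi>2 :: "'u \<Rightarrow> 'y \<Rightarrow> 'v option" where
    "\<And>x u. \<phi>1 x = Some u \<Longrightarrow> \<exists>v z. X z = x \<and> T u v z"
    "\<And>u y v. \<phi>2 u y = Some v \<Longrightarrow> \<exists>z. Y z = y \<and> T u v z"
    "finite (ran \<phi>1)" "real (card (ran \<phi>1)) \<le> K1 / \<eta>"
    "\<And>u. finite (ran (\<phi>2 u))" "\<And>u. real (card (ran (\<phi>2 u))) \<le> K2 / \<eta>"
    "measure_pmf.prob p {z. \<not> (\<exists>u v. \<phi>1 (X z) = Some u \<and> \<phi>2 u (Y z) = Some v \<and> T u v z)}
       \<le> \<zeta> / \<eta>\<^sup>2 + 4 * \<eta>"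
proof -
  define Z where "Z = set_pmf p"
  have finZ: "finite Z" using fin by (simp add: Z_def)
  \<comment> \<open>The badness of u at the first stage is the probability that the channel to v,
    applied to the side information Y z, misses T. If it is below 1, some v completes the triple,
    and this is all that the density bound for u requires.\<close>
  define b1 where "b1 u z = measure_pmf.prob (W2 u (Y z)) {v. \<not> T u v z}" for u z
  have sum1: "(\<Sum>z\<in>Z. pmf p z) = 1" using finZ by (simp add: Z_def sum_pmf_eq_1)
  have \<zeta>: "(\<Sum>z\<in>Z. pmf p z * measure_pmf.expectation (W1 (X z)) (\<lambda>u. b1 u z)) \<le> \<zeta>"
  proof -
    have "measure_pmf.prob (bind_pmf (W1 (X z)) (\<lambda>u. map_pmf (\<lambda>v. (u, v, z)) (W2 u (Y z)))) {(u, v, z). \<not> T u v z}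
       = measure_pmf.expectation (W1 (X z)) (\<lambda>u. b1 u z)" for z
      by (subst prob_bind_finite, use fin in simp, subst integral_measure_pmf_real[where A="set_pmf (W1 (X z))"])
         (use fin in \<open>auto simp: b1_def mult.commute vimage_def\<close>)
    with err fin(1) show ?thesis by (subst (asm) prob_bind_finite) (auto simp: Z_def)
  qed
  have b1_less: "\<exists>v. T u v z" if "b1 u z < 1" for u z
  proof (rule ccontr)
    assume "\<not> (\<exists>v. T u v z)"
    then have "b1 u z = 1" by (simp add: b1_def)
    with that show False by simp
  qed
  have W1_le: "pmf (W1 (X z)) u \<le> K1 * pmf r1 u" if "b1 u z < 1" for u z
    using b1_less[OF that] K1(1) by blast
  have \<eta>2: "0 < \<eta>\<^sup>2" "\<eta>\<^sup>2 < 1" using \<eta> by (auto simp: power_less_one_iff)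
  obtain \<phi>1 where \<phi>1:
    "\<And>x u. \<phi>1 x = Some u \<Longrightarrow> \<exists>z\<in>Z. X z = x \<and> b1 u z < 1"
    "\<And>x u. \<phi>1 x = Some u \<Longrightarrow> (\<Sum>z | z \<in> Z \<and> X z = x. pmf p z * b1 u z) \<le> \<eta>\<^sup>2 * (\<Sum>z | z \<in> Z \<and> X z = x. pmf p z)"
    "finite (ran \<phi>1)" "real (card (ran \<phi>1)) \<le> K1 / \<eta>"
    "(\<Sum>z | z \<in> Z \<and> \<phi>1 (X z) = None. pmf p z)
       \<le> (\<Sum>z\<in>Z. pmf p z * measure_pmf.expectation (W1 (X z)) (\<lambda>u. b1 u z)) / \<eta>\<^sup>2 + \<eta> * (\<Sum>z\<in>Z. pmf p z)"
    by (rule threshold_covering[of Z W1 "pmf p" b1 X K1 r1 "\<eta>\<^sup>2" \<eta>])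
       (use finZ fin \<eta> \<eta>2 K1(2) W1_le in \<open>auto simp: b1_def\<close>)
  \<comment> \<open>The cells \<open>Zu u\<close> are disjoint and their masses \<open>m u\<close>
    add up to at most 1, so losses proportional to \<open>m u\<close> may be summed over the
    codewords without regard to their number.\<close>
  define Zu where "Zu u = {z\<in>Z. \<phi>1 (X z) = Some u}" for u
  have finZu: "finite (Zu u)" for u using finZ by (simp add: Zu_def)
  define m where "m u = (\<Sum>z\<in>Zu u. pmf p z)" for u
  have msum: "(\<Sum>u\<in>ran \<phi>1. m u) \<le> 1"
  proof -
    have "(\<Sum>u\<in>ran \<phi>1. m u) = (\<Sum>z\<in>(\<Union>u\<in>ran \<phi>1. Zu u). pmf p z)"
      unfolding m_def by (rule sum.UNION_disjoint[symmetric]) (use \<phi>1(3) finZu in \<open>auto simp: Zu_def\<close>)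
    also have "\<dots> \<le> (\<Sum>z\<in>Z. pmf p z)" by (rule sum_mono2) (use finZ in \<open>auto simp: Zu_def\<close>)
    finally show ?thesis using sum1 by simp
  qed
  have bad1: "(\<Sum>z\<in>Zu u. pmf p z * b1 u z) \<le> \<eta>\<^sup>2 * m u" for u
  proof -
    have "(\<Sum>z\<in>Zu u. pmf p z * b1 u z) = (\<Sum>x\<in>X ` Zu u. \<Sum>z | z \<in> Zu u \<and> X z = x. pmf p z * b1 u z)"
      by (rule sum.image_gen) (rule finZu)
    also have "\<dots> = (\<Sum>x\<in>X ` Zu u. \<Sum>z | z \<in> Z \<and> X z = x. pmf p z * b1 u z)"
      by (intro sum.cong) (auto simp: Zu_def)
    also have "\<dots> \<le> (\<Sum>x\<in>X ` Zu u. \<eta>\<^sup>2 * (\<Sum>z | z \<in> Z \<and> X z = x. pmf p z))"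
      by (rule sum_mono, rule \<phi>1(2)) (auto simp: Zu_def)
    also have "\<dots> = \<eta>\<^sup>2 * (\<Sum>x\<in>X ` Zu u. \<Sum>z | z \<in> Zu u \<and> X z = x. pmf p z)"
      unfolding sum_distrib_left[symmetric]
      by (intro arg_cong[where f="\<lambda>x. \<eta>\<^sup>2 * x"] sum.cong) (auto simp: Zu_def)
    also have "\<dots> = \<eta>\<^sup>2 * m u" unfolding m_def by (subst sum.image_gen[OF finZu, symmetric]) simp
    finally show ?thesis .
  qed
  \<comment> \<open>At the second stage the outcome is already determined by u, v and z, so the
    badness is an indicator; its mean under the channel to v is the badness \<open>b1\<close> of the
    first stage.\<close>
  define b2 where "b2 u v z = (if T u v z then 0 else 1 :: real)" for u v z
  have b2_0: "0 \<le> b2 u v z" and b2_1: "b2 u v z \<le> 1" for u v z by (simp_all add: b2_def)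
  have b2_K: "pmf (W2 u (Y z)) v \<le> K2 * pmf (r2 u) v" if "z \<in> Zu u" "b2 u v z < 1" for u v z
    using that K2(1) by (simp add: b2_def split: if_splits)
  \<comment> \<open>Collects the conclusions of the covering for one u, so that a map can be chosen
    for all u simultaneously.\<close>
  define good where "good u f \<longleftrightarrow>
    (\<forall>y v. f y = Some v \<longrightarrow> (\<exists>z\<in>Zu u. Y z = y \<and> b2 u v z < 1)) \<and>
    (\<forall>y v. f y = Some v \<longrightarrow>
      (\<Sum>z | z \<in> Zu u \<and> Y z = y. pmf p z * b2 u v z) \<le> \<eta> * (\<Sum>z | z \<in> Zu u \<and> Y z = y. pmf p z)) \<and>
    finite (ran f) \<and> real (card (ran f)) \<le> K2 / \<eta> \<and>
    (\<Sum>z | z \<in> Zu u \<and> f (Y z) = None. pmf p z)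
       \<le> (\<Sum>z\<in>Zu u. pmf p z * measure_pmf.expectation (W2 u (Y z)) (\<lambda>v. b2 u v z)) / \<eta>
         + \<eta> * (\<Sum>z\<in>Zu u. pmf p z)" for u f
  have "\<exists>f. good u f" for u
  proof (rule threshold_covering[of "Zu u" "W2 u" "pmf p" "b2 u" Y K2 "r2 u" \<eta> \<eta>,
        OF finZu fin(3) pmf_nonneg b2_0 b2_1 b2_K K2(2) \<eta> \<eta>(1)], assumption, assumption, goal_cases)
    case (1 f)
    have "good u f" unfolding good_def
      by (intro conjI allI impI; (rule 1(3-5) | (rule 1(1), assumption) | (rule 1(2), assumption)))
    then show ?case by blast
  qed
  then obtain \<phi>2 where g: "\<And>u. good u (\<phi>2 u)" by metis
  have \<phi>2:
    "\<And>u y v. \<phi>2 u y = Some v \<Longrightarrow> (\<exists>z\<in>Zu u. Y z = y \<and> b2 u v z < 1)"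
    "\<And>u y v. \<phi>2 u y = Some v \<Longrightarrow> (\<Sum>z | z \<in> Zu u \<and> Y z = y. pmf p z * b2 u v z) \<le> \<eta> * (\<Sum>z | z \<in> Zu u \<and> Y z = y. pmf p z)"
    "\<And>u. finite (ran (\<phi>2 u))" "\<And>u. real (card (ran (\<phi>2 u))) \<le> K2 / \<eta>"
    "\<And>u. (\<Sum>z | z \<in> Zu u \<and> \<phi>2 u (Y z) = None. pmf p z)
       \<le> (\<Sum>z\<in>Zu u. pmf p z * measure_pmf.expectation (W2 u (Y z)) (\<lambda>v. b2 u v z)) / \<eta> + \<eta> * (\<Sum>z\<in>Zu u. pmf p z)"
    using g unfolding good_def by blast+
  have Eb2: "measure_pmf.expectation (W2 u (Y z)) (\<lambda>v. b2 u v z) = b1 u z" for u z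
  proof -
    have "b2 u v z = indicator {v. \<not> T u v z} v" for v by (simp add: b2_def)
    then show ?thesis by (simp add: b1_def)
  qed
  have none2: "(\<Sum>z | z \<in> Zu u \<and> \<phi>2 u (Y z) = None. pmf p z) \<le> 2 * \<eta> * m u" for u
  proof -
    have "(\<Sum>z\<in>Zu u. pmf p z * b1 u z) / \<eta> \<le> (\<eta>\<^sup>2 * m u) / \<eta>"
      by (rule divide_right_mono[OF bad1]) (use \<eta> in simp)
    also have "\<dots> = \<eta> * m u" using \<eta> by (simp add: power2_eq_square)
    finally show ?thesis using \<phi>2(5)[of u] unfolding Eb2 m_def by simp
  qed
  \<comment> \<open>Here y has been assigned a codeword v, but the actual z violates T. The
    threshold at the second stage bounds this conditionally on y within the cell.\<close>
  define F where "F u = {z\<in>Zu u. \<exists>v. \<phi>2 u (Y z) = Some v \<and> \<not> T u v z}" for u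
  have fail2: "(\<Sum>z\<in>F u. pmf p z) \<le> \<eta> * m u" for u
  proof -
    have "(\<Sum>z\<in>F u. pmf p z) = (\<Sum>y\<in>Y ` F u. \<Sum>z | z \<in> F u \<and> Y z = y. pmf p z)"
      by (rule sum.image_gen) (use finZu in \<open>simp add: F_def\<close>)
    also have "\<dots> \<le> (\<Sum>y\<in>Y ` F u. \<eta> * (\<Sum>z | z \<in> Zu u \<and> Y z = y. pmf p z))"
    proof (rule sum_mono)
      fix y assume "y \<in> Y ` F u"
      then obtain v where v: "\<phi>2 u y = Some v" by (auto simp: F_def)
      have "(\<Sum>z | z \<in> F u \<and> Y z = y. pmf p z) = (\<Sum>z | z \<in> F u \<and> Y z = y. pmf p z * b2 u v z)"
        by (rule sum.cong) (use v in \<open>auto simp: F_def b2_def\<close>)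
      also have "\<dots> \<le> (\<Sum>z | z \<in> Zu u \<and> Y z = y. pmf p z * b2 u v z)"
        by (rule sum_mono2) (use finZu in \<open>auto simp: F_def b2_def\<close>)
      finally show "(\<Sum>z | z \<in> F u \<and> Y z = y. pmf p z) \<le> \<eta> * (\<Sum>z | z \<in> Zu u \<and> Y z = y. pmf p z)"
        using \<phi>2(2)[OF v] by simp
    qed
    also have "\<dots> \<le> (\<Sum>y\<in>Y ` Zu u. \<eta> * (\<Sum>z | z \<in> Zu u \<and> Y z = y. pmf p z))"
      by (rule sum_mono2) (use finZu \<eta> in \<open>auto simp: F_def intro!: mult_nonneg_nonneg sum_nonneg\<close>)
    also have "\<dots> = \<eta> * m u" unfolding m_def sum_distrib_left[symmetric]
      by (subst sum.image_gen[OF finZu, symmetric]) simp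
    finally show ?thesis .
  qed
  define bad where "bad = {z. \<not> (\<exists>u v. \<phi>1 (X z) = Some u \<and> \<phi>2 u (Y z) = Some v \<and> T u v z)}"
  define N where "N = {z. z \<in> Z \<and> \<phi>1 (X z) = None}"
  define N2 where "N2 u = {z. z \<in> Zu u \<and> \<phi>2 u (Y z) = None}" for u
  have "measure_pmf.prob p bad = (\<Sum>z\<in>bad \<inter> Z. pmf p z)"
    using finZ by (subst measure_Int_set_pmf[symmetric], subst measure_measure_pmf_finite) (auto simp: Z_def)
  \<comment> \<open>Three ways to fail: x has no codeword (\<zeta> / \<open>\<eta>\<^sup>2\<close> +
    \<eta>), y has none within its cell (a fraction 2 \<eta> of the cell), or T fails although both
    exist (a fraction \<eta>). The sum accounts for 4 \<eta>.\<close>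
  also have "\<dots> \<le> (\<Sum>z\<in>N \<union> (\<Union>u\<in>ran \<phi>1. N2 u \<union> F u). pmf p z)"
  proof (rule sum_mono2)
    show "finite (N \<union> (\<Union>u\<in>ran \<phi>1. N2 u \<union> F u))"
      using finZ finZu \<phi>1(3) by (auto simp: N_def N2_def F_def)
    show "bad \<inter> Z \<subseteq> N \<union> (\<Union>u\<in>ran \<phi>1. N2 u \<union> F u)"
    proof
      fix z assume z: "z \<in> bad \<inter> Z"
      show "z \<in> N \<union> (\<Union>u\<in>ran \<phi>1. N2 u \<union> F u)"
      proof (cases "\<phi>1 (X z)")
        case None
        with z show ?thesis by (auto simp: N_def)
      next
        case (Some u)
        then have "u \<in> ran \<phi>1" by (auto simp: ran_def)
        moreover have "z \<in> N2 u \<union> F u"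
          using z Some by (cases "\<phi>2 u (Y z)") (auto simp: N2_def F_def Zu_def bad_def)
        ultimately show ?thesis by blast
      qed
    qed
  qed auto
  also have "\<dots> \<le> (\<Sum>z\<in>N. pmf p z) + (\<Sum>z\<in>(\<Union>u\<in>ran \<phi>1. N2 u \<union> F u). pmf p z)"
    by (rule sum_Un_le) (use finZ finZu \<phi>1(3) in \<open>auto simp: N_def N2_def F_def\<close>)
  also have "(\<Sum>z\<in>(\<Union>u\<in>ran \<phi>1. N2 u \<union> F u). pmf p z) = (\<Sum>u\<in>ran \<phi>1. \<Sum>z\<in>N2 u \<union> F u. pmf p z)"
    by (rule sum.UNION_disjoint) (use finZ \<phi>1(3) in \<open>auto simp: N2_def F_def Zu_def\<close>)
  also have "\<dots> \<le> (\<Sum>u\<in>ran \<phi>1. 3 * \<eta> * m u)"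
  proof (rule sum_mono)
    fix u
    have "(\<Sum>z\<in>N2 u \<union> F u. pmf p z) \<le> (\<Sum>z\<in>N2 u. pmf p z) + (\<Sum>z\<in>F u. pmf p z)"
      by (rule sum_Un_le) (use finZu in \<open>auto simp: N2_def F_def\<close>)
    with none2[of u] fail2[of u] show "(\<Sum>z\<in>N2 u \<union> F u. pmf p z) \<le> 3 * \<eta> * m u"
      by (simp add: N2_def)
  qed
  also have "\<dots> = 3 * \<eta> * (\<Sum>u\<in>ran \<phi>1. m u)" by (simp add: sum_distrib_left)
  also have "\<dots> \<le> 3 * \<eta> * 1" by (rule mult_left_mono[OF msum]) (use \<eta> in simp)
  also have "(\<Sum>z\<in>N. pmf p z) \<le> \<zeta> / \<eta>\<^sup>2 + \<eta>"
  proof -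
    have "(\<Sum>z\<in>Z. pmf p z * measure_pmf.expectation (W1 (X z)) (\<lambda>u. b1 u z)) / \<eta>\<^sup>2 \<le> \<zeta> / \<eta>\<^sup>2"
      by (rule divide_right_mono[OF \<zeta>]) simp
    with \<phi>1(5) show ?thesis unfolding N_def sum1 by simp
  qed
  finally have "measure_pmf.prob p bad \<le> \<zeta> / \<eta>\<^sup>2 + 4 * \<eta>" by simp
  moreover have "\<exists>v z. X z = x \<and> T u v z" if "\<phi>1 x = Some u" for x u
    using \<phi>1(1)[OF that] b1_less by blast
  moreover have "\<exists>z. Y z = y \<and> T u v z" if "\<phi>2 u y = Some v" for u y v
    using \<phi>2(1)[OF that] by (auto simp: b2_def split: if_splits)
  ultimately show thesis
    using that[of \<phi>1 \<phi>2] \<phi>1(3,4) \<phi>2(3,4) unfolding bad_def by blast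
qed

section \<open>Conditional method of types\<close>

lemma finite_fun_pmf:
  fixes f :: "'a \<Rightarrow> real"
  assumes "finite S" "\<And>x. x \<in> S \<Longrightarrow> 0 \<le> f x" "sum f S = 1"
  obtains p where "\<And>x. pmf p x = (if x \<in> S then f x else 0)" "set_pmf p \<subseteq> S"
proof -
  define g where "g x = (if x \<in> S then f x else 0)" for x
  have g0: "0 \<le> g x" for x using assms by (simp add: g_def)
  have "(\<integral>\<^sup>+ x. ennreal (g x) \<partial>count_space UNIV) = (\<Sum>x\<in>S. ennreal (g x))"
    by (rule nn_integral_count_space') (use assms in \<open>auto simp: g_def\<close>)
  also have "\<dots> = ennreal (sum g S)" using g0 by simp
  also have "sum g S = 1" using assms(3) by (simp add: g_def)
  finally have "pmf (embed_pmf g) x = g x" for x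
    using g0 by (intro pmf_embed_pmf) auto
  then have "pmf (embed_pmf g) x = (if x \<in> S then f x else 0)" for x by (simp add: g_def)
  moreover from this have "set_pmf (embed_pmf g) \<subseteq> S" by (auto simp: set_pmf_iff split: if_splits)
  ultimately show thesis by (rule that)
qed

lemma prob_le_mult_prob:
  assumes "finite (set_pmf p)" "\<And>w. w \<in> B \<Longrightarrow> w \<in> set_pmf p \<Longrightarrow> pmf p w \<le> C * pmf q w" "0 \<le> C"
  shows "measure_pmf.prob p B \<le> C"
proof -
  have "measure_pmf.prob p B = (\<Sum>w\<in>B \<inter> set_pmf p. pmf p w)"
    using assms(1) by (subst measure_Int_set_pmf[symmetric], subst measure_measure_pmf_finite) auto
  also have "\<dots> \<le> (\<Sum>w\<in>B \<inter> set_pmf p. C * pmf q w)" by (rule sum_mono) (use assms in auto)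
  also have "\<dots> = C * measure_pmf.prob q (B \<inter> set_pmf p)"
    using assms(1) by (subst measure_measure_pmf_finite) (auto simp: sum_distrib_left)
  also have "\<dots> \<le> C * 1" by (rule mult_left_mono) (use assms in auto)
  finally show ?thesis by simp
qed

section \<open>Types and the probability of their classes\<close>

definition emp :: "nat \<Rightarrow> (nat \<Rightarrow> 'a) \<Rightarrow> 'a \<Rightarrow> real" where
  "emp n s c = real (card {t. t < n \<and> s t = c}) / real n"

lemma sum_eq_emp:
  fixes h :: "'a \<Rightarrow> real"
  assumes "finite S" "\<And>t. t < n \<Longrightarrow> s t \<in> S"
  shows "(\<Sum>t<n. h (s t)) = real n * (\<Sum>c\<in>S. emp n s c * h c)"
proof -
  have "(\<Sum>t<n. h (s t)) = (\<Sum>c\<in>S. \<Sum>t\<in>{t\<in>{..<n}. s t = c}. h (s t))"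
    by (rule sum.group[symmetric]) (use assms in auto)
  also have "\<dots> = (\<Sum>c\<in>S. real (card {t. t < n \<and> s t = c}) * h c)"
    by (rule sum.cong) auto
  also have "\<dots> = (\<Sum>c\<in>S. real n * (emp n s c * h c))"
    by (rule sum.cong) (auto simp: emp_def)
  finally show ?thesis by (simp add: sum_distrib_left)
qed

lemma prod_eq_emp:
  fixes g :: "'a \<Rightarrow> real"
  assumes "finite S" "\<And>t. t < n \<Longrightarrow> s t \<in> S" "\<And>t. t < n \<Longrightarrow> g (s t) > 0"
  shows "(\<Prod>t<n. g (s t)) = exp (real n * (\<Sum>c\<in>S. emp n s c * ln (g c)))"
proof -
  have "(\<Prod>t<n. g (s t)) = (\<Prod>t<n. exp (ln (g (s t))))"
    by (rule prod.cong) (use assms(3) in auto)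
  also have "\<dots> = exp (\<Sum>t<n. ln (g (s t)))" by (simp add: exp_sum)
  also have "(\<Sum>t<n. ln (g (s t))) = real n * (\<Sum>c\<in>S. emp n s c * ln (g c))"
    by (rule sum_eq_emp[of S n s "\<lambda>c. ln (g c)"]) (use assms in auto)
  finally show ?thesis .
qed

lemma card_eq_emp:
  assumes "finite S" "\<And>t. t < n \<Longrightarrow> s t \<in> S"
  shows "real (card {t. t < n \<and> s t \<in> B}) / real n = (\<Sum>c\<in>S \<inter> B. emp n s c)"
proof (cases "n = 0")
  case False
  have "real (card {t. t < n \<and> s t \<in> B}) = (\<Sum>t\<in>{..<n} \<inter> {t. s t \<in> B}. 1)"
    by (simp add: lessThan_def Collect_conj_eq)
  also have "\<dots> = (\<Sum>t<n. indicator B (s t))"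
    by (simp add: sum.inter_restrict indicator_def)
  also have "\<dots> = real n * (\<Sum>c\<in>S. emp n s c * indicator B c)"
    by (rule sum_eq_emp) (use assms in auto)
  also have "(\<Sum>c\<in>S. emp n s c * indicator B c) = (\<Sum>c\<in>S \<inter> B. emp n s c)"
    by (auto simp: sum.inter_restrict[OF assms(1)] intro!: sum.cong)
  finally show ?thesis using False by simp
qed (simp add: emp_def)

text \<open>The weights are functions on the whole type that vanish off S. This makes the set a
  closed slice of a product of compact intervals, hence compact in the product topology for finite
  S, even when the underlying type is infinite.\<close>

definition prob_simplex :: "'a set \<Rightarrow> ('a \<Rightarrow> real) set" where
  "prob_simplex S = {T. (\<forall>c. T c \<in> (if c \<in> S then {0..1} else {0})) \<and> (\<Sum>c\<in>S. T c) = 1}"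

lemma emp_in_prob_simplex:
  assumes "finite S" "\<And>t. t < n \<Longrightarrow> s t \<in> S" "n > 0"
  shows "emp n s \<in> prob_simplex S"
proof -
  have "emp n s c \<in> {0..1}" for c
  proof -
    have "card {t. t < n \<and> s t = c} \<le> card {..<n}" by (rule card_mono) auto
    then show ?thesis by (simp add: emp_def divide_le_eq)
  qed
  moreover have "emp n s c = 0" if "c \<notin> S" for c
    using assms(2) that by (auto simp: emp_def)
  moreover have "(\<Sum>c\<in>S. emp n s c) = 1"
    using card_eq_emp[of S n s UNIV, OF assms(1,2)] assms(3) by simp
  ultimately show ?thesis by (simp add: prob_simplex_def)
qed

definition fst_mass :: "('a \<times> 'z::finite \<Rightarrow> real) \<Rightarrow> 'a \<Rightarrow> real" where
  "fst_mass T a = (\<Sum>z\<in>UNIV. T (a, z))"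

text \<open>The divergence of T from the product of its first marginal with q, split into three sums
  so that continuity at the boundary of the simplex is that of x ln x.\<close>
definition rate :: "'a set \<Rightarrow> ('z::finite \<Rightarrow> real) \<Rightarrow> ('a \<times> 'z \<Rightarrow> real) \<Rightarrow> real" where
  "rate A q T = (\<Sum>c\<in>A \<times> UNIV. T c * ln (T c)) - (\<Sum>a\<in>A. fst_mass T a * ln (fst_mass T a))
     - (\<Sum>c\<in>A \<times> UNIV. T c * ln (q (snd c)))"

text \<open>Terms with T c = 0 vanish on both sides. Elsewhere the marginal dominates T c and is
  positive, so the logarithm of the quotient splits.\<close>

lemma rate_eq:
  fixes q :: "'z::finite \<Rightarrow> real"
  assumes "finite A" "\<And>c. 0 \<le> T c" "\<And>z. 0 < q z"
  shows "rate A q T = (\<Sum>c\<in>A \<times> UNIV. T c * ln (T c / (fst_mass T (fst c) * q (snd c))))"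
proof -
  have "fst_mass T a * ln (fst_mass T a) = (\<Sum>z\<in>UNIV. T (a, z) * ln (fst_mass T a))" for a
    by (simp add: fst_mass_def sum_distrib_right)
  then have "(\<Sum>a\<in>A. fst_mass T a * ln (fst_mass T a)) = (\<Sum>c\<in>A \<times> UNIV. T c * ln (fst_mass T (fst c)))"
    by (simp add: sum.cartesian_product split_beta)
  then have "rate A q T = (\<Sum>c\<in>A \<times> UNIV. T c * ln (T c) - T c * ln (fst_mass T (fst c)) - T c * ln (q (snd c)))"
    by (simp add: rate_def sum_subtractf)
  also have "\<dots> = (\<Sum>c\<in>A \<times> UNIV. T c * ln (T c / (fst_mass T (fst c) * q (snd c))))"
  proof (rule sum.cong[OF refl])
    fix c :: "'a \<times> 'z"
    show "T c * ln (T c) - T c * ln (fst_mass T (fst c)) - T c * ln (q (snd c))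
      = T c * ln (T c / (fst_mass T (fst c) * q (snd c)))"
    proof (cases "T c = 0")
      case False
      then have "T c > 0" using assms(2)[of c] by simp
      moreover have "T c \<le> fst_mass T (fst c)"
        unfolding fst_mass_def using member_le_sum[of "snd c" UNIV "\<lambda>z. T (fst c, z)"] assms(2) by simp
      ultimately have "fst_mass T (fst c) > 0" "T c > 0" by linarith+
      then show ?thesis using assms(3)[of "snd c"] by (simp add: ln_div ln_mult algebra_simps)
    qed simp
  qed
  finally show ?thesis .
qed

text \<open>Change of measure to the conditional law of the second component given the first under
  the type T, which gives all members of the type class the same likelihood ratio.\<close>
lemma type_class_prob_le:
  fixes Q :: "'z::finite pmf" and a :: "nat \<Rightarrow> 'a"
  assumes n: "n > 0" and A: "finite A" "\<And>t. t < n \<Longrightarrow> a t \<in> A" and Q: "\<And>z. pmf Q z > 0"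
  shows "measure_pmf.prob (Pi_pmf {..<n} d (\<lambda>_. Q)) {w. emp n (\<lambda>t. (a t, w t)) = T}
     \<le> exp (- real n * rate A (pmf Q) T)"
proof (cases "\<exists>w. emp n (\<lambda>t. (a t, w t)) = T")
  case False
  then show ?thesis by simp
next
  case True
  then obtain w0 where w0: "emp n (\<lambda>t. (a t, w0 t)) = T" by blast
  have T0: "0 \<le> T c" for c using w0 by (auto simp: emp_def)
  have Tpos: "0 < T (a t, w t)" if "emp n (\<lambda>t. (a t, w t)) = T" "t < n" for w t
  proof -
    have "t \<in> {s. s < n \<and> (a s, w s) = (a t, w t)}" using that by simp
    then have "0 < card {s. s < n \<and> (a s, w s) = (a t, w t)}"
      by (subst card_gt_0_iff) auto
    then show ?thesis using that(1)[symmetric] n by (simp add: emp_def)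
  qed
  have mass: "T (b, z) \<le> fst_mass T b" for b z
    unfolding fst_mass_def using member_le_sum[of z UNIV "\<lambda>z. T (b, z)"] T0 by simp
  have mpos: "0 < fst_mass T (a t)" if "t < n" for t
    using Tpos[OF w0 that] mass[of "a t" "w0 t"] by linarith
  have "\<exists>\<kappa>. t < n \<longrightarrow> (\<forall>z. pmf \<kappa> z = T (a t, z) / fst_mass T (a t))" for t
  proof (cases "t < n")
    case True
    show ?thesis
      by (rule finite_fun_pmf[of UNIV "\<lambda>z. T (a t, z) / fst_mass T (a t)"])
         (use T0 mpos[OF True] in \<open>auto simp: sum_divide_distrib[symmetric] fst_mass_def less_imp_le\<close>)
  qed simp
  \<comment> \<open>\<open>\<kappa> t\<close> is the conditional law of the second component given
    \<open>a t\<close> under T. The division is legitimate because each symbol \<open>a t\<close>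
    with t < n has positive mass in the realized type.\<close>
  then obtain \<kappa> where \<kappa>: "\<And>t z. t < n \<Longrightarrow> pmf (\<kappa> t) z = T (a t, z) / fst_mass T (a t)"
    by metis
  show ?thesis
  proof (rule prob_le_mult_prob[where q="Pi_pmf {..<n} d \<kappa>"])
    show "finite (set_pmf (Pi_pmf {..<n} d (\<lambda>_. Q)))"
      by (subst set_Pi_pmf) auto
    fix w assume w: "w \<in> {w. emp n (\<lambda>t. (a t, w t)) = T}" "w \<in> set_pmf (Pi_pmf {..<n} d (\<lambda>_. Q))"
    then have out: "\<And>t. t \<notin> {..<n} \<Longrightarrow> w t = d" and emp: "emp n (\<lambda>t. (a t, w t)) = T"
      using set_Pi_pmf_subset[of "{..<n}" d "\<lambda>_. Q"] by auto
    have S: "finite (A \<times> (UNIV :: 'z set))" "\<And>t. t < n \<Longrightarrow> (a t, w t) \<in> A \<times> UNIV" using A by auto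
    have eq_neg: "T c * ln (pmf Q (snd c) / (T c / fst_mass T (fst c)))
        = - (T c * ln (T c / (fst_mass T (fst c) * pmf Q (snd c))))" for c
    proof (cases "T c = 0")
      case False
      then have "T c > 0" using T0[of c] by simp
      moreover have "fst_mass T (fst c) > 0" using mass[of "fst c" "snd c"] \<open>T c > 0\<close> by simp
      ultimately show ?thesis using Q[of "snd c"] by (simp add: ln_div ln_mult algebra_simps)
    qed simp
    have rateT: "(\<Sum>c\<in>A \<times> UNIV. T c * ln (pmf Q (snd c) / (T c / fst_mass T (fst c)))) = - rate A (pmf Q) T"
      unfolding rate_eq[OF A(1) T0 Q] eq_neg sum_negf ..
    have pos: "0 < pmf Q (snd (a t, w t)) / (T (a t, w t) / fst_mass T (fst (a t, w t)))" if "t < n" for t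
      using Q[of "w t"] mpos[OF that] Tpos[OF emp that] by simp
    \<comment> \<open>The likelihood ratio is a product over positions of a function of the pair of
      symbols, so it depends on w only through its joint type with a.\<close>
    have ratio: "(\<Prod>t<n. pmf Q (w t) / (T (a t, w t) / fst_mass T (a t))) = exp (- real n * rate A (pmf Q) T)"
      using prod_eq_emp[of "A \<times> UNIV" n "\<lambda>t. (a t, w t)"
          "\<lambda>c. pmf Q (snd c) / (T c / fst_mass T (fst c))", OF S pos]
      unfolding emp rateT fst_conv snd_conv mult_minus_left mult_minus_right .
    have "pmf (Pi_pmf {..<n} d (\<lambda>_. Q)) w = (\<Prod>t<n. pmf Q (w t))"
      by (rule pmf_Pi') (use out in auto)
    also have "\<dots> = (\<Prod>t<n. pmf Q (w t) / (T (a t, w t) / fst_mass T (a t)) * pmf (\<kappa> t) (w t))"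
    proof (rule prod.cong[OF refl])
      fix t assume "t \<in> {..<n}"
      then have t: "t < n" by simp
      show "pmf Q (w t) = pmf Q (w t) / (T (a t, w t) / fst_mass T (a t)) * pmf (\<kappa> t) (w t)"
        unfolding \<kappa>[OF t] using Tpos[OF emp t] mpos[OF t] by simp
    qed
    also have "\<dots> = exp (- real n * rate A (pmf Q) T) * (\<Prod>t<n. pmf (\<kappa> t) (w t))"
      by (simp only: prod.distrib ratio)
    also have "(\<Prod>t<n. pmf (\<kappa> t) (w t)) = pmf (Pi_pmf {..<n} d \<kappa>) w"
      by (rule pmf_Pi'[symmetric]) (use out in auto)
    finally show "pmf (Pi_pmf {..<n} d (\<lambda>_. Q)) w \<le> exp (- real n * rate A (pmf Q) T) * pmf (Pi_pmf {..<n} d \<kappa>) w"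
      by simp
  qed simp
qed

text \<open>A joint type is determined by one count in {0..n} for each pair of symbols, so there are
  at most polynomially many; the union bound over those in G costs only this factor.\<close>

lemma conditional_sanov:
  fixes Q :: "'z::finite pmf" and a :: "nat \<Rightarrow> 'a"
  assumes n: "n > 0" and A: "finite A" "\<And>t. t < n \<Longrightarrow> a t \<in> A" and Q: "\<And>z. pmf Q z > 0"
    and c: "\<And>T. T \<in> prob_simplex (A \<times> UNIV) \<Longrightarrow> T \<in> G \<Longrightarrow> c \<le> rate A (pmf Q) T"
  shows "measure_pmf.prob (Pi_pmf {..<n} d (\<lambda>_. Q)) {w. emp n (\<lambda>t. (a t, w t)) \<in> G}
     \<le> real ((n + 1) ^ (card A * CARD('z))) * exp (- real n * c)"
proof -
  define S where "S = A \<times> (UNIV :: 'z set)"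
  have finS: "finite S" using A by (simp add: S_def)
  define F where "F k = (\<lambda>c. if c \<in> S then real (k c) / real n else 0)" for k :: "'a \<times> 'z \<Rightarrow> nat"
  define D where "D = F ` (S \<rightarrow>\<^sub>E {0..n}) \<inter> prob_simplex S \<inter> G"
  have finP: "finite (S \<rightarrow>\<^sub>E {0..n})" using finS by (intro finite_PiE) auto
  have finD: "finite D" using finP by (simp add: D_def)
  have "card D \<le> card (S \<rightarrow>\<^sub>E {0..n})"
  proof -
    have "card D \<le> card (F ` (S \<rightarrow>\<^sub>E {0..n}))" unfolding D_def by (rule card_mono) (use finP in auto)
    also have "\<dots> \<le> card (S \<rightarrow>\<^sub>E {0..n})" by (rule card_image_le[OF finP])
    finally show ?thesis .
  qed
  also have "\<dots> = (n + 1) ^ (card A * CARD('z))"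
    by (subst card_PiE[OF finS]) (simp add: S_def card_cartesian_product)
  finally have cardD: "card D \<le> (n + 1) ^ (card A * CARD('z))" .
  have sub: "{w. emp n (\<lambda>t. (a t, w t)) \<in> G} \<subseteq> (\<Union>T\<in>D. {w. emp n (\<lambda>t. (a t, w t)) = T})"
  proof
    fix w assume w: "w \<in> {w. emp n (\<lambda>t. (a t, w t)) \<in> G}"
    let ?s = "\<lambda>t. (a t, w t)"
    define k where "k = restrict (\<lambda>c. card {t. t < n \<and> ?s t = c}) S"
    have "card {t. t < n \<and> ?s t = c} \<le> n" for c
    proof -
      have "card {t. t < n \<and> ?s t = c} \<le> card {..<n}" by (rule card_mono) auto
      then show ?thesis by simp
    qed
    then have "k \<in> S \<rightarrow>\<^sub>E {0..n}" by (auto simp: k_def)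
    moreover have "emp n ?s = F k"
      using A(2) by (auto simp: fun_eq_iff F_def k_def emp_def S_def)
    moreover have "emp n ?s \<in> prob_simplex S"
      by (rule emp_in_prob_simplex) (use finS n A in \<open>auto simp: S_def\<close>)
    ultimately show "w \<in> (\<Union>T\<in>D. {w. emp n (\<lambda>t. (a t, w t)) = T})"
      using w by (auto simp: D_def)
  qed
  let ?p = "Pi_pmf {..<n} d (\<lambda>_. Q)"
  have "measure_pmf.prob ?p {w. emp n (\<lambda>t. (a t, w t)) \<in> G}
     \<le> measure_pmf.prob ?p (\<Union>T\<in>D. {w. emp n (\<lambda>t. (a t, w t)) = T})"
    by (rule measure_pmf.finite_measure_mono[OF sub]) simp
  also have "\<dots> \<le> (\<Sum>T\<in>D. measure_pmf.prob ?p {w. emp n (\<lambda>t. (a t, w t)) = T})"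
    by (rule measure_pmf.finite_measure_subadditive_finite[OF finD]) simp
  also have "\<dots> \<le> (\<Sum>T\<in>D. exp (- real n * c))"
  proof (rule sum_mono)
    fix T assume T: "T \<in> D"
    have "measure_pmf.prob ?p {w. emp n (\<lambda>t. (a t, w t)) = T} \<le> exp (- real n * rate A (pmf Q) T)"
      by (rule type_class_prob_le[OF n A Q])
    also have "\<dots> \<le> exp (- real n * c)"
      using c[of T] T n by (simp add: D_def S_def)
    finally show "measure_pmf.prob ?p {w. emp n (\<lambda>t. (a t, w t)) = T} \<le> exp (- real n * c)" .
  qed
  also have "\<dots> = real (card D) * exp (- real n * c)" by simp
  also have "\<dots> \<le> real ((n + 1) ^ (card A * CARD('z))) * exp (- real n * c)"
    by (rule mult_right_mono) (use cardD in \<open>simp_all only: of_nat_le_iff exp_ge_zero\<close>)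
  finally show ?thesis .
qed

section \<open>Compactness and continuity on the simplex of types\<close>

lemma continuous_on_x_ln_x: "continuous_on {0..} (\<lambda>x::real. x * ln x)"
proof (rule continuous_on_subset)
  have lim: "((\<lambda>x::real. x * ln x) \<longlongrightarrow> 0) (at_right 0)"
  proof -
    \<comment> \<open>Only the boundary point 0 is delicate; the substitution y = 1/x reduces it to
      ln y / y tending to 0.\<close>
    have "((\<lambda>x::real. ln (inverse x) / inverse x) \<longlongrightarrow> 0) (at_right 0)"
      by (rule filterlim_compose[OF ln_x_over_x_tendsto_0 filterlim_inverse_at_top_right])
    then have "((\<lambda>x::real. - (ln (inverse x) / inverse x)) \<longlongrightarrow> - 0) (at_right 0)"
      by (rule tendsto_minus)
    moreover have "eventually (\<lambda>x::real. - (ln (inverse x) / inverse x) = x * ln x) (at_right 0)"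
      by (rule eventually_at_rightI[of 0 1]) (auto simp: ln_inverse divide_inverse)
    ultimately show ?thesis by (simp add: tendsto_cong)
  qed
  show "continuous_on {0..} (\<lambda>x::real. x * ln x)"
    unfolding continuous_on_def
  proof
    fix x :: real assume x: "x \<in> {0..}"
    show "((\<lambda>x. x * ln x) \<longlongrightarrow> x * ln x) (at x within {0..})"
    proof (cases "x = 0")
      case True
      then show ?thesis using lim by (simp add: at_within_Ici_at_right)
    next
      case False
      then show ?thesis by (intro tendsto_intros) auto
    qed
  qed
qed simp

lemma continuous_on_apply: "continuous_on K (\<lambda>T :: 'a \<Rightarrow> real. T c)"
  by (rule continuous_on_subset[OF continuous_on_product_coordinates]) simp

lemma compact_prob_simplex:
  assumes "finite S"
  shows "compact (prob_simplex S)"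
proof -
  let ?B = "\<lambda>c. if c \<in> S then {0..1} else {0 :: real}"
  have "compactin (product_topology (\<lambda>_. euclidean) UNIV) (PiE UNIV ?B)"
    by (subst compactin_PiE) auto
  then have "compact (PiE UNIV ?B)" by (simp add: euclidean_product_topology)
  moreover have "closed {T :: 'a \<Rightarrow> real. (\<Sum>c\<in>S. T c) = 1}"
    by (intro closed_Collect_eq continuous_intros continuous_on_apply)
  ultimately have "compact (PiE UNIV ?B \<inter> {T. (\<Sum>c\<in>S. T c) = 1})" by (rule compact_Int_closed)
  moreover have "PiE UNIV ?B \<inter> {T. (\<Sum>c\<in>S. T c) = 1} = prob_simplex S"
    by (auto simp: prob_simplex_def PiE_def Pi_def)
  ultimately show ?thesis by simp
qed

lemma prob_simplexD:
  assumes "T \<in> prob_simplex S"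
  shows "0 \<le> T x" "x \<notin> S \<Longrightarrow> T x = 0" "sum T S = 1"
proof -
  have "T x \<in> (if x \<in> S then {0..1} else {0})" using assms unfolding prob_simplex_def by blast
  then show "0 \<le> T x" "x \<notin> S \<Longrightarrow> T x = 0" by (auto split: if_splits)
  show "sum T S = 1" using assms by (simp add: prob_simplex_def)
qed

lemma closed_prob_simplex: "closed (prob_simplex S)"
proof -
  have "prob_simplex S = (\<Inter>c. (\<lambda>T. T c) -` (if c \<in> S then {0..1} else {0})) \<inter> {T. (\<Sum>c\<in>S. T c) = 1}"
    by (simp add: prob_simplex_def set_eq_iff split del: if_split)
  also have "closed \<dots>"
    by (intro closed_Int closed_INT ballI closed_vimage closed_Collect_eq continuous_intros continuous_on_apply) auto
  finally show ?thesis .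
qed

lemma continuous_on_rate:
  assumes "finite A"
  shows "continuous_on (prob_simplex (A \<times> UNIV)) (rate A q)"
proof -
  have xlnx: "continuous_on K (\<lambda>T. f T * ln (f T))" if "continuous_on K f" "\<And>T. T \<in> K \<Longrightarrow> 0 \<le> f T"
    for K and f :: "('a \<times> 'b \<Rightarrow> real) \<Rightarrow> real"
    by (rule continuous_on_compose2[OF continuous_on_x_ln_x that(1)]) (use that(2) in auto)
  show ?thesis
    unfolding rate_def fst_mass_def
    by (intro continuous_intros xlnx continuous_on_apply sum_nonneg) (auto intro: prob_simplexD)
qed

text \<open>The weights of rate at most c - \<epsilon> form a compact set, and the total deviation
  \<open>G\<close> from the prescribed probabilities is continuous on it. It has no zero there,
  since a zero would satisfy the constraints exactly and so have rate at least c. Its minimum is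
  therefore positive, and every weight with smaller deviation has rate above c - \<epsilon>.\<close>

lemma rate_lower_semicontinuous:
  fixes q :: "'z::finite \<Rightarrow> real" and R :: "('a \<times> 'z) pmf"
  assumes A: "finite A" and fB: "finite \<B>" and \<epsilon>: "\<epsilon> > 0"
    and c: "\<And>T. set_pmf T \<subseteq> A \<times> UNIV \<Longrightarrow>
      (\<And>B. B \<in> \<B> \<Longrightarrow> measure_pmf.prob T B = measure_pmf.prob R B) \<Longrightarrow> c \<le> rate A q (pmf T)"
  obtains \<delta> where "\<delta> > 0"
    "\<And>T :: 'a \<times> 'z \<Rightarrow> real. T \<in> prob_simplex (A \<times> UNIV) \<Longrightarrow>
      (\<And>B. B \<in> \<B> \<Longrightarrow> \<bar>(\<Sum>c\<in>A \<times> UNIV \<inter> B. T c) - measure_pmf.prob R B\<bar> \<le> \<delta>) \<Longrightarrow> c - \<epsilon> \<le> rate A q T"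
proof -
  define S where "S = A \<times> (UNIV :: 'z set)"
  have finS: "finite S" using A by (simp add: S_def)
  define G where "G T = (\<Sum>B\<in>\<B>. \<bar>(\<Sum>c\<in>S \<inter> B. T c) - measure_pmf.prob R B\<bar>)" for T
  define K where "K = prob_simplex S \<inter> (prob_simplex S \<inter> rate A q -` {..c - \<epsilon>})"
  have "continuous_on (prob_simplex S) (rate A q)"
    unfolding S_def by (rule continuous_on_rate[OF A])
  moreover have "compact (prob_simplex S)" by (rule compact_prob_simplex[OF finS])
  ultimately have K: "compact K" unfolding K_def
    by (intro compact_Int_closed continuous_closed_preimage) (auto intro: closed_prob_simplex)
  have Gc: "continuous_on K G" unfolding G_def
    by (intro continuous_intros continuous_on_apply)
  show thesis
  proof (cases "K = {}")
    case True
    show thesis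
    proof (rule that[of 1])
      fix T :: "'a \<times> 'z \<Rightarrow> real" assume "T \<in> prob_simplex (A \<times> UNIV)"
      with True show "c - \<epsilon> \<le> rate A q T" by (auto simp: K_def S_def)
    qed simp
  next
    case False
    from continuous_attains_inf[OF K False Gc] obtain T0 where T0: "T0 \<in> K" "\<And>T. T \<in> K \<Longrightarrow> G T0 \<le> G T"
      by blast
    have G0: "0 \<le> G T" for T unfolding G_def by (intro sum_nonneg) simp
    have "G T0 \<noteq> 0"
    proof
      assume "G T0 = 0"
      then have eq: "(\<Sum>c\<in>S \<inter> B. T0 c) = measure_pmf.prob R B" if "B \<in> \<B>" for B
        using that fB unfolding G_def by (subst (asm) sum_nonneg_eq_0_iff) auto
      have T0S: "T0 \<in> prob_simplex S" using T0(1) by (simp add: K_def)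
      note T0n = prob_simplexD[OF T0S]
      obtain p where p: "\<And>x. pmf p x = (if x \<in> S then T0 x else 0)" "set_pmf p \<subseteq> S"
        by (rule finite_fun_pmf[OF finS, of T0]) (use T0n in auto)
      have pT: "pmf p = T0" using p(1) T0n(2) by auto
      have "measure_pmf.prob p B = (\<Sum>c\<in>S \<inter> B. T0 c)" for B
      proof -
        have "measure_pmf.prob p B = measure_pmf.prob p (S \<inter> B)"
          by (rule measure_pmf.finite_measure_eq_AE) (use p(2) in \<open>auto simp: AE_measure_pmf_iff\<close>)
        then show ?thesis using finS pT by (simp add: measure_measure_pmf_finite)
      qed
      then have "c \<le> rate A q (pmf p)" using p(2) eq by (intro c) (auto simp: S_def)
      then have "c \<le> rate A q T0" by (simp add: pT)
      moreover have "rate A q T0 \<le> c - \<epsilon>" using T0(1) by (simp add: K_def)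
      ultimately show False using \<epsilon> by simp
    qed
    with G0[of T0] have Gp: "G T0 > 0" by simp
    \<comment> \<open>Small enough that the deviations permitted on all sets of the finite family
      together stay below the minimum of \<open>G\<close>.\<close>
    define \<delta> where "\<delta> = G T0 / (2 * (real (card \<B>) + 1))"
    have \<delta>p: "\<delta> > 0" using Gp by (simp add: \<delta>_def)
    show thesis
    proof (rule that[OF \<delta>p], rule ccontr)
      fix T assume T: "T \<in> prob_simplex (A \<times> UNIV)"
        and close: "\<And>B. B \<in> \<B> \<Longrightarrow> \<bar>(\<Sum>c\<in>A \<times> UNIV \<inter> B. T c) - measure_pmf.prob R B\<bar> \<le> \<delta>"
        and "\<not> c - \<epsilon> \<le> rate A q T"
      then have "T \<in> K" by (simp add: K_def S_def)
      then have "G T0 \<le> G T" by (rule T0)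
      also have "\<dots> \<le> (\<Sum>B\<in>\<B>. \<delta>)" unfolding G_def S_def by (intro sum_mono close)
      also have "\<dots> = real (card \<B>) * \<delta>" by simp
      also have "\<dots> < (2 * (real (card \<B>) + 1)) * \<delta>" using \<delta>p by (intro mult_strict_right_mono) auto
      also have "\<dots> = G T0" by (simp add: \<delta>_def add_eq_0_iff)
      finally show False by simp
    qed
  qed
qed

text \<open>The tolerance \<delta> depends neither on n nor on the sequence a. This uniformity
  permits the later union bound over codewords that are known only to exist.\<close>

lemma conditional_sanov_marginals:
  fixes Q :: "'z::finite pmf" and R :: "('a \<times> 'z) pmf"
  assumes A: "finite A" and fB: "finite \<B>" and \<epsilon>: "\<epsilon> > 0" and Q: "\<And>z. pmf Q z > 0"
    and c: "\<And>T. set_pmf T \<subseteq> A \<times> UNIV \<Longrightarrow>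
      (\<And>B. B \<in> \<B> \<Longrightarrow> measure_pmf.prob T B = measure_pmf.prob R B) \<Longrightarrow> c \<le> rate A (pmf Q) (pmf T)"
  obtains \<delta> where "\<delta> > 0"
    "\<And>n (a :: nat \<Rightarrow> 'a) d. n > 0 \<Longrightarrow> (\<And>t. t < n \<Longrightarrow> a t \<in> A) \<Longrightarrow>
       measure_pmf.prob (Pi_pmf {..<n} d (\<lambda>_. Q))
         {w. \<forall>B\<in>\<B>. \<bar>real (card {t. t < n \<and> (a t, w t) \<in> B}) / real n - measure_pmf.prob R B\<bar> \<le> \<delta>}
       \<le> real ((n + 1) ^ (card A * CARD('z))) * exp (- real n * (c - \<epsilon>))"
proof -
  obtain \<delta> where \<delta>: "\<delta> > 0"
    "\<And>T :: 'a \<times> 'z \<Rightarrow> real. T \<in> prob_simplex (A \<times> UNIV) \<Longrightarrow>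
      (\<And>B. B \<in> \<B> \<Longrightarrow> \<bar>(\<Sum>c\<in>A \<times> UNIV \<inter> B. T c) - measure_pmf.prob R B\<bar> \<le> \<delta>) \<Longrightarrow> c - \<epsilon> \<le> rate A (pmf Q) T"
    by (rule rate_lower_semicontinuous[OF A fB \<epsilon> c]) blast+
  show thesis
  proof (rule that[OF \<delta>(1)])
    fix n :: nat and a :: "nat \<Rightarrow> 'a" and d
    assume n: "n > 0" and a: "\<And>t. t < n \<Longrightarrow> a t \<in> A"
    define G where "G = {T. \<forall>B\<in>\<B>. \<bar>(\<Sum>c\<in>A \<times> UNIV \<inter> B. T c) - measure_pmf.prob R B\<bar> \<le> \<delta>}"
    have "real (card {t. t < n \<and> (a t, w t) \<in> B}) / real n = (\<Sum>c\<in>A \<times> UNIV \<inter> B. emp n (\<lambda>t. (a t, w t)) c)"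
    for w :: "nat \<Rightarrow> 'z" and B
      by (rule card_eq_emp) (use A a in auto)
    then have "{w. \<forall>B\<in>\<B>. \<bar>real (card {t. t < n \<and> (a t, w t) \<in> B}) / real n - measure_pmf.prob R B\<bar> \<le> \<delta>}
       = {w. emp n (\<lambda>t. (a t, w t)) \<in> G}"
      by (simp add: G_def)
    moreover have "measure_pmf.prob (Pi_pmf {..<n} d (\<lambda>_. Q)) {w. emp n (\<lambda>t. (a t, w t)) \<in> G}
       \<le> real ((n + 1) ^ (card A * CARD('z))) * exp (- real n * (c - \<epsilon>))"
      by (rule conditional_sanov[OF n A a Q]) (use \<delta>(2) in \<open>auto simp: G_def\<close>)
    ultimately show "measure_pmf.prob (Pi_pmf {..<n} d (\<lambda>_. Q))
         {w. \<forall>B\<in>\<B>. \<bar>real (card {t. t < n \<and> (a t, w t) \<in> B}) / real n - measure_pmf.prob R B\<bar> \<le> \<delta>}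
       \<le> real ((n + 1) ^ (card A * CARD('z))) * exp (- real n * (c - \<epsilon>))" by simp
  qed
qed

section \<open>Typical sequences and test channels\<close>

text \<open>Closeness is asked for all events at once, so that every image under a map inherits it
  with the same \<delta>. The support condition keeps the logarithms of densities finite along the
  sequence.\<close>

definition typical :: "nat \<Rightarrow> real \<Rightarrow> 'a pmf \<Rightarrow> (nat \<Rightarrow> 'a) \<Rightarrow> bool" where
  "typical n \<delta> J w \<longleftrightarrow> (\<forall>t<n. w t \<in> set_pmf J) \<and>
     (\<forall>B. \<bar>real (card {t. t < n \<and> w t \<in> B}) / real n - measure_pmf.prob J B\<bar> \<le> \<delta>)"

lemma typical_cong:
  assumes "\<And>t. t < n \<Longrightarrow> w t = w' t"
  shows "typical n \<delta> J w \<longleftrightarrow> typical n \<delta> J w'"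
proof -
  have "{t. t < n \<and> w t \<in> B} = {t. t < n \<and> w' t \<in> B}" for B using assms by auto
  then show ?thesis using assms by (simp add: typical_def)
qed

lemma finite_set_Pi_pmf:
  assumes "finite A" "\<And>x. x \<in> A \<Longrightarrow> finite (set_pmf (p x))"
  shows "finite (set_pmf (Pi_pmf A d p))"
  using assms by (subst set_Pi_pmf) auto

lemma map_pmf_indicator_bernoulli: "map_pmf (\<lambda>z. z = a) J = bernoulli_pmf (pmf J a)"
proof (rule pmf_eqI)
  fix b
  have t: "(\<lambda>z. z = a) -` {True} = {a}" and f: "(\<lambda>z. z = a) -` {False} = UNIV - {a}" by auto
  show "pmf (map_pmf (\<lambda>z. z = a) J) b = pmf (bernoulli_pmf (pmf J a)) b"
    using measure_pmf.prob_compl[of "{a}" J]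
    by (cases b) (simp_all add: pmf_map t f pmf.rep_eq[symmetric] measure_pmf_single pmf_le_1)
qed

text \<open>The number of occurrences of a single symbol is binomial, so Hoeffding's inequality
  applies. If each symbol of the support deviates by at most \<delta> divided by the number of
  symbols, each event deviates by at most \<delta>.\<close>

lemma prob_not_typical_le:
  assumes fin: "finite (set_pmf J)" and n: "n > 0" and \<delta>: "\<delta> > 0"
  shows "measure_pmf.prob (iid n J) {w. \<not> typical n \<delta> J w}
    \<le> real (card (set_pmf J)) * (2 * exp (- 2 * real n * (\<delta> / real (card (set_pmf J)))\<^sup>2))"
proof -
  define S where "S = set_pmf J"
  have k: "card S > 0" using fin set_pmf_not_empty[of J] by (simp add: S_def card_gt_0_iff)
  define e where "e = \<delta> / real (card S)"
  have e: "e > 0" using k \<delta> by (simp add: e_def)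
  have single: "measure_pmf.prob (iid n J) {w. e \<le> \<bar>emp n w a - pmf J a\<bar>} \<le> 2 * exp (- 2 * real n * e\<^sup>2)" for a
  proof -
    interpret binomial_distribution n "pmf J a" by unfold_locales (simp add: pmf_le_1)
    \<comment> \<open>The indicator sequence is the coordinatewise image of the sample, so its
      default outside {..<n} has to be the image of \<open>undefined\<close>.\<close>
    have "binomial_pmf n (pmf J a)
        = map_pmf (\<lambda>f. card {t\<in>{..<n}. f t}) (Pi_pmf {..<n} (undefined = a) (\<lambda>_. bernoulli_pmf (pmf J a)))"
      by (rule binomial_pmf_altdef') (auto simp: pmf_le_1)
    also have "Pi_pmf {..<n} (undefined = a) (\<lambda>_. bernoulli_pmf (pmf J a))
        = map_pmf (\<lambda>h. (\<lambda>z. z = a) \<circ> h) (iid n J)"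
      unfolding iid_def map_pmf_indicator_bernoulli[symmetric] by (rule Pi_pmf_map) auto
    finally have "binomial_pmf n (pmf J a) = map_pmf (\<lambda>w. card {t. t < n \<and> w t = a}) (iid n J)"
      by (simp add: pmf.map_comp o_def)
    then have "measure_pmf.prob (binomial_pmf n (pmf J a)) {x. e \<le> \<bar>real x / real n - pmf J a\<bar>}
       = measure_pmf.prob (iid n J) {w. e \<le> \<bar>emp n w a - pmf J a\<bar>}"
      by (simp add: emp_def vimage_def)
    with prob_abs_ge'[OF n, of e] e show ?thesis by simp
  qed
  have sub: "{w. \<not> typical n \<delta> J w} \<inter> set_pmf (iid n J) \<subseteq> (\<Union>a\<in>S. {w. e \<le> \<bar>emp n w a - pmf J a\<bar>})"
  proof (rule subsetI, rule ccontr)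
    fix w assume w: "w \<in> {w. \<not> typical n \<delta> J w} \<inter> set_pmf (iid n J)"
      and no: "w \<notin> (\<Union>a\<in>S. {w. e \<le> \<bar>emp n w a - pmf J a\<bar>})"
    from w have inS: "\<And>t. t < n \<Longrightarrow> w t \<in> S"
      unfolding iid_def S_def by (auto simp: set_Pi_pmf PiE_dflt_def)
    have "\<bar>real (card {t. t < n \<and> w t \<in> B}) / real n - measure_pmf.prob J B\<bar> \<le> \<delta>" for B
    proof -
      have "measure_pmf.prob J B = (\<Sum>c\<in>S \<inter> B. pmf J c)"
        using fin unfolding S_def
        by (subst measure_Int_set_pmf[symmetric], subst measure_measure_pmf_finite) (auto simp: Int_commute)
      moreover have "real (card {t. t < n \<and> w t \<in> B}) / real n = (\<Sum>c\<in>S \<inter> B. emp n w c)"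
        by (rule card_eq_emp) (use fin inS in \<open>auto simp: S_def\<close>)
      ultimately have "\<bar>real (card {t. t < n \<and> w t \<in> B}) / real n - measure_pmf.prob J B\<bar>
         = \<bar>\<Sum>c\<in>S \<inter> B. emp n w c - pmf J c\<bar>" by (simp add: sum_subtractf)
      also have "\<dots> \<le> (\<Sum>c\<in>S \<inter> B. \<bar>emp n w c - pmf J c\<bar>)" by (rule sum_abs)
      also have "\<dots> \<le> (\<Sum>c\<in>S \<inter> B. e)" by (rule sum_mono) (use no in \<open>auto simp: not_le less_imp_le\<close>)
      also have "\<dots> \<le> (\<Sum>c\<in>S. e)" by (rule sum_mono2) (use fin e in \<open>auto simp: S_def\<close>)
      also have "\<dots> = \<delta>" using k by (simp add: e_def)
      finally show ?thesis .
    qed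
    then have "typical n \<delta> J w" using inS by (simp add: typical_def S_def)
    with w show False by simp
  qed
  have "measure_pmf.prob (iid n J) {w. \<not> typical n \<delta> J w}
     = measure_pmf.prob (iid n J) ({w. \<not> typical n \<delta> J w} \<inter> set_pmf (iid n J))"
    by (rule measure_Int_set_pmf[symmetric])
  also have "\<dots> \<le> measure_pmf.prob (iid n J) (\<Union>a\<in>S. {w. e \<le> \<bar>emp n w a - pmf J a\<bar>})"
    by (rule measure_pmf.finite_measure_mono[OF sub]) simp
  also have "\<dots> \<le> (\<Sum>a\<in>S. measure_pmf.prob (iid n J) {w. e \<le> \<bar>emp n w a - pmf J a\<bar>})"
    by (rule measure_pmf.finite_measure_subadditive_finite) (use fin in \<open>auto simp: S_def\<close>)
  also have "\<dots> \<le> (\<Sum>a\<in>S. 2 * exp (- 2 * real n * e\<^sup>2))" by (intro sum_mono single)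
  finally show ?thesis by (simp add: S_def e_def)
qed

lemma prob_not_typical_tendsto_0:
  assumes fin: "finite (set_pmf J)" and \<delta>: "\<delta> > 0"
  shows "(\<lambda>n. measure_pmf.prob (iid n J) {w. \<not> typical n \<delta> J w}) \<longlonglongrightarrow> 0"
proof (rule tendsto_sandwich)
  define k where "k = real (card (set_pmf J))"
  have k: "k > 0" using fin set_pmf_not_empty[of J] by (simp add: k_def card_gt_0_iff)
  show "\<forall>\<^sub>F n in sequentially. 0 \<le> measure_pmf.prob (iid n J) {w. \<not> typical n \<delta> J w}" by simp
  show "\<forall>\<^sub>F n in sequentially. measure_pmf.prob (iid n J) {w. \<not> typical n \<delta> J w}
      \<le> k * (2 * exp (- 2 * (\<delta> / k)\<^sup>2) ^ n)"
  proof (rule eventually_sequentiallyI[of 1])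
    fix n :: nat assume "1 \<le> n"
    then have "measure_pmf.prob (iid n J) {w. \<not> typical n \<delta> J w} \<le> k * (2 * exp (- 2 * real n * (\<delta> / k)\<^sup>2))"
      unfolding k_def by (intro prob_not_typical_le fin \<delta>) simp
    also have "exp (- 2 * real n * (\<delta> / k)\<^sup>2) = exp (- 2 * (\<delta> / k)\<^sup>2) ^ n"
      by (subst exp_of_nat_mult[symmetric]) (simp add: mult_ac)
    finally show "measure_pmf.prob (iid n J) {w. \<not> typical n \<delta> J w} \<le> k * (2 * exp (- 2 * (\<delta> / k)\<^sup>2) ^ n)" .
  qed
  have "exp (- 2 * (\<delta> / k)\<^sup>2) < 1" using k \<delta> by simp
  from LIMSEQ_realpow_zero[OF exp_ge_zero this]
  have "(\<lambda>n. exp (- 2 * (\<delta> / k)\<^sup>2) ^ n) \<longlonglongrightarrow> 0" .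
  then have "(\<lambda>n. k * (2 * exp (- 2 * (\<delta> / k)\<^sup>2) ^ n)) \<longlonglongrightarrow> k * (2 * 0)"
    by (intro tendsto_mult tendsto_const)
  then show "(\<lambda>n. k * (2 * exp (- 2 * (\<delta> / k)\<^sup>2) ^ n)) \<longlonglongrightarrow> 0" by simp
qed simp

text \<open>One half of the asymptotic equipartition property, with explicit error: the logarithm of
  the product is n times the empirical mean of ln g, and each symbol frequency is off by at most
  \<delta>.\<close>

lemma typical_prod_le:
  assumes fin: "finite (set_pmf J)" and n: "n > 0" and w: "typical n \<delta> J w"
    and g: "\<And>c. c \<in> set_pmf J \<Longrightarrow> g c > 0"
  shows "(\<Prod>t<n. g (w t)) \<le> exp (real n * (measure_pmf.expectation J (\<lambda>c. ln (g c))
           + \<delta> * (\<Sum>c\<in>set_pmf J. \<bar>ln (g c)\<bar>)))"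
proof -
  have inS: "\<And>t. t < n \<Longrightarrow> w t \<in> set_pmf J" using w by (simp add: typical_def)
  have close: "\<bar>emp n w c - pmf J c\<bar> \<le> \<delta>" for c
    using w unfolding typical_def emp_def by (auto dest: spec[of _ "{c}"] simp: measure_pmf_single)
  have "(\<Prod>t<n. g (w t)) = exp (real n * (\<Sum>c\<in>set_pmf J. emp n w c * ln (g c)))"
    by (rule prod_eq_emp[of "set_pmf J" n w g]) (use fin inS g in auto)
  also have "(\<Sum>c\<in>set_pmf J. emp n w c * ln (g c))
     \<le> (\<Sum>c\<in>set_pmf J. pmf J c * ln (g c) + \<delta> * \<bar>ln (g c)\<bar>)"
  proof (rule sum_mono)
    fix c
    have "(emp n w c - pmf J c) * ln (g c) \<le> \<bar>(emp n w c - pmf J c) * ln (g c)\<bar>" by simp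
    also have "\<dots> \<le> \<delta> * \<bar>ln (g c)\<bar>" unfolding abs_mult by (rule mult_right_mono[OF close]) simp
    finally show "emp n w c * ln (g c) \<le> pmf J c * ln (g c) + \<delta> * \<bar>ln (g c)\<bar>" by (simp add: algebra_simps)
  qed
  also have "\<dots> = measure_pmf.expectation J (\<lambda>c. ln (g c)) + \<delta> * (\<Sum>c\<in>set_pmf J. \<bar>ln (g c)\<bar>)"
    by (subst integral_measure_pmf_real[OF fin]) (auto simp: sum.distrib sum_distrib_left mult.commute)
  finally show ?thesis using n by (simp add: mult_left_mono)
qed

section \<open>Conditional laws and the factorization through test channels\<close>

lemma pr_eq: "pr J f a = measure_pmf.prob J {z. f z = a}"
  by (simp add: pr_def pmf_map vimage_def)

lemma pr_nonneg: "0 \<le> pr J f a"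
  by (simp add: pr_def)

lemma pr_pos: "z \<in> set_pmf J \<Longrightarrow> 0 < pr J f (f z)"
  unfolding pr_def by (auto simp: pmf_positive_iff)

lemma pr_pos_iff: "0 < pr J f a \<longleftrightarrow> a \<in> f ` set_pmf J"
  unfolding pr_def by (auto simp: pmf_positive_iff)

text \<open>Outside the support of g the value is irrelevant; it is chosen to have finite support.\<close>
definition cond_law :: "'a pmf \<Rightarrow> ('a \<Rightarrow> 'b) \<Rightarrow> ('a \<Rightarrow> 'c) \<Rightarrow> 'c \<Rightarrow> 'b pmf" where
  "cond_law J f g b = (if b \<in> g ` set_pmf J then map_pmf f (cond_pmf J {z. g z = b}) else map_pmf f J)"

lemma pmf_cond_law:
  assumes "b \<in> g ` set_pmf J"
  shows "pmf (cond_law J f g b) a = pr J (\<lambda>z. (f z, g z)) (a, b) / pr J g b"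
proof -
  have ne: "set_pmf J \<inter> {z. g z = b} \<noteq> {}" using assms by auto
  have "pmf (cond_law J f g b) a = measure_pmf.prob (cond_pmf J {z. g z = b}) {z. f z = a}"
    using assms by (simp add: cond_law_def pmf_map vimage_def)
  also have "\<dots> = measure_pmf.prob J ({z. g z = b} \<inter> {z. f z = a}) / measure_pmf.prob J {z. g z = b}"
    using ne by (simp add: measure_def cond_pmf.rep_eq[OF ne] emeasure_uniform_measure)
       (simp add: measure_pmf.emeasure_eq_measure divide_ennreal measure_measure_pmf_not_zero[OF ne] zero_less_measure_iff)
  finally show ?thesis by (simp add: pr_eq Int_def conj_commute)
qed

lemma finite_set_cond_law:
  assumes "finite (set_pmf J)"
  shows "finite (set_pmf (cond_law J f g b))"
proof (cases "b \<in> g ` set_pmf J")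
  case True
  then have "set_pmf J \<inter> {z. g z = b} \<noteq> {}" by auto
  with True assms show ?thesis by (simp add: cond_law_def)
next
  case False
  with assms show ?thesis by (simp add: cond_law_def)
qed

lemma pmf_bind_bind_map:
  "pmf (bind_pmf P (\<lambda>z. bind_pmf (K1 z) (\<lambda>u. map_pmf (\<lambda>v. (u, v, z)) (K2 u z)))) (u, v, z)
     = pmf P z * pmf (K1 z) u * pmf (K2 u z) v"
proof -
  have in0: "pmf (map_pmf (\<lambda>v. (u', v, z')) (K2 u' z')) (u, v, z)
      = (if u' = u \<and> z' = z then pmf (K2 u z) v else 0)" for u' z'
  proof (cases "u' = u \<and> z' = z")
    case True
    have "inj (\<lambda>v. (u, v, z))" by (auto simp: inj_def)
    from pmf_map_inj'[OF this, of "K2 u z" v] True show ?thesis by simp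
  next
    case False
    then show ?thesis by (auto intro!: pmf_map_outside)
  qed
  have in1: "pmf (bind_pmf (K1 z') (\<lambda>u. map_pmf (\<lambda>v. (u, v, z')) (K2 u z'))) (u, v, z)
     = (if z' = z then pmf (K1 z) u * pmf (K2 u z) v else 0)" for z'
    unfolding pmf_bind in0
    by (subst integral_measure_pmf_real[where A="{u}"]) (auto simp: mult.commute split: if_splits)
  show ?thesis
    unfolding pmf_bind[of P] in1
    by (subst integral_measure_pmf_real[where A="{z}"]) (auto simp: mult_ac split: if_splits)
qed

text \<open>\<open>condU\<close> and \<open>condV\<close> vanish by 0/0 = 0 off the support of the
  conditioning variable and so are no probability laws there; sampling a codeword needs genuine
  pmfs, which agree with them on the support.\<close>

definition encU :: "('x, 'y1, 'y2) aux_law \<Rightarrow> 'x \<Rightarrow> nat pmf" where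
  "encU J = cond_law J gU gX"

definition encV :: "('x, 'y1, 'y2) aux_law \<Rightarrow> nat \<Rightarrow> 'y1 \<Rightarrow> nat pmf" where
  "encV J u y = cond_law J gV (\<lambda>z. (gY1 z, gU z)) (y, u)"

lemmas g_defs = gU_def gV_def gX_def gY1_def gY2_def

lemma pmf_encU: "w \<in> set_pmf J \<Longrightarrow> gX w = x \<Longrightarrow> pmf (encU J x) u = condU J u x"
  unfolding encU_def condU_def by (rule pmf_cond_law) auto

lemma pmf_encV: "w \<in> set_pmf J \<Longrightarrow> gU w = u \<Longrightarrow> gY1 w = y \<Longrightarrow> pmf (encV J u y) v = condV J v y u"
  unfolding encV_def condV_def by (subst pmf_cond_law) auto

lemma markov_factorization:
  fixes J :: "('x, 'y1, 'y2) aux_law"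
  assumes "markov_chain J gU gX (\<lambda>z. (gY1 z, gY2 z))"
    and "markov_chain J gV (\<lambda>z. (gY1 z, gU z)) (\<lambda>z. (gY2 z, gX z))"
    and P: "map_pmf (\<lambda>(u,v,x,y1,y2). (x,y1,y2)) J = P"
  shows "J = bind_pmf P (\<lambda>z. bind_pmf (encU J (fst z)) (\<lambda>u.
           map_pmf (\<lambda>v. (u, v, z)) (encV J u (fst (snd z)))))" (is "J = ?R")
proof (rule pmf_eqI)
  fix w :: "nat \<times> nat \<times> 'x \<times> 'y1 \<times> 'y2"
  obtain u v x y1 y2 where w: "w = (u, v, x, y1, y2)" by (cases w) auto
  have R: "pmf ?R w = pmf P (x, y1, y2) * pmf (encU J x) u * pmf (encV J u y1) v"
    unfolding w by (subst pmf_bind_bind_map) simp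
  have Ppr: "pmf P (x, y1, y2) = pr J (\<lambda>z. (gX z, gY1 z, gY2 z)) (x, y1, y2)"
    unfolding P[symmetric] pr_def by (simp add: g_defs case_prod_unfold)
  have Jpr: "pmf J w = pr J (\<lambda>z. (gV z, (gY1 z, gU z), (gY2 z, gX z))) (v, (y1, u), (y2, x))"
  proof -
    have "{z. (gV z, (gY1 z, gU z), (gY2 z, gX z)) = (v, (y1, u), (y2, x))} = {w}"
      by (auto simp: g_defs w)
    then show ?thesis by (simp add: pr_eq measure_pmf_single)
  qed
  have mono: "pmf J w \<le> pr J f (f w)" for f :: "_ \<Rightarrow> 'c"
    unfolding pr_eq measure_pmf_single[symmetric]
    by (rule measure_pmf.finite_measure_mono) auto
  have M1: "pr J (\<lambda>z. (gU z, gX z, gY1 z, gY2 z)) (u, x, y1, y2) * pr J gX x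
      = pr J (\<lambda>z. (gU z, gX z)) (u, x) * pmf P (x, y1, y2)"
    using assms(1) unfolding markov_chain_def Ppr by simp
  have eq: "pr J (\<lambda>z. ((gY1 z, gU z), gY2 z, gX z)) ((y1, u), y2, x)
      = pr J (\<lambda>z. (gU z, gX z, gY1 z, gY2 z)) (u, x, y1, y2)"
    unfolding pr_eq by (rule arg_cong[where f="measure_pmf.prob J"]) auto
  have M2: "pmf J w * pr J (\<lambda>z. (gY1 z, gU z)) (y1, u)
      = pr J (\<lambda>z. (gV z, gY1 z, gU z)) (v, y1, u) * pr J (\<lambda>z. (gU z, gX z, gY1 z, gY2 z)) (u, x, y1, y2)"
    using assms(2) unfolding markov_chain_def Jpr eq[symmetric] by blast
  have le: "pmf J w \<le> pr J (\<lambda>z. (gU z, gX z, gY1 z, gY2 z)) (u, x, y1, y2)"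
    using mono[of "\<lambda>z. (gU z, gX z, gY1 z, gY2 z)"] by (simp add: w g_defs)
  have le': "pr J (\<lambda>z. (gU z, gX z, gY1 z, gY2 z)) (u, x, y1, y2) \<le> pmf P (x, y1, y2)"
    unfolding Ppr pr_eq by (rule measure_pmf.finite_measure_mono) auto
  show "pmf J w = pmf ?R w"
  proof (cases "pmf P (x, y1, y2) = 0")
    case True
    then have "pmf J w = 0" using le le' pmf_nonneg[of J w] by linarith
    with True show ?thesis by (simp only: R)
  next
    case False
    then have "(x, y1, y2) \<in> set_pmf P" by (simp add: set_pmf_iff)
    then obtain w' where w': "w' \<in> set_pmf J" "gX w' = x"
      unfolding P[symmetric] by (auto simp: g_defs)
    have px: "pr J gX x > 0" using pr_pos[OF w'(1), of gX] w'(2) by simp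
    have *: "pr J (\<lambda>z. (gU z, gX z, gY1 z, gY2 z)) (u, x, y1, y2) = pmf P (x, y1, y2) * pmf (encU J x) u"
      using M1 px unfolding pmf_encU[OF w'] condU_def by (simp add: field_simps)
    show ?thesis
    proof (cases "pr J (\<lambda>z. (gU z, gX z, gY1 z, gY2 z)) (u, x, y1, y2) = 0")
      case True
      then have "pmf J w = 0" using le pmf_nonneg[of J w] by linarith
      with True show ?thesis by (simp only: R *[symmetric])
    next
      case False
      then obtain w'' where w'': "w'' \<in> set_pmf J" "gU w'' = u" "gY1 w'' = y1"
        using pr_pos_iff[of J "\<lambda>z. (gU z, gX z, gY1 z, gY2 z)" "(u, x, y1, y2)"] pr_nonneg[of J "\<lambda>z. (gU z, gX z, gY1 z, gY2 z)" "(u, x, y1, y2)"] by force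
      have "pr J (\<lambda>z. (gY1 z, gU z)) (y1, u) > 0"
        using pr_pos[OF w''(1), of "\<lambda>z. (gY1 z, gU z)"] w''(2,3) by simp
      then show ?thesis using M2 unfolding R *[symmetric] pmf_encV[OF w''] condV_def
        by (simp add: field_simps)
    qed
  qed
qed

text \<open>An i.i.d. sample from J, drawn in the order in which the system works: the whole source
  sequence, then the whole of u, then the whole of v. This is the shape in which the two-stage
  covering expects its law.\<close>

definition joint_code_law :: "nat \<Rightarrow> ('x \<times> 'y1 \<times> 'y2) pmf \<Rightarrow> ('x, 'y1, 'y2) aux_law
    \<Rightarrow> ((nat \<Rightarrow> nat) \<times> (nat \<Rightarrow> nat) \<times> (nat \<Rightarrow> 'x \<times> 'y1 \<times> 'y2)) pmf" where
  "joint_code_law n P J = bind_pmf (iid n P) (\<lambda>z.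
     bind_pmf (Pi_pmf {..<n} 0 (\<lambda>t. encU J (seqX z t))) (\<lambda>u.
       map_pmf (\<lambda>v. (u, v, z)) (Pi_pmf {..<n} 0 (\<lambda>t. encV J (u t) (seqY1 z t)))))"

text \<open>Taking products commutes with drawing in stages. The components carry different defaults
  beyond n, hence the truncation to \<open>undefined\<close>.\<close>

lemma iid_eq_map_joint_code_law:
  assumes "J = bind_pmf P (\<lambda>z. bind_pmf (encU J (fst z)) (\<lambda>u.
           map_pmf (\<lambda>v. (u, v, z)) (encV J u (fst (snd z)))))"
  shows "iid n J = map_pmf (\<lambda>(u, v, z) t. if t < n then (u t, v t, z t) else undefined) (joint_code_law n P J)"
proof -
  have "iid n J = Pi_pmf {..<n} undefined (\<lambda>_. bind_pmf P (\<lambda>z. bind_pmf (encU J (fst z)) (\<lambda>u.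
           bind_pmf (encV J u (fst (snd z))) (\<lambda>v. return_pmf (u, v, z)))))"
    unfolding iid_def by (subst assms) (simp add: map_pmf_def)
  also have "\<dots> = bind_pmf (iid n P) (\<lambda>z. bind_pmf (Pi_pmf {..<n} 0 (\<lambda>t. encU J (fst (z t)))) (\<lambda>u.
       bind_pmf (Pi_pmf {..<n} 0 (\<lambda>t. encV J (u t) (fst (snd (z t))))) (\<lambda>v.
         return_pmf (\<lambda>t. if t < n then (u t, v t, z t) else undefined))))"
    unfolding iid_def
    by (subst Pi_pmf_bind[where d'=undefined], simp, subst Pi_pmf_bind[where d'=0], simp,
        subst Pi_pmf_bind[where d'=0], simp, subst Pi_pmf_return_pmf, simp, simp)
  also have "\<dots> = map_pmf (\<lambda>(u, v, z) t. if t < n then (u t, v t, z t) else undefined) (joint_code_law n P J)"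
    by (simp add: joint_code_law_def map_bind_pmf map_pmf_comp seqX_def seqY1_def) (simp add: map_pmf_def)
  finally show ?thesis .
qed

lemma joint_code_law_not_typical:
  assumes "J = bind_pmf P (\<lambda>z. bind_pmf (encU J (fst z)) (\<lambda>u.
           map_pmf (\<lambda>v. (u, v, z)) (encV J u (fst (snd z)))))"
  shows "measure_pmf.prob (joint_code_law n P J) {(u, v, z). \<not> typical n \<delta> J (\<lambda>t. (u t, v t, z t))}
    = measure_pmf.prob (iid n J) {w. \<not> typical n \<delta> J w}"
proof -
  have "typical n \<delta> J (\<lambda>t. if t < n then (u t, v t, z t) else undefined)
      \<longleftrightarrow> typical n \<delta> J (\<lambda>t. (u t, v t, z t))" for u v z
    by (rule typical_cong) simp
  then show ?thesis
    by (subst iid_eq_map_joint_code_law[OF assms]) (simp add: vimage_def case_prod_unfold)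
qed

section \<open>Divergences and information densities\<close>

lemma expectation_finite:
  fixes h :: "'a \<Rightarrow> real"
  assumes "finite (set_pmf J)"
  shows "measure_pmf.expectation J h = (\<Sum>a\<in>set_pmf J. pmf J a * h a)"
  by (subst integral_measure_pmf_real[OF assms]) (auto simp: mult.commute)

lemma mutual_inf_eq_expectation:
  assumes "finite (set_pmf J)"
  shows "mutual_inf J f g = measure_pmf.expectation J
    (\<lambda>z. ln (pr J (\<lambda>z. (f z, g z)) (f z, g z) / (pr J f (f z) * pr J g (g z))))"
proof -
  have "measure_pmf.expectation J (\<lambda>z. ln (pr J (\<lambda>z. (f z, g z)) (f z, g z) / (pr J f (f z) * pr J g (g z))))
    = measure_pmf.expectation (map_pmf (\<lambda>z. (f z, g z)) J)
       (\<lambda>(a, b). ln (pr J (\<lambda>z. (f z, g z)) (a, b) / (pr J f a * pr J g b)))" by simp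
  also have "\<dots> = mutual_inf J f g"
    unfolding mutual_inf_def
    by (subst expectation_finite) (use assms in \<open>auto simp: pr_def intro!: sum.cong\<close>)
  finally show ?thesis by simp
qed

lemma cond_mutual_inf_eq_expectation:
  assumes "finite (set_pmf J)"
  shows "cond_mutual_inf J f g h = measure_pmf.expectation J
    (\<lambda>z. ln (pr J (\<lambda>z. (f z, g z, h z)) (f z, g z, h z) * pr J h (h z) /
            (pr J (\<lambda>z. (f z, h z)) (f z, h z) * pr J (\<lambda>z. (g z, h z)) (g z, h z))))"
proof -
  have "measure_pmf.expectation J
    (\<lambda>z. ln (pr J (\<lambda>z. (f z, g z, h z)) (f z, g z, h z) * pr J h (h z) /
            (pr J (\<lambda>z. (f z, h z)) (f z, h z) * pr J (\<lambda>z. (g z, h z)) (g z, h z))))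
    = measure_pmf.expectation (map_pmf (\<lambda>z. (f z, g z, h z)) J)
       (\<lambda>(a, b, c). ln (pr J (\<lambda>z. (f z, g z, h z)) (a, b, c) * pr J h c /
            (pr J (\<lambda>z. (f z, h z)) (a, c) * pr J (\<lambda>z. (g z, h z)) (b, c))))" by simp
  also have "\<dots> = cond_mutual_inf J f g h"
    unfolding cond_mutual_inf_def
    by (subst expectation_finite) (use assms in \<open>auto simp: pr_def intro!: sum.cong\<close>)
  finally show ?thesis by simp
qed

lemma KL_eq_expectation:
  assumes "finite (set_pmf p)" "\<And>a. a \<in> set_pmf p \<Longrightarrow> q a > 0"
  shows "KL p q = ereal (measure_pmf.expectation p (\<lambda>a. ln (pmf p a / q a)))"
  using assms unfolding KL_def by (subst expectation_finite) auto

lemma rate_eq_expectation: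
  fixes T :: "('a \<times> 'z::finite) pmf"
  assumes "finite A" "set_pmf T \<subseteq> A \<times> UNIV" "\<And>z. 0 < q z"
  shows "rate A q (pmf T) = measure_pmf.expectation T (\<lambda>c. ln (pmf T c / (pr T fst (fst c) * q (snd c))))"
proof -
  have mass: "fst_mass (pmf T) a = pr T fst a" for a
  proof -
    have "pr T fst a = measure_pmf.prob T (Pair a ` UNIV)"
      unfolding pr_eq by (rule arg_cong[where f="measure_pmf.prob T"]) auto
    also have "\<dots> = fst_mass (pmf T) a"
      unfolding fst_mass_def by (subst measure_measure_pmf_finite) (auto simp: sum.reindex inj_on_def)
    finally show ?thesis by simp
  qed
  show ?thesis
    by (subst rate_eq, use assms in auto, subst integral_measure_pmf_real[where A="A \<times> UNIV"])
       (use assms in \<open>auto simp: mass mult.commute\<close>)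
qed

lemma expectation_add_finite:
  fixes f g :: "'a \<Rightarrow> real"
  assumes "finite (set_pmf T)"
  shows "measure_pmf.expectation T (\<lambda>c. f c + g c) = measure_pmf.expectation T f + measure_pmf.expectation T g"
  by (rule Bochner_Integration.integral_add) (use assms in \<open>auto intro: integrable_measure_pmf_finite\<close>)

lemma expectation_transfer:
  assumes "map_pmf f T = map_pmf g J"
  shows "measure_pmf.expectation T (\<lambda>c. h (f c)) = measure_pmf.expectation J (\<lambda>c. h (g c) :: real)"
  using integral_map_pmf[of f T h] integral_map_pmf[of g J h] assms by simp

lemma expectation_cong:
  assumes "\<And>c. c \<in> set_pmf T \<Longrightarrow> f c = (g c :: real)"
  shows "measure_pmf.expectation T f = measure_pmf.expectation T g"
  by (rule integral_cong_AE) (use assms in \<open>auto simp: AE_measure_pmf_iff\<close>)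

section \<open>Marginal constraints and the exponents\<close>

definition fibers :: "('a \<Rightarrow> 'b) \<Rightarrow> 'a set \<Rightarrow> 'a set set" where
  "fibers f D = (\<lambda>b. {c. f c = b}) ` f ` D"

lemma finite_fibers: "finite D \<Longrightarrow> finite (fibers f D)"
  by (simp add: fibers_def)

text \<open>Expresses a prescribed marginal by the probabilities of finitely many events when D is
  finite, the form in which types are constrained.\<close>

lemma map_pmf_eq_fibers:
  assumes "set_pmf T \<subseteq> D" "set_pmf R \<subseteq> D"
    and "\<And>B. B \<in> fibers f D \<Longrightarrow> measure_pmf.prob T B = measure_pmf.prob R B"
  shows "map_pmf f T = map_pmf f R"
proof (rule pmf_eqI)
  fix b
  show "pmf (map_pmf f T) b = pmf (map_pmf f R) b"
  proof (cases "b \<in> f ` D")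
    case True
    then have "{c. f c = b} \<in> fibers f D" by (auto simp: fibers_def)
    from assms(3)[OF this] show ?thesis by (simp add: pmf_map vimage_def)
  next
    case False
    then have "b \<notin> set_pmf (map_pmf f T)" "b \<notin> set_pmf (map_pmf f R)" using assms(1,2) by auto
    then show ?thesis by (simp add: set_pmf_iff del: set_map_pmf)
  qed
qed

lemma pr_transfer:
  assumes "map_pmf f T = map_pmf g J"
  shows "pr T (\<lambda>c. h (f c)) a = pr J (\<lambda>c. h (g c)) a"
proof -
  have "map_pmf (\<lambda>c. h (f c)) T = map_pmf h (map_pmf f T)" by (simp add: map_pmf_comp)
  also have "\<dots> = map_pmf (\<lambda>c. h (g c)) J" unfolding assms by (simp add: map_pmf_comp)
  finally show ?thesis by (simp add: pr_def)
qed

lemma supp_transfer: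
  assumes "map_pmf f T = map_pmf g J" "c \<in> set_pmf T"
  obtains w where "w \<in> set_pmf J" "g w = f c"
proof -
  have "f c \<in> set_pmf (map_pmf f T)" using assms(2) by simp
  then have "f c \<in> g ` set_pmf J" unfolding assms(1) by simp
  then show thesis using that by force
qed

text \<open>Codeword symbol first, observation second: \<open>rate\<close> treats the first
  component as fixed and the second as random.\<close>

definition proj1 :: "nat \<times> nat \<times> 'x \<times> 'y1 \<times> 'y2 \<Rightarrow> nat \<times> 'x \<times> 'y1" where
  "proj1 w = (gU w, gX w, gY1 w)"

definition proj2 :: "nat \<times> nat \<times> 'x \<times> 'y1 \<times> 'y2 \<Rightarrow> (nat \<times> nat) \<times> 'x \<times> 'y1 \<times> 'y2" where
  "proj2 w = ((gU w, gV w), (gX w, gY1 w, gY2 w))"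

definition constraints1 :: "nat set \<Rightarrow> (nat \<times> 'x \<times> 'y1) set set" where
  "constraints1 A = fibers (\<lambda>(u,x,y1). (u,x)) (A \<times> UNIV) \<union> fibers (\<lambda>(u,x,y1). (u,y1)) (A \<times> UNIV)"

definition constraints2 :: "(nat \<times> nat) set \<Rightarrow> ((nat \<times> nat) \<times> 'x \<times> 'y1 \<times> 'y2) set set" where
  "constraints2 A = fibers (\<lambda>((u,v),x,y1,y2). (u,x)) (A \<times> UNIV)
     \<union> fibers (\<lambda>((u,v),x,y1,y2). (u,v,y1)) (A \<times> UNIV)
     \<union> fibers (\<lambda>((u,v),x,y1,y2). (u,v,y2)) (A \<times> UNIV)"

lemma info_U:
  assumes "finite (set_pmf J)"
  shows "measure_pmf.expectation J (\<lambda>w. ln (condU J (gU w) (gX w) / pr J gU (gU w))) = mutual_inf J gU gX"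
  unfolding mutual_inf_eq_expectation[OF assms]
  by (rule expectation_cong) (simp add: condU_def mult.commute)

text \<open>The integrand is the logarithm of P(v|y1,u) / P(v|u), with P(v|u) written as a quotient
  of marginals.\<close>

lemma info_V:
  assumes "finite (set_pmf J)"
  shows "measure_pmf.expectation J (\<lambda>w. ln (condV J (gV w) (gY1 w) (gU w) * pr J gU (gU w)
            / pr J (\<lambda>w. (gV w, gU w)) (gV w, gU w))) = cond_mutual_inf J gV gY1 gU"
  unfolding cond_mutual_inf_eq_expectation[OF assms]
  by (rule expectation_cong) (simp add: condV_def mult_ac)

lemma condU_pos: "w \<in> set_pmf J \<Longrightarrow> condU J (gU w) (gX w) > 0"
  unfolding condU_def using pr_pos[of w J "\<lambda>z. (gU z, gX z)"] pr_pos[of w J gX] by simp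

lemma condV_pos: "w \<in> set_pmf J \<Longrightarrow> condV J (gV w) (gY1 w) (gU w) > 0"
  unfolding condV_def
  using pr_pos[of w J "\<lambda>z. (gV z, gY1 z, gU z)"] pr_pos[of w J "\<lambda>z. (gY1 z, gU z)"] by simp

text \<open>The pointwise form of the excess of the rate over the divergence: t is the type, m the
  law of the codeword symbol, p the alternative and c the channel to u. The last summand is the
  information density.\<close>

lemma ln_density_split_U:
  fixes t m p c :: real
  assumes "0 < t" "0 < m" "0 < p" "0 < c"
  shows "ln (t / (m * p)) = ln (t / (p * c)) + ln (c / m)"
  using assms by (simp add: ln_div ln_mult)

lemma ln_density_split_UV:
  fixes t m p c d g :: real
  assumes "0 < t" "0 < m" "0 < p" "0 < c" "0 < d" "0 < g"
  shows "ln (t / (m * p)) = ln (t / (p * c * d)) + (ln (c / g) + ln (d * g / m))"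
  using assms by (simp add: ln_div ln_mult)

text \<open>The constraints put T into \<open>L1 J\<close>. The rate measures T against P(U) times
  the alternative, the exponent against the channel times the alternative; the two differ by the
  mean of the density P(u|x) / P(u), which depends only on the prescribed marginal (U,X) and so
  equals I(U;X) for every such T.\<close>

lemma exponent1_le_rate:
  fixes J :: "('x::finite, 'y1::finite, 'y2::finite) aux_law" and T :: "(nat \<times> 'x \<times> 'y1) pmf"
  assumes fin: "finite (set_pmf J)" and Pb: "\<forall>z. pmf Pb z > 0"
    and \<theta>: "ereal \<theta> \<le> (INF T\<in>L1 J. KL T (bar1 Pb J))"
    and T: "set_pmf T \<subseteq> gU ` set_pmf J \<times> UNIV"
    and eq: "\<And>B. B \<in> constraints1 (gU ` set_pmf J) \<Longrightarrow>
       measure_pmf.prob T B = measure_pmf.prob (map_pmf proj1 J) B"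
  shows "\<theta> + mutual_inf J gU gX
    \<le> rate (gU ` set_pmf J) (pmf (map_pmf (\<lambda>(x,y1,y2). (x,y1)) Pb)) (pmf T)"
proof -
  define A where "A = gU ` set_pmf J"
  define Q where "Q = map_pmf (\<lambda>(x,y1,y2). (x,y1)) Pb"
  have finA: "finite A" using fin by (simp add: A_def)
  have T: "set_pmf T \<subseteq> A \<times> UNIV" using assms by (simp add: A_def)
  have R: "set_pmf (map_pmf proj1 J) \<subseteq> A \<times> UNIV" by (auto simp: proj1_def A_def)
  have finT: "finite (set_pmf T)" using T finA by (meson finite_SigmaI finite_UNIV finite_subset finite)
  have Qpos: "pmf Q z > 0" for z
  proof -
    have "z = (\<lambda>(x,y1,y2). (x,y1)) (fst z, snd z, undefined)" by simp
    moreover have "(fst z, snd z, undefined) \<in> set_pmf Pb"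
      using Pb pmf_positive_iff[of Pb "(fst z, snd z, undefined)"] by blast
    ultimately have "z \<in> set_pmf Q" unfolding Q_def set_map_pmf by (rule image_eqI)
    then show ?thesis by (rule pmf_positive)
  qed
  have mX: "map_pmf (\<lambda>(u,x,y1). (u,x)) T = map_pmf (\<lambda>z. (gU z, gX z)) J"
    using map_pmf_eq_fibers[OF T R, of "\<lambda>(u,x,y1). (u,x)"] eq
    by (simp add: constraints1_def A_def map_pmf_comp proj1_def)
  have mY: "map_pmf (\<lambda>(u,x,y1). (u,y1)) T = map_pmf (\<lambda>z. (gU z, gY1 z)) J"
    using map_pmf_eq_fibers[OF T R, of "\<lambda>(u,x,y1). (u,y1)"] eq
    by (simp add: constraints1_def A_def map_pmf_comp proj1_def)
  have "T \<in> L1 J" using mX mY by (simp add: L1_def)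
  then have \<theta>T: "ereal \<theta> \<le> KL T (bar1 Pb J)" using \<theta> by (meson INF_lower order_trans)
  \<comment> \<open>Every pair (u,x) charged by T is charged by J, so the reference weight is
    positive on the support of T and the divergence is finite.\<close>
  have barpos: "condU J (fst c) (fst (snd c)) > 0" "pr J gU (fst c) > 0" if c: "c \<in> set_pmf T" for c
  proof -
    obtain w where "w \<in> set_pmf J" "(gU w, gX w) = (\<lambda>(u,x,y1). (u,x)) c"
      by (rule supp_transfer[OF mX c])
    then show "condU J (fst c) (fst (snd c)) > 0" "pr J gU (fst c) > 0"
      using condU_pos[of w J] pr_pos[of w J gU] by (auto simp: case_prod_unfold)
  qed
  have bar: "bar1 Pb J c = pmf Q (snd c) * condU J (fst c) (fst (snd c))" for c
    by (simp add: bar1_def pr_def Q_def case_prod_unfold)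
  have "KL T (bar1 Pb J) = ereal (measure_pmf.expectation T (\<lambda>c. ln (pmf T c / bar1 Pb J c)))"
    by (rule KL_eq_expectation[OF finT]) (simp add: bar barpos Qpos)
  with \<theta>T have "\<theta> \<le> measure_pmf.expectation T (\<lambda>c. ln (pmf T c / bar1 Pb J c))" by simp
  moreover have "measure_pmf.expectation T (\<lambda>c. ln (condU J (fst c) (fst (snd c)) / pr J gU (fst c)))
     = mutual_inf J gU gX"
    using expectation_transfer[OF mX, of "\<lambda>(u,x). ln (condU J u x / pr J gU u)"]
    unfolding info_U[OF fin, symmetric] by (simp add: case_prod_unfold)
  moreover have "rate A (pmf Q) (pmf T) = measure_pmf.expectation T (\<lambda>c. ln (pmf T c / bar1 Pb J c)
      + ln (condU J (fst c) (fst (snd c)) / pr J gU (fst c)))"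
    unfolding rate_eq_expectation[OF finA T Qpos]
  proof (rule expectation_cong)
    fix c assume c: "c \<in> set_pmf T"
    have "pr T fst (fst c) = pr J gU (fst c)"
      using pr_transfer[OF mX, of fst] by (simp add: case_prod_unfold)
    then show "ln (pmf T c / (pr T fst (fst c) * pmf Q (snd c))) = ln (pmf T c / bar1 Pb J c)
      + ln (condU J (fst c) (fst (snd c)) / pr J gU (fst c))"
      using ln_density_split_U[OF pmf_positive[OF c] barpos(2)[OF c] Qpos barpos(1)[OF c]] unfolding bar by simp
  qed
  ultimately show ?thesis
    unfolding A_def[symmetric] Q_def[symmetric] by (simp add: expectation_add_finite[OF finT])
qed

text \<open>Besides the density of u against x there is that of v against y1 given u; its mean is
  fixed by the marginal (U,V,Y1), which yields the additional I(V;Y1|U).\<close>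

lemma exponent2_le_rate:
  fixes J :: "('x::finite, 'y1::finite, 'y2::finite) aux_law"
    and T :: "((nat \<times> nat) \<times> 'x \<times> 'y1 \<times> 'y2) pmf"
  assumes fin: "finite (set_pmf J)" and Pb: "\<forall>z. pmf Pb z > 0"
    and \<theta>: "ereal \<theta> \<le> (INF T\<in>L2 J. KL T (bar2 Pb J))"
    and T: "set_pmf T \<subseteq> (\<lambda>w. (gU w, gV w)) ` set_pmf J \<times> UNIV"
    and eq: "\<And>B. B \<in> constraints2 ((\<lambda>w. (gU w, gV w)) ` set_pmf J) \<Longrightarrow>
       measure_pmf.prob T B = measure_pmf.prob (map_pmf proj2 J) B"
  shows "\<theta> + mutual_inf J gU gX + cond_mutual_inf J gV gY1 gU
    \<le> rate ((\<lambda>w. (gU w, gV w)) ` set_pmf J) (pmf Pb) (pmf T)"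
proof -
  define A where "A = (\<lambda>w. (gU w, gV w)) ` set_pmf J"
  have finA: "finite A" using fin by (simp add: A_def)
  have T: "set_pmf T \<subseteq> A \<times> UNIV" using assms by (simp add: A_def)
  have R: "set_pmf (map_pmf proj2 J) \<subseteq> A \<times> UNIV" by (auto simp: proj2_def A_def)
  have finT: "finite (set_pmf T)" using T finA by (meson finite_SigmaI finite_UNIV finite_subset finite)
  have Pbpos: "pmf Pb z > 0" for z using Pb by blast
  have mX: "map_pmf (\<lambda>((u,v),x,y1,y2). (u,x)) T = map_pmf (\<lambda>z. (gU z, gX z)) J"
    using map_pmf_eq_fibers[OF T R, of "\<lambda>((u,v),x,y1,y2). (u,x)"] eq
    by (simp add: constraints2_def A_def map_pmf_comp proj2_def)
  have mY1: "map_pmf (\<lambda>((u,v),x,y1,y2). (u,v,y1)) T = map_pmf (\<lambda>z. (gU z, gV z, gY1 z)) J"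
    using map_pmf_eq_fibers[OF T R, of "\<lambda>((u,v),x,y1,y2). (u,v,y1)"] eq
    by (simp add: constraints2_def A_def map_pmf_comp proj2_def)
  have mY2: "map_pmf (\<lambda>((u,v),x,y1,y2). (u,v,y2)) T = map_pmf (\<lambda>z. (gU z, gV z, gY2 z)) J"
    using map_pmf_eq_fibers[OF T R, of "\<lambda>((u,v),x,y1,y2). (u,v,y2)"] eq
    by (simp add: constraints2_def A_def map_pmf_comp proj2_def)
  \<comment> \<open>Types treat (u,v) as one codeword symbol, whereas \<open>L2\<close> uses flat
    tuples; \<pi> is the bijection between the two.\<close>
  define \<pi> :: "(nat \<times> nat) \<times> 'x \<times> 'y1 \<times> 'y2 \<Rightarrow> nat \<times> nat \<times> 'x \<times> 'y1 \<times> 'y2"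
    where "\<pi> = (\<lambda>((u,v),z). (u,v,z))"
  have inj: "inj \<pi>" by (auto simp: inj_def \<pi>_def)
  define T' where "T' = map_pmf \<pi> T"
  have finT': "finite (set_pmf T')" using finT by (simp add: T'_def)
  have "T' \<in> L2 J"
    using mX mY1 mY2 by (simp add: L2_def T'_def map_pmf_comp \<pi>_def g_defs case_prod_unfold)
  then have \<theta>T: "ereal \<theta> \<le> KL T' (bar2 Pb J)" using \<theta> by (meson INF_lower order_trans)
  let ?U = "\<lambda>c. fst (fst c)" and ?V = "\<lambda>c. snd (fst c)" and ?X = "\<lambda>c. fst (snd c)" and ?Y = "\<lambda>c. fst (snd (snd c))"
  have posU: "condU J (?U c) (?X c) > 0" "pr J gU (?U c) > 0" if c: "c \<in> set_pmf T" for c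
  proof -
    obtain w where "w \<in> set_pmf J" "(gU w, gX w) = (\<lambda>((u,v),x,y1,y2). (u,x)) c"
      by (rule supp_transfer[OF mX c])
    then show "condU J (?U c) (?X c) > 0" "pr J gU (?U c) > 0"
      using condU_pos[of w J] pr_pos[of w J gU] by (auto simp: case_prod_unfold)
  qed
  have posV: "condV J (?V c) (?Y c) (?U c) > 0" "pr J (\<lambda>w. (gV w, gU w)) (?V c, ?U c) > 0"
    if c: "c \<in> set_pmf T" for c
  proof -
    obtain w where "w \<in> set_pmf J" "(gU w, gV w, gY1 w) = (\<lambda>((u,v),x,y1,y2). (u,v,y1)) c"
      by (rule supp_transfer[OF mY1 c])
    then show "condV J (?V c) (?Y c) (?U c) > 0" "pr J (\<lambda>w. (gV w, gU w)) (?V c, ?U c) > 0"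
      using condV_pos[of w J] pr_pos[of w J "\<lambda>w. (gV w, gU w)"] by (auto simp: case_prod_unfold)
  qed
  have bar: "bar2 Pb J (\<pi> c) = pmf Pb (snd c) * condU J (?U c) (?X c) * condV J (?V c) (?Y c) (?U c)" for c
    by (simp add: bar2_def \<pi>_def case_prod_unfold)
  have "KL T' (bar2 Pb J) = ereal (measure_pmf.expectation T' (\<lambda>c. ln (pmf T' c / bar2 Pb J c)))"
  proof (rule KL_eq_expectation[OF finT'])
    fix a assume "a \<in> set_pmf T'"
    then obtain c where c: "c \<in> set_pmf T" "a = \<pi> c" unfolding T'_def by auto
    then show "0 < bar2 Pb J a"
      unfolding c(2) bar using posU(1)[OF c(1)] posV(1)[OF c(1)] Pbpos by simp
  qed
  also have "measure_pmf.expectation T' (\<lambda>c. ln (pmf T' c / bar2 Pb J c))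
     = measure_pmf.expectation T (\<lambda>c. ln (pmf T c / bar2 Pb J (\<pi> c)))"
    by (simp add: T'_def pmf_map_inj'[OF inj])
  finally have "\<theta> \<le> measure_pmf.expectation T (\<lambda>c. ln (pmf T c / bar2 Pb J (\<pi> c)))"
    using \<theta>T by simp
  moreover have "measure_pmf.expectation T (\<lambda>c. ln (condU J (?U c) (?X c) / pr J gU (?U c)))
     = mutual_inf J gU gX"
    using expectation_transfer[OF mX, of "\<lambda>(u,x). ln (condU J u x / pr J gU u)"]
    unfolding info_U[OF fin, symmetric] by (simp add: case_prod_unfold)
  moreover have "measure_pmf.expectation T (\<lambda>c. ln (condV J (?V c) (?Y c) (?U c) * pr J gU (?U c)
      / pr J (\<lambda>w. (gV w, gU w)) (?V c, ?U c))) = cond_mutual_inf J gV gY1 gU"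
    using expectation_transfer[OF mY1, of "\<lambda>(u,v,y). ln (condV J v y u * pr J gU u / pr J (\<lambda>w. (gV w, gU w)) (v, u))"]
    unfolding info_V[OF fin, symmetric] by (simp add: case_prod_unfold)
  moreover have "rate A (pmf Pb) (pmf T) = measure_pmf.expectation T (\<lambda>c. ln (pmf T c / bar2 Pb J (\<pi> c))
      + (ln (condU J (?U c) (?X c) / pr J gU (?U c))
      + ln (condV J (?V c) (?Y c) (?U c) * pr J gU (?U c) / pr J (\<lambda>w. (gV w, gU w)) (?V c, ?U c))))"
    unfolding rate_eq_expectation[OF finA T Pbpos]
  proof (rule expectation_cong)
    fix c assume c: "c \<in> set_pmf T"
    have "pr T fst (fst c) = pr J (\<lambda>w. (gU w, gV w)) (fst c)"
      using pr_transfer[OF mY1, of "\<lambda>(u,v,y). (u,v)"] by (simp add: case_prod_unfold)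
    also have "\<dots> = pr J (\<lambda>w. (gV w, gU w)) (?V c, ?U c)"
      unfolding pr_eq by (rule arg_cong[where f="measure_pmf.prob J"]) (auto simp: prod_eq_iff)
    finally have "pr T fst (fst c) = pr J (\<lambda>w. (gV w, gU w)) (?V c, ?U c)" .
    then show "ln (pmf T c / (pr T fst (fst c) * pmf Pb (snd c))) = ln (pmf T c / bar2 Pb J (\<pi> c))
      + (ln (condU J (?U c) (?X c) / pr J gU (?U c))
      + ln (condV J (?V c) (?Y c) (?U c) * pr J gU (?U c) / pr J (\<lambda>w. (gV w, gU w)) (?V c, ?U c)))"
      unfolding bar
      using ln_density_split_UV[OF pmf_positive[OF c] posV(2)[OF c] Pbpos posU(1)[OF c] posV(1)[OF c] posU(2)[OF c]]
      by simp
  qed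
  ultimately show ?thesis
    unfolding A_def[symmetric] by (simp add: expectation_add_finite[OF finT])
qed

text \<open>Where a map is undefined, the additional last message is sent, which makes the detectors
  reject the null hypothesis.\<close>
lemma code_of_partial_maps:
  fixes \<phi>1 :: "(nat \<Rightarrow> 'x) \<Rightarrow> 'u option" and \<phi>2 :: "'u \<Rightarrow> (nat \<Rightarrow> 'y1) \<Rightarrow> 'v option"
    and D1 :: "'u \<Rightarrow> (nat \<Rightarrow> 'y1) \<Rightarrow> bool" and D2 :: "'u \<Rightarrow> 'v \<Rightarrow> (nat \<Rightarrow> 'y2) \<Rightarrow> bool"
  assumes fin: "finite (ran \<phi>1)" "\<And>u. finite (ran (\<phi>2 u))"
    and card: "card (ran \<phi>1) \<le> m1" "\<And>u. card (ran (\<phi>2 u)) \<le> m2"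
  obtains f1 f2 g1 g2 where "code_ok (Suc m1) (Suc m2) f1 f2 g1 g2"
    "\<And>w :: nat \<Rightarrow> 'x \<times> 'y1 \<times> 'y2. dec1 f1 g1 w = (if \<exists>u. \<phi>1 (seqX w) = Some u \<and> D1 u (seqY1 w) then 1 else 2)"
    "\<And>w. dec2 f1 f2 g2 w = (if \<exists>u v. \<phi>1 (seqX w) = Some u \<and> \<phi>2 u (seqY1 w) = Some v \<and> D2 u v (seqY2 w) then 1 else 2)"
proof -
  have "\<exists>i. i ` ran \<phi>1 \<subseteq> {1..m1} \<and> inj_on i (ran \<phi>1)"
    using card_le_inj[of "ran \<phi>1" "{1..m1}"] fin card by auto
  then obtain i1 where i1: "i1 ` ran \<phi>1 \<subseteq> {1..m1}" "inj_on i1 (ran \<phi>1)" by blast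
  have "\<exists>i. i ` ran (\<phi>2 u) \<subseteq> {1..m2} \<and> inj_on i (ran (\<phi>2 u))" for u
    using card_le_inj[of "ran (\<phi>2 u)" "{1..m2}"] fin card by auto
  then obtain i2 where i2: "\<And>u. i2 u ` ran (\<phi>2 u) \<subseteq> {1..m2}" "\<And>u. inj_on (i2 u) (ran (\<phi>2 u))" by metis
  have i1_eq: "i1 u = i1 u' \<longleftrightarrow> u = u'" if "u \<in> ran \<phi>1" "u' \<in> ran \<phi>1" for u u'
    using i1(2) that by (auto dest: inj_onD)
  have i1_range: "1 \<le> i1 u \<and> i1 u \<le> m1" if "u \<in> ran \<phi>1" for u using i1(1) that by auto
  have i2_eq: "i2 u v = i2 u v' \<longleftrightarrow> v = v'" if "v \<in> ran (\<phi>2 u)" "v' \<in> ran (\<phi>2 u)" for u v v'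
    using i2(2)[of u] that by (auto dest: inj_onD)
  have i2_range: "1 \<le> i2 u v \<and> i2 u v \<le> m2" if "v \<in> ran (\<phi>2 u)" for u v using i2(1)[of u] that by auto
  define f1 where "f1 x = (case \<phi>1 x of None \<Rightarrow> Suc m1 | Some u \<Rightarrow> i1 u)" for x
  \<comment> \<open>Detector 1 recovers u from the message. For messages that stand for no codeword
    the value is arbitrary, which is harmless because \<open>f2\<close> stays in range for every
    u.\<close>
  define un1 where "un1 m = (SOME u. u \<in> ran \<phi>1 \<and> i1 u = m)" for m
  have un1: "un1 (i1 u) = u" if "u \<in> ran \<phi>1" for u
    unfolding un1_def by (rule some_equality) (use that i1_eq in auto)
  define f2 where "f2 m y = (case \<phi>2 (un1 m) y of None \<Rightarrow> Suc m2 | Some v \<Rightarrow> i2 (un1 m) v)" for m y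
  define g1 where "g1 m y = (if \<exists>u\<in>ran \<phi>1. i1 u = m \<and> D1 u y then 1 else 2 :: nat)" for m y
  define g2 where "g2 m m' y = (if \<exists>u\<in>ran \<phi>1. \<exists>v\<in>ran (\<phi>2 u). i1 u = m \<and> i2 u v = m' \<and> D2 u v y then 1 else 2 :: nat)" for m m' y
  have ranI: "\<phi>1 x = Some u \<Longrightarrow> u \<in> ran \<phi>1" "\<phi>2 u y = Some v \<Longrightarrow> v \<in> ran (\<phi>2 u)" for x u y v
    by (auto simp: ran_def)
  have f1_Some: "f1 x = i1 u \<longleftrightarrow> \<phi>1 x = Some u" if "u \<in> ran \<phi>1" for x u
    using that i1_range[OF that] i1_eq ranI(1) by (auto simp: f1_def split: option.splits)
  have f2_Some: "f2 (i1 u) y = i2 u v \<longleftrightarrow> \<phi>2 u y = Some v" if "u \<in> ran \<phi>1" "v \<in> ran (\<phi>2 u)" for u v y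
    using that i2_range[OF that(2)] i2_eq ranI(2) un1[OF that(1)] by (auto simp: f2_def split: option.splits)
  have ok: "code_ok (Suc m1) (Suc m2) f1 f2 g1 g2"
    unfolding code_ok_def
  proof (intro conjI allI impI)
    fix x show "f1 x \<in> {1..Suc m1}"
      using i1_range[OF ranI(1), of x] by (cases "\<phi>1 x") (auto simp: f1_def)
    fix m y show "f2 m y \<in> {1..Suc m2}"
      using i2_range[OF ranI(2), of "un1 m" y] by (cases "\<phi>2 (un1 m) y") (auto simp: f2_def)
  qed (auto simp: g1_def g2_def)
  show thesis
  proof (rule that[OF ok])
    fix w :: "nat \<Rightarrow> 'x \<times> 'y1 \<times> 'y2"
    have "(\<exists>u\<in>ran \<phi>1. i1 u = f1 (seqX w) \<and> D1 u (seqY1 w))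
      \<longleftrightarrow> (\<exists>u. \<phi>1 (seqX w) = Some u \<and> D1 u (seqY1 w))"
      using f1_Some ranI(1) by metis
    then show "dec1 f1 g1 w = (if \<exists>u. \<phi>1 (seqX w) = Some u \<and> D1 u (seqY1 w) then 1 else 2)"
      by (simp add: dec1_def g1_def)
    have "(\<exists>u\<in>ran \<phi>1. \<exists>v\<in>ran (\<phi>2 u). i1 u = f1 (seqX w) \<and> i2 u v = f2 (f1 (seqX w)) (seqY1 w) \<and> D2 u v (seqY2 w))
      \<longleftrightarrow> (\<exists>u v. \<phi>1 (seqX w) = Some u \<and> \<phi>2 u (seqY1 w) = Some v \<and> D2 u v (seqY2 w))" (is "?L \<longleftrightarrow> ?R")
    proof
      assume ?L
      then obtain u v where uv: "u \<in> ran \<phi>1" "v \<in> ran (\<phi>2 u)" "i1 u = f1 (seqX w)"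
        "i2 u v = f2 (f1 (seqX w)) (seqY1 w)" "D2 u v (seqY2 w)" by blast
      from uv(1,3) have "\<phi>1 (seqX w) = Some u" using f1_Some by metis
      moreover have "\<phi>2 u (seqY1 w) = Some v" using uv f2_Some[OF uv(1,2)] by metis
      ultimately show ?R using uv(5) by blast
    next
      assume ?R
      then obtain u v where uv: "\<phi>1 (seqX w) = Some u" "\<phi>2 u (seqY1 w) = Some v" "D2 u v (seqY2 w)" by blast
      note r = ranI(1)[OF uv(1)] ranI(2)[OF uv(2)]
      have "i1 u = f1 (seqX w)" using f1_Some[OF r(1)] uv(1) by metis
      moreover have "i2 u v = f2 (i1 u) (seqY1 w)" using f2_Some[OF r] uv(2) by metis
      ultimately show ?L using r uv(3) by metis
    qed
    then show "dec2 f1 f2 g2 w = (if \<exists>u v. \<phi>1 (seqX w) = Some u \<and> \<phi>2 u (seqY1 w) = Some v \<and> D2 u v (seqY2 w) then 1 else 2)"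
      by (simp add: dec2_def g2_def)
  qed
qed

section \<open>Construction of the codes\<close>

lemma typical_map:
  assumes "typical n \<delta> J w"
  shows "\<bar>real (card {t. t < n \<and> f (w t) \<in> B}) / real n - measure_pmf.prob (map_pmf f J) B\<bar> \<le> \<delta>"
  using assms unfolding typical_def by (auto dest!: spec[of _ "f -` B"])

lemma eventually_poly_le_exp:
  assumes "\<epsilon> > 0" "C > 0"
  shows "\<forall>\<^sub>F n in sequentially. real ((n + 1) ^ k) * C \<le> exp (real n * \<epsilon>)"
proof -
  have "filterlim (\<lambda>n. \<epsilon> * real (n + 1)) at_top sequentially"
    by (intro filterlim_tendsto_pos_mult_at_top[OF tendsto_const assms(1)]
        filterlim_compose[OF filterlim_real_sequentially] filterlim_add_const_nat_at_top)
  from filterlim_compose[OF tendsto_power_div_exp_0[of k] this]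
  have "(\<lambda>n. (\<epsilon> * real (n + 1)) ^ k / exp (\<epsilon> * real (n + 1))) \<longlonglongrightarrow> 0" .
  moreover have "0 < \<epsilon> ^ k / (C * exp \<epsilon>)" using assms by simp
  ultimately have "\<forall>\<^sub>F n in sequentially.
      (\<epsilon> * real (n + 1)) ^ k / exp (\<epsilon> * real (n + 1)) < \<epsilon> ^ k / (C * exp \<epsilon>)"
    by (rule order_tendstoD(2))
  then show ?thesis
  proof eventually_elim
    case (elim n)
    have e: "exp (\<epsilon> * real (n + 1)) = exp (real n * \<epsilon>) * exp \<epsilon>"
      by (simp add: exp_add[symmetric] algebra_simps)
    have "\<epsilon> ^ k * (real (n + 1) ^ k * (C * exp \<epsilon>)) < \<epsilon> ^ k * (exp (real n * \<epsilon>) * exp \<epsilon>)"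
      using elim assms unfolding e power_mult_distrib by (simp add: field_simps)
    then have "real (n + 1) ^ k * (C * exp \<epsilon>) < exp (real n * \<epsilon>) * exp \<epsilon>"
      using assms by (simp add: mult_less_cancel_left_pos)
    then have "real (n + 1) ^ k * C < exp (real n * \<epsilon>)"
      by (simp add: mult.assoc[symmetric])
    then show ?case by simp
  qed
qed

text \<open>At length n the best available quality among the first n + 1 levels is used. Every fixed
  level is available for all large n, so the level in use eventually exceeds it, and monotonicity
  transfers the guarantee back to \<epsilon>.\<close>

lemma diagonal_choice:
  fixes good :: "real \<Rightarrow> nat \<Rightarrow> 'c \<Rightarrow> bool"
  assumes ev: "\<And>\<epsilon>. 0 < \<epsilon> \<Longrightarrow> \<epsilon> < 1 \<Longrightarrow> \<forall>\<^sub>F n in sequentially. \<exists>c. good \<epsilon> n c"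
    and mono: "\<And>\<epsilon> \<epsilon>' n c. good \<epsilon> n c \<Longrightarrow> \<epsilon> \<le> \<epsilon>' \<Longrightarrow> good \<epsilon>' n c"
    and ok: "\<And>\<epsilon> n c. good \<epsilon> n c \<Longrightarrow> ok c" "ok c0"
  obtains c where "\<And>n. ok (c n)" "\<And>\<epsilon>. \<epsilon> > 0 \<Longrightarrow> \<forall>\<^sub>F n in sequentially. good \<epsilon> n (c n)"
proof -
  define e where "e k = 1 / (real k + 2)" for k :: nat
  have e: "0 < e k" "e k < 1" for k by (simp_all add: e_def)
  have e_mono: "e l \<le> e k" if "k \<le> l" for k l using that by (simp add: e_def frac_le)
  define K where "K n = {k. k \<le> n \<and> (k = 0 \<or> (\<exists>c. good (e k) n c))}" for n
  define \<kappa> where "\<kappa> n = Max (K n)" for n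
  define c where "c n = (if \<exists>c. good (e (\<kappa> n)) n c then SOME c. good (e (\<kappa> n)) n c else c0)" for n
  have c_good: "good (e (\<kappa> n)) n (c n)" if "\<exists>c. good (e (\<kappa> n)) n c" for n
    using that unfolding c_def by (simp add: someI_ex)
  show thesis
  proof (rule that)
    fix n show "ok (c n)"
      using c_good[of n] ok by (cases "\<exists>c. good (e (\<kappa> n)) n c") (auto simp: c_def)
  next
    fix \<epsilon> :: real assume \<epsilon>: "\<epsilon> > 0"
    obtain k :: nat where k: "1 / \<epsilon> < real k" using reals_Archimedean2 by blast
    then have "e k \<le> \<epsilon>" using \<epsilon> by (simp add: e_def field_simps)
    have "\<forall>\<^sub>F n in sequentially. \<exists>c. good (e k) n c" by (rule ev[OF e])
    then show "\<forall>\<^sub>F n in sequentially. good \<epsilon> n (c n)"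
      using eventually_ge_at_top[of k]
    proof eventually_elim
      case (elim n)
      have fin: "finite (K n)" by (rule finite_subset[of _ "{..n}"]) (auto simp: K_def)
      have kK: "k \<in> K n" using elim by (simp add: K_def)
      then have le: "k \<le> \<kappa> n" unfolding \<kappa>_def by (rule Max_ge[OF fin])
      have "\<kappa> n \<in> K n" unfolding \<kappa>_def by (rule Max_in[OF fin]) (use kK in auto)
      then have "\<exists>c. good (e (\<kappa> n)) n c" using elim(1) le by (cases "\<kappa> n = 0") (auto simp: K_def)
      from c_good[OF this] show ?case
        by (rule mono) (use e_mono[OF le] \<open>e k \<le> \<epsilon>\<close> in linarith)
    qed
  qed
qed

lemma limsup_le_ereal:
  assumes "\<And>\<epsilon>. \<epsilon> > 0 \<Longrightarrow> \<forall>\<^sub>F n in sequentially. x n \<le> a + \<epsilon>"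
  shows "limsup (\<lambda>n. ereal (x n)) \<le> ereal a"
proof (rule ereal_le_epsilon2)
  fix \<epsilon> :: real assume "0 < \<epsilon>"
  from assms[OF this] have "\<forall>\<^sub>F n in sequentially. ereal (x n) \<le> ereal (a + \<epsilon>)" by simp
  then show "limsup (\<lambda>n. ereal (x n)) \<le> ereal a + ereal \<epsilon>" by (simp add: Limsup_bounded)
qed

lemma liminf_expo_ge:
  assumes "\<And>\<epsilon>. \<epsilon> > 0 \<Longrightarrow> \<forall>\<^sub>F n in sequentially. b n \<le> exp (- real n * (a - \<epsilon>))"
    and "\<And>n. 0 \<le> b n"
  shows "ereal a \<le> liminf (\<lambda>n. expo n (b n))"
proof (rule ereal_le_epsilon2)
  fix \<epsilon> :: real assume "0 < \<epsilon>"
  from assms(1)[OF this] eventually_gt_at_top[of 0]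
  have "\<forall>\<^sub>F n in sequentially. ereal (a - \<epsilon>) \<le> expo n (b n)"
  proof eventually_elim
    case (elim n)
    show ?case
    proof (cases "b n = 0")
      case False
      then have "b n > 0" using assms(2)[of n] by simp
      then have "ln (b n) \<le> ln (exp (- real n * (a - \<epsilon>)))"
        using elim(1) by (subst ln_le_cancel_iff) auto
      then show ?thesis using elim(2) False by (simp add: expo_def field_simps)
    qed (simp add: expo_def)
  qed
  then have "ereal (a - \<epsilon>) \<le> liminf (\<lambda>n. expo n (b n))" by (rule Liminf_bounded)
  then have "ereal (a - \<epsilon>) + ereal \<epsilon> \<le> liminf (\<lambda>n. expo n (b n)) + ereal \<epsilon>" by (rule add_right_mono)
  then show "ereal a \<le> liminf (\<lambda>n. expo n (b n)) + ereal \<epsilon>" by simp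
qed

text \<open>Since R is nonnegative, the codebook bound is at least 1, so the additional message at
  most doubles it; the resulting factor 2/\<eta> is absorbed by exp(n \<epsilon>).\<close>

lemma rate_le:
  fixes \<eta> :: real
  assumes n: "n > 0" and \<eta>: "0 < \<eta>" "\<eta> < 1" and R: "I \<le> R" "0 \<le> R" and \<epsilon>: "\<epsilon> > 0"
    and small: "2 / \<eta> \<le> exp (real n * \<epsilon>)"
  shows "ln (real (Suc (nat \<lfloor>exp (real n * (I + \<epsilon>)) / \<eta>\<rfloor>))) / real n \<le> R + 2 * \<epsilon>"
proof -
  let ?E = "exp (real n * (R + \<epsilon>))"
  have "exp (real n * (I + \<epsilon>)) \<le> ?E" using R by (simp add: mult_left_mono)
  then have "exp (real n * (I + \<epsilon>)) / \<eta> \<le> ?E / \<eta>" using \<eta> by (simp add: divide_right_mono)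
  moreover have "1 \<le> ?E / \<eta>"
  proof -
    have "\<eta> \<le> 1" using \<eta> by simp
    also have "1 \<le> ?E" using R \<epsilon> by simp
    finally show ?thesis using \<eta> by simp
  qed
  moreover have "real (Suc (nat \<lfloor>exp (real n * (I + \<epsilon>)) / \<eta>\<rfloor>)) \<le> exp (real n * (I + \<epsilon>)) / \<eta> + 1"
    using of_nat_floor[of "exp (real n * (I + \<epsilon>)) / \<eta>"] \<eta> by simp
  ultimately have "real (Suc (nat \<lfloor>exp (real n * (I + \<epsilon>)) / \<eta>\<rfloor>)) \<le> ?E / \<eta> + ?E / \<eta>"
    by linarith
  also have "\<dots> = 2 / \<eta> * ?E" by simp
  also have "\<dots> \<le> exp (real n * \<epsilon>) * ?E" by (rule mult_right_mono[OF small]) simp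
  also have "\<dots> = exp (real n * (R + 2 * \<epsilon>))" by (simp add: exp_add[symmetric] algebra_simps)
  finally have "ln (real (Suc (nat \<lfloor>exp (real n * (I + \<epsilon>)) / \<eta>\<rfloor>))) \<le> ln (exp (real n * (R + 2 * \<epsilon>)))"
    by (subst ln_le_cancel_iff) auto
  then show ?thesis using n by (simp add: field_simps)
qed

lemma prob_UN_le:
  assumes "finite I" "\<And>i. i \<in> I \<Longrightarrow> measure_pmf.prob p (E i) \<le> b" "real (card I) \<le> c" "0 \<le> b"
  shows "measure_pmf.prob p (\<Union>i\<in>I. E i) \<le> c * b"
proof -
  have "measure_pmf.prob p (\<Union>i\<in>I. E i) \<le> (\<Sum>i\<in>I. measure_pmf.prob p (E i))"
    by (rule measure_pmf.finite_measure_subadditive_finite[OF assms(1)]) simp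
  also have "\<dots> \<le> (\<Sum>i\<in>I. b)" by (intro sum_mono assms(2))
  also have "\<dots> \<le> c * b" using assms(3,4) by (simp add: mult_right_mono)
  finally show ?thesis .
qed

section \<open>Codebooks and false acceptance for a fixed auxiliary law\<close>

type_synonym ('x, 'y1, 'y2) code = "nat \<times> nat \<times> ((nat \<Rightarrow> 'x) \<Rightarrow> nat) \<times> (nat \<Rightarrow> (nat \<Rightarrow> 'y1) \<Rightarrow> nat)
  \<times> (nat \<Rightarrow> (nat \<Rightarrow> 'y1) \<Rightarrow> nat) \<times> (nat \<Rightarrow> nat \<Rightarrow> (nat \<Rightarrow> 'y2) \<Rightarrow> nat)"

fun valid_code :: "('x, 'y1, 'y2) code \<Rightarrow> bool" where
  "valid_code (M1, M2, f1, f2, g1, g2) = code_ok M1 M2 f1 f2 g1 g2"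

locale relay_testing =
  fixes P Pb :: "('x::finite \<times> 'y1::finite \<times> 'y2::finite) pmf"
    and R1 R2 \<theta>1 \<theta>2 :: real and J :: "('x, 'y1, 'y2) aux_law"
  assumes Pb_pos: "\<forall>z. pmf Pb z > 0"
    and R1: "R1 \<ge> 0" and R2: "R2 \<ge> 0"
    and inS: "in_S P R1 R2 J"
    and \<theta>1: "ereal \<theta>1 \<le> (INF T\<in>L1 J. KL T (bar1 Pb J))"
    and \<theta>2: "ereal \<theta>2 \<le> (INF T\<in>L2 J. KL T (bar2 Pb J))"
begin

abbreviation "I1 \<equiv> mutual_inf J gU gX"
abbreviation "I2 \<equiv> cond_mutual_inf J gV gY1 gU"
abbreviation "typ3 n \<delta> u v z \<equiv> typical n \<delta> J (\<lambda>t. (u t, v t, z t))"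

lemma finJ: "finite (set_pmf J)" and I1: "I1 \<le> R1" and I2: "I2 \<le> R2"
  using inS by (simp_all add: in_S_def)

lemma factorization: "J = bind_pmf P (\<lambda>z. bind_pmf (encU J (fst z)) (\<lambda>u.
           map_pmf (\<lambda>v. (u, v, z)) (encV J u (fst (snd z)))))"
  using inS unfolding in_S_def by (intro markov_factorization) auto

text \<open>The likelihood ratio of the test channel to the i.i.d. law of U is a product of
  information densities, and along a typical triple its logarithm is at most n(I(U;X) +
  \<epsilon>).\<close>

lemma enc_prob_U_le:
  assumes n: "n > 0" and T: "typ3 n \<delta> u v z"
    and \<delta>: "\<delta> * (\<Sum>w\<in>set_pmf J. \<bar>ln (condU J (gU w) (gX w) / pr J gU (gU w))\<bar>) \<le> \<epsilon>"
  shows "pmf (Pi_pmf {..<n} 0 (\<lambda>t. encU J (seqX z t))) u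
    \<le> exp (real n * (I1 + \<epsilon>)) * pmf (Pi_pmf {..<n} 0 (\<lambda>_. map_pmf gU J)) u"
proof (cases "\<forall>t. t \<notin> {..<n} \<longrightarrow> u t = 0")
  case False
  \<comment> \<open>A u that departs from the default beyond n has probability 0 under both product
    laws.\<close>
  then show ?thesis by (subst (1 2) pmf_Pi_outside) auto
next
  case True
  let ?g = "\<lambda>w. condU J (gU w) (gX w) / pr J gU (gU w)"
  let ?w = "\<lambda>t. (u t, v t, z t)"
  have inJ: "?w t \<in> set_pmf J" if "t < n" for t using T that by (simp add: typical_def)
  have "(\<Prod>t<n. ?g (?w t)) \<le> exp (real n * (measure_pmf.expectation J (\<lambda>w. ln (?g w))
      + \<delta> * (\<Sum>w\<in>set_pmf J. \<bar>ln (?g w)\<bar>)))"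
    by (rule typical_prod_le[OF finJ n T]) (simp add: condU_pos pr_pos)
  also have "\<dots> \<le> exp (real n * (I1 + \<epsilon>))"
    unfolding info_U[OF finJ] using \<delta> by (simp add: mult_left_mono)
  finally have le: "(\<Prod>t<n. ?g (?w t)) \<le> exp (real n * (I1 + \<epsilon>))" .
  have "pmf (Pi_pmf {..<n} 0 (\<lambda>t. encU J (seqX z t))) u = (\<Prod>t<n. pmf (encU J (seqX z t)) (u t))"
    using True by (simp add: pmf_Pi)
  also have "\<dots> = (\<Prod>t<n. ?g (?w t) * pmf (map_pmf gU J) (u t))"
  proof (rule prod.cong[OF refl])
    fix t assume "t \<in> {..<n}"
    then have t: "?w t \<in> set_pmf J" using inJ by simp
    have gX: "gX (?w t) = seqX z t" by (cases "z t") (simp add: gX_def seqX_def)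
    have gU: "gU (?w t) = u t" by (simp add: gU_def)
    show "pmf (encU J (seqX z t)) (u t) = ?g (?w t) * pmf (map_pmf gU J) (u t)"
      unfolding pmf_encU[OF t gX] using pr_pos[OF t, of gU] unfolding gX gU by (simp add: pr_def)
  qed
  also have "\<dots> = (\<Prod>t<n. ?g (?w t)) * pmf (Pi_pmf {..<n} 0 (\<lambda>_. map_pmf gU J)) u"
    unfolding prod.distrib using True by (simp add: pmf_Pi)
  also have "\<dots> \<le> exp (real n * (I1 + \<epsilon>)) * pmf (Pi_pmf {..<n} 0 (\<lambda>_. map_pmf gU J)) u"
    by (rule mult_right_mono[OF le]) simp
  finally show ?thesis .
qed

text \<open>The reference law is that of V given the codeword u, so the ratio has logarithm about n
  I(V;Y1|U): nothing is paid for the dependence of v on u.\<close>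

lemma enc_prob_V_le:
  assumes n: "n > 0" and T: "typ3 n \<delta> u v z"
    and \<delta>: "\<delta> * (\<Sum>w\<in>set_pmf J. \<bar>ln (condV J (gV w) (gY1 w) (gU w) * pr J gU (gU w)
            / pr J (\<lambda>w. (gV w, gU w)) (gV w, gU w))\<bar>) \<le> \<epsilon>"
  shows "pmf (Pi_pmf {..<n} 0 (\<lambda>t. encV J (u t) (seqY1 z t))) v
    \<le> exp (real n * (I2 + \<epsilon>)) * pmf (Pi_pmf {..<n} 0 (\<lambda>t. cond_law J gV gU (u t))) v"
proof (cases "\<forall>t. t \<notin> {..<n} \<longrightarrow> v t = 0")
  case False
  then show ?thesis by (subst (1 2) pmf_Pi_outside) auto
next
  case True
  let ?g = "\<lambda>w. condV J (gV w) (gY1 w) (gU w) * pr J gU (gU w) / pr J (\<lambda>w. (gV w, gU w)) (gV w, gU w)"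
  let ?w = "\<lambda>t. (u t, v t, z t)"
  have inJ: "?w t \<in> set_pmf J" if "t < n" for t using T that by (simp add: typical_def)
  have pos: "?g w > 0" if "w \<in> set_pmf J" for w
    using condV_pos[OF that] pr_pos[OF that, of gU] pr_pos[OF that, of "\<lambda>w. (gV w, gU w)"] by simp
  have "(\<Prod>t<n. ?g (?w t)) \<le> exp (real n * (measure_pmf.expectation J (\<lambda>w. ln (?g w))
      + \<delta> * (\<Sum>w\<in>set_pmf J. \<bar>ln (?g w)\<bar>)))"
    by (rule typical_prod_le[OF finJ n T pos])
  also have "\<dots> \<le> exp (real n * (I2 + \<epsilon>))"
    unfolding info_V[OF finJ] using \<delta> by (simp add: mult_left_mono)
  finally have le: "(\<Prod>t<n. ?g (?w t)) \<le> exp (real n * (I2 + \<epsilon>))" .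
  have "pmf (Pi_pmf {..<n} 0 (\<lambda>t. encV J (u t) (seqY1 z t))) v = (\<Prod>t<n. pmf (encV J (u t) (seqY1 z t)) (v t))"
    using True by (simp add: pmf_Pi)
  also have "\<dots> = (\<Prod>t<n. ?g (?w t) * pmf (cond_law J gV gU (u t)) (v t))"
  proof (rule prod.cong[OF refl])
    fix t assume "t \<in> {..<n}"
    then have t: "?w t \<in> set_pmf J" using inJ by simp
    have gY: "gY1 (?w t) = seqY1 z t" by (cases "z t") (simp add: gY1_def seqY1_def)
    have gU: "gU (?w t) = u t" and gV: "gV (?w t) = v t" by (simp_all add: gU_def gV_def)
    have c: "pmf (cond_law J gV gU (u t)) (v t) = pr J (\<lambda>w. (gV w, gU w)) (v t, u t) / pr J gU (u t)"
      by (rule pmf_cond_law) (use t gU in \<open>metis image_eqI\<close>)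
    have "pr J gU (u t) > 0" "pr J (\<lambda>w. (gV w, gU w)) (v t, u t) > 0"
      using pr_pos[OF t, of gU] pr_pos[OF t, of "\<lambda>w. (gV w, gU w)"] unfolding gU gV by simp_all
    then show "pmf (encV J (u t) (seqY1 z t)) (v t) = ?g (?w t) * pmf (cond_law J gV gU (u t)) (v t)"
      unfolding pmf_encV[OF t gU gY] c gU gV gY by simp
  qed
  also have "\<dots> = (\<Prod>t<n. ?g (?w t)) * pmf (Pi_pmf {..<n} 0 (\<lambda>t. cond_law J gV gU (u t))) v"
    unfolding prod.distrib using True by (simp add: pmf_Pi)
  also have "\<dots> \<le> exp (real n * (I2 + \<epsilon>)) * pmf (Pi_pmf {..<n} 0 (\<lambda>t. cond_law J gV gU (u t))) v"
    by (rule mult_right_mono[OF le]) simp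
  finally show ?thesis .
qed

text \<open>Detector 1 only tests U against Y1; the condition on X holds because the encoder chose u.
  In the same way the conditions on X and Y1 at Detector 2 come from the choice of u and v.\<close>
definition accept1 :: "nat \<Rightarrow> real \<Rightarrow> (nat \<Rightarrow> nat) \<Rightarrow> (nat \<Rightarrow> 'x \<times> 'y1 \<times> 'y2) set" where
  "accept1 n \<delta> u = {z. (\<exists>v z'. seqX z' = seqX z \<and> typ3 n \<delta> u v z') \<and>
     (\<exists>v z'. seqY1 z' = seqY1 z \<and> typ3 n \<delta> u v z')}"

definition accept2 :: "nat \<Rightarrow> real \<Rightarrow> (nat \<Rightarrow> nat) \<Rightarrow> (nat \<Rightarrow> nat) \<Rightarrow> (nat \<Rightarrow> 'x \<times> 'y1 \<times> 'y2) set" where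
  "accept2 n \<delta> u v = {z. (\<exists>v' z'. seqX z' = seqX z \<and> typ3 n \<delta> u v' z') \<and>
     (\<exists>z'. seqY1 z' = seqY1 z \<and> typ3 n \<delta> u v z') \<and> (\<exists>z'. seqY2 z' = seqY2 z \<and> typ3 n \<delta> u v z')}"

text \<open>The two witnesses in \<open>accept1\<close> may be different sequences. Each constraint
  looks at (u,x) alone or at (u,y1) alone, so each witness transfers its own marginal to z, and the
  conditional Sanov bound applies.\<close>

lemma accept1_prob:
  assumes "\<epsilon> > 0"
  obtains \<delta>0 k where "\<delta>0 > 0" "\<And>n \<delta> u. n > 0 \<Longrightarrow> \<delta> \<le> \<delta>0 \<Longrightarrow>
    measure_pmf.prob (iid n Pb) (accept1 n \<delta> u) \<le> real ((n + 1) ^ k) * exp (- real n * (\<theta>1 + I1 - \<epsilon>))"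
proof -
  define A where "A = gU ` set_pmf J"
  define h :: "'x \<times> 'y1 \<times> 'y2 \<Rightarrow> 'x \<times> 'y1" where "h = (\<lambda>(x,y1,y2). (x,y1))"
  have h: "h z = (fst z, fst (snd z))" for z by (simp add: h_def case_prod_unfold)
  have h_eq: "(\<lambda>(x,y1,y2). (x,y1)) = h" by (simp add: fun_eq_iff h)
  define Q where "Q = map_pmf h Pb"
  have finA: "finite A" using finJ by (simp add: A_def)
  have finB: "finite (constraints1 A :: (nat \<times> 'x \<times> 'y1) set set)"
    unfolding constraints1_def using finA by (intro finite_UnI finite_fibers) auto
  have Qpos: "pmf Q z > 0" for z
  proof -
    have "z = h (fst z, snd z, undefined)" by (simp add: h)
    moreover have "(fst z, snd z, undefined) \<in> set_pmf Pb"
      using Pb_pos pmf_positive_iff[of Pb "(fst z, snd z, undefined)"] by blast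
    ultimately have "z \<in> set_pmf Q" unfolding Q_def set_map_pmf by (rule image_eqI)
    then show ?thesis by (rule pmf_positive)
  qed
  obtain \<delta>0 where \<delta>0: "\<delta>0 > 0"
    "\<And>n (a :: nat \<Rightarrow> nat) d. n > 0 \<Longrightarrow> (\<And>t. t < n \<Longrightarrow> a t \<in> A) \<Longrightarrow>
       measure_pmf.prob (Pi_pmf {..<n} d (\<lambda>_. Q))
         {w. \<forall>B\<in>constraints1 A. \<bar>real (card {t. t < n \<and> (a t, w t) \<in> B}) / real n
            - measure_pmf.prob (map_pmf proj1 J) B\<bar> \<le> \<delta>0}
       \<le> real ((n + 1) ^ (card A * CARD('x \<times> 'y1))) * exp (- real n * (\<theta>1 + I1 - \<epsilon>))"
  proof (rule conditional_sanov_marginals[OF finA finB assms Qpos])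
    fix T :: "(nat \<times> 'x \<times> 'y1) pmf"
    assume "set_pmf T \<subseteq> A \<times> UNIV"
      "\<And>B. B \<in> constraints1 A \<Longrightarrow> measure_pmf.prob T B = measure_pmf.prob (map_pmf proj1 J) B"
    then show "\<theta>1 + I1 \<le> rate A (pmf Q) (pmf T)"
      using exponent1_le_rate[OF finJ Pb_pos \<theta>1, of T] unfolding A_def Q_def h_eq by blast
  qed blast
  show thesis
  proof (rule that[OF \<delta>0(1)])
    fix n :: nat and \<delta> u assume n: "n > 0" and \<delta>: "\<delta> \<le> \<delta>0"
    show "measure_pmf.prob (iid n Pb) (accept1 n \<delta> u)
      \<le> real ((n + 1) ^ (card A * CARD('x \<times> 'y1))) * exp (- real n * (\<theta>1 + I1 - \<epsilon>))"
    \<comment> \<open>Nonemptiness supplies a typical sequence through u, so all symbols of u lie in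
      the finite alphabet; otherwise the bound is trivial.\<close>
    proof (cases "accept1 n \<delta> u = {}")
      case False
      then obtain v0 z0 where "typ3 n \<delta> u v0 z0" unfolding accept1_def by blast
      then have "(u t, v0 t, z0 t) \<in> set_pmf J" if "t < n" for t using that by (simp add: typical_def)
      then have uA: "u t \<in> A" if "t < n" for t
        using that unfolding A_def by (force simp: gU_def intro: rev_image_eqI)
      let ?E = "{w. \<forall>B\<in>constraints1 A. \<bar>real (card {t. t < n \<and> (u t, w t) \<in> B}) / real n
            - measure_pmf.prob (map_pmf proj1 J) B\<bar> \<le> \<delta>0}"
      have "accept1 n \<delta> u \<subseteq> {z. h \<circ> z \<in> ?E}"
      proof (intro subsetI CollectI ballI)
        fix z and B :: "(nat \<times> 'x \<times> 'y1) set"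
        assume z: "z \<in> accept1 n \<delta> u" and B: "B \<in> constraints1 A"
        have main: "\<bar>real (card {t. t < n \<and> (u t, (h \<circ> z) t) \<in> B}) / real n
            - measure_pmf.prob (map_pmf proj1 J) B\<bar> \<le> \<delta>0"
          if ty: "typ3 n \<delta> u v z'" and iff: "\<And>t. proj1 (u t, v t, z' t) \<in> B \<longleftrightarrow> (u t, h (z t)) \<in> B" for v z'
          using typical_map[OF ty, of proj1 B] \<delta> by (simp add: iff)
        from B consider b where "B = {c. (\<lambda>(u,x,y1). (u,x)) c = b}"
          | b where "B = {c. (\<lambda>(u,x,y1). (u,y1)) c = b}"
          unfolding constraints1_def fibers_def by blast
        then show "\<bar>real (card {t. t < n \<and> (u t, (h \<circ> z) t) \<in> B}) / real n
            - measure_pmf.prob (map_pmf proj1 J) B\<bar> \<le> \<delta>0"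
        proof cases
          case 1
          obtain v z' where z': "seqX z' = seqX z" "typ3 n \<delta> u v z'" using z unfolding accept1_def by blast
          have "fst (z' t) = fst (z t)" for t using fun_cong[OF z'(1), of t] by (simp add: seqX_def)
          then show ?thesis
            by (intro main[OF z'(2)]) (simp add: 1 proj1_def g_defs h case_prod_unfold)
        next
          case 2
          obtain v z' where z': "seqY1 z' = seqY1 z" "typ3 n \<delta> u v z'" using z unfolding accept1_def by blast
          have "fst (snd (z' t)) = fst (snd (z t))" for t using fun_cong[OF z'(1), of t] by (simp add: seqY1_def)
          then show ?thesis
            by (intro main[OF z'(2)]) (simp add: 2 proj1_def g_defs h case_prod_unfold)
        qed
      qed
      then have "measure_pmf.prob (iid n Pb) (accept1 n \<delta> u) \<le> measure_pmf.prob (iid n Pb) {z. h \<circ> z \<in> ?E}"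
        by (rule measure_pmf.finite_measure_mono) simp
      \<comment> \<open>Y2 is discarded symbol by symbol; the default of the image is accordingly
        \<open>h undefined\<close>.\<close>
      also have "\<dots> = measure_pmf.prob (Pi_pmf {..<n} (h undefined) (\<lambda>_. Q)) ?E"
        unfolding Q_def iid_def by (subst Pi_pmf_map[of "{..<n}" h undefined]) (simp_all add: vimage_def)
      also have "\<dots> \<le> real ((n + 1) ^ (card A * CARD('x \<times> 'y1))) * exp (- real n * (\<theta>1 + I1 - \<epsilon>))"
        by (rule \<delta>0(2)[OF n uA])
      finally show ?thesis .
    qed simp
  qed
qed

text \<open>As for Detector 1, with pairs (u,v) as codeword symbols. The witness for x may use a
  different v' since that constraint ignores v; those for y1 and y2 must share the actual v.\<close>

lemma accept2_prob:
  assumes "\<epsilon> > 0"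
  obtains \<delta>0 k where "\<delta>0 > 0" "\<And>n \<delta> u v. n > 0 \<Longrightarrow> \<delta> \<le> \<delta>0 \<Longrightarrow>
    measure_pmf.prob (iid n Pb) (accept2 n \<delta> u v) \<le> real ((n + 1) ^ k) * exp (- real n * (\<theta>2 + I1 + I2 - \<epsilon>))"
proof -
  define A where "A = (\<lambda>w. (gU w, gV w)) ` set_pmf J"
  have finA: "finite A" using finJ by (simp add: A_def)
  have finB: "finite (constraints2 A :: ((nat \<times> nat) \<times> 'x \<times> 'y1 \<times> 'y2) set set)"
    unfolding constraints2_def using finA by (intro finite_UnI finite_fibers) auto
  have Pbpos: "pmf Pb z > 0" for z using Pb_pos by blast
  obtain \<delta>0 where \<delta>0: "\<delta>0 > 0"
    "\<And>n (a :: nat \<Rightarrow> nat \<times> nat) d. n > 0 \<Longrightarrow> (\<And>t. t < n \<Longrightarrow> a t \<in> A) \<Longrightarrow>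
       measure_pmf.prob (Pi_pmf {..<n} d (\<lambda>_. Pb))
         {w. \<forall>B\<in>constraints2 A. \<bar>real (card {t. t < n \<and> (a t, w t) \<in> B}) / real n
            - measure_pmf.prob (map_pmf proj2 J) B\<bar> \<le> \<delta>0}
       \<le> real ((n + 1) ^ (card A * CARD('x \<times> 'y1 \<times> 'y2))) * exp (- real n * (\<theta>2 + I1 + I2 - \<epsilon>))"
  proof (rule conditional_sanov_marginals[OF finA finB assms Pbpos])
    fix T :: "((nat \<times> nat) \<times> 'x \<times> 'y1 \<times> 'y2) pmf"
    assume "set_pmf T \<subseteq> A \<times> UNIV"
      "\<And>B. B \<in> constraints2 A \<Longrightarrow> measure_pmf.prob T B = measure_pmf.prob (map_pmf proj2 J) B"
    then show "\<theta>2 + I1 + I2 \<le> rate A (pmf Pb) (pmf T)"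
      using exponent2_le_rate[OF finJ Pb_pos \<theta>2, of T] unfolding A_def by blast
  qed blast
  show thesis
  proof (rule that[OF \<delta>0(1)])
    fix n :: nat and \<delta> u v assume n: "n > 0" and \<delta>: "\<delta> \<le> \<delta>0"
    show "measure_pmf.prob (iid n Pb) (accept2 n \<delta> u v)
      \<le> real ((n + 1) ^ (card A * CARD('x \<times> 'y1 \<times> 'y2))) * exp (- real n * (\<theta>2 + I1 + I2 - \<epsilon>))"
    proof (cases "accept2 n \<delta> u v = {}")
      case False
      then obtain z0 where "typ3 n \<delta> u v z0" unfolding accept2_def by blast
      then have "(u t, v t, z0 t) \<in> set_pmf J" if "t < n" for t using that by (simp add: typical_def)
      then have uA: "(u t, v t) \<in> A" if "t < n" for t
        using that unfolding A_def by (force simp: gU_def gV_def intro: rev_image_eqI)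
      let ?E = "{w. \<forall>B\<in>constraints2 A. \<bar>real (card {t. t < n \<and> ((u t, v t), w t) \<in> B}) / real n
            - measure_pmf.prob (map_pmf proj2 J) B\<bar> \<le> \<delta>0}"
      have "accept2 n \<delta> u v \<subseteq> ?E"
      proof (intro subsetI CollectI ballI)
        fix z and B :: "((nat \<times> nat) \<times> 'x \<times> 'y1 \<times> 'y2) set"
        assume z: "z \<in> accept2 n \<delta> u v" and B: "B \<in> constraints2 A"
        have main: "\<bar>real (card {t. t < n \<and> ((u t, v t), z t) \<in> B}) / real n
            - measure_pmf.prob (map_pmf proj2 J) B\<bar> \<le> \<delta>0"
          if ty: "typ3 n \<delta> u v' z'"
            and iff: "\<And>t. proj2 (u t, v' t, z' t) \<in> B \<longleftrightarrow> ((u t, v t), z t) \<in> B" for v' z'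
          using typical_map[OF ty, of proj2 B] \<delta> by (simp add: iff)
        from B consider b where "B = {c. (\<lambda>((u,v),x,y1,y2). (u,x)) c = b}"
          | b where "B = {c. (\<lambda>((u,v),x,y1,y2). (u,v,y1)) c = b}"
          | b where "B = {c. (\<lambda>((u,v),x,y1,y2). (u,v,y2)) c = b}"
          unfolding constraints2_def fibers_def by blast
        then show "\<bar>real (card {t. t < n \<and> ((u t, v t), z t) \<in> B}) / real n
            - measure_pmf.prob (map_pmf proj2 J) B\<bar> \<le> \<delta>0"
        proof cases
          case 1
          obtain v' z' where z': "seqX z' = seqX z" "typ3 n \<delta> u v' z'" using z unfolding accept2_def by blast
          have "fst (z' t) = fst (z t)" for t using fun_cong[OF z'(1), of t] by (simp add: seqX_def)
          then show ?thesis
            by (intro main[OF z'(2)]) (simp add: 1 proj2_def g_defs case_prod_unfold)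
        next
          case 2
          obtain z' where z': "seqY1 z' = seqY1 z" "typ3 n \<delta> u v z'" using z unfolding accept2_def by blast
          have "fst (snd (z' t)) = fst (snd (z t))" for t using fun_cong[OF z'(1), of t] by (simp add: seqY1_def)
          then show ?thesis
            by (intro main[OF z'(2)]) (simp add: 2 proj2_def g_defs case_prod_unfold)
        next
          case 3
          obtain z' where z': "seqY2 z' = seqY2 z" "typ3 n \<delta> u v z'" using z unfolding accept2_def by blast
          have "snd (snd (z' t)) = snd (snd (z t))" for t using fun_cong[OF z'(1), of t] by (simp add: seqY2_def)
          then show ?thesis
            by (intro main[OF z'(2)]) (simp add: 3 proj2_def g_defs case_prod_unfold)
        qed
      qed
      then have "measure_pmf.prob (iid n Pb) (accept2 n \<delta> u v) \<le> measure_pmf.prob (iid n Pb) ?E"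
        by (rule measure_pmf.finite_measure_mono) simp
      also have "\<dots> \<le> real ((n + 1) ^ (card A * CARD('x \<times> 'y1 \<times> 'y2))) * exp (- real n * (\<theta>2 + I1 + I2 - \<epsilon>))"
        unfolding iid_def by (rule \<delta>0(2)[OF n uA])
      finally show ?thesis .
    qed simp
  qed
qed

section \<open>Good codes and passage to the limit\<close>

fun good_code :: "real \<Rightarrow> nat \<Rightarrow> ('x, 'y1, 'y2) code \<Rightarrow> bool" where
  "good_code \<epsilon> n (M1, M2, f1, f2, g1, g2) \<longleftrightarrow> code_ok M1 M2 f1 f2 g1 g2 \<and>
     err n P (dec1 f1 g1) 1 \<le> \<epsilon> \<and> err n P (dec2 f1 f2 g2) 1 \<le> \<epsilon> \<and>
     err n Pb (dec1 f1 g1) 2 \<le> exp (- real n * (\<theta>1 - \<epsilon>)) \<and>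
     err n Pb (dec2 f1 f2 g2) 2 \<le> exp (- real n * (\<theta>2 - \<epsilon>)) \<and>
     ln (real M1) / real n \<le> R1 + \<epsilon> \<and> ln (real M2) / real n \<le> R2 + \<epsilon>"

text \<open>The two-stage covering for product test channels. Its failure budget is the probability
  that an i.i.d. sample from J is atypical, because source and channel outputs, read coordinatewise,
  have exactly this law.\<close>

lemma codebooks:
  assumes n: "n > 0" and \<epsilon>: "\<epsilon> > 0" and \<eta>: "0 < \<eta>" "\<eta> < 1"
    and \<delta>U: "\<delta> * (\<Sum>w\<in>set_pmf J. \<bar>ln (condU J (gU w) (gX w) / pr J gU (gU w))\<bar>) \<le> \<epsilon>"
    and \<delta>V: "\<delta> * (\<Sum>w\<in>set_pmf J. \<bar>ln (condV J (gV w) (gY1 w) (gU w) * pr J gU (gU w)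
            / pr J (\<lambda>w. (gV w, gU w)) (gV w, gU w))\<bar>) \<le> \<epsilon>"
  obtains \<phi>1 \<phi>2 where
    "\<And>x u. \<phi>1 x = Some u \<Longrightarrow> \<exists>v z. seqX z = x \<and> typ3 n \<delta> u v z"
    "\<And>u y v. \<phi>2 u y = Some v \<Longrightarrow> \<exists>z. seqY1 z = y \<and> typ3 n \<delta> u v z"
    "finite (ran \<phi>1)" "real (card (ran \<phi>1)) \<le> exp (real n * (I1 + \<epsilon>)) / \<eta>"
    "\<And>u. finite (ran (\<phi>2 u))" "\<And>u. real (card (ran (\<phi>2 u))) \<le> exp (real n * (I2 + \<epsilon>)) / \<eta>"
    "measure_pmf.prob (iid n P)
       {z. \<not> (\<exists>u v. \<phi>1 (seqX z) = Some u \<and> \<phi>2 u (seqY1 z) = Some v \<and> typ3 n \<delta> u v z)}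
     \<le> measure_pmf.prob (iid n J) {w. \<not> typical n \<delta> J w} / \<eta>\<^sup>2 + 4 * \<eta>"
proof (rule two_stage_covering[of "iid n P" "\<lambda>x. Pi_pmf {..<n} 0 (\<lambda>t. encU J (x t))"
      "\<lambda>u y. Pi_pmf {..<n} 0 (\<lambda>t. encV J (u t) (y t))" seqX seqY1 "typ3 n \<delta>"
      "measure_pmf.prob (iid n J) {w. \<not> typical n \<delta> J w}"
      "exp (real n * (I1 + \<epsilon>))" "Pi_pmf {..<n} 0 (\<lambda>_. map_pmf gU J)"
      "exp (real n * (I2 + \<epsilon>))" "\<lambda>u. Pi_pmf {..<n} 0 (\<lambda>t. cond_law J gV gU (u t))" \<eta>])
  show "finite (set_pmf (iid n P))" unfolding iid_def by (rule finite_set_Pi_pmf) auto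
  show "finite (set_pmf (Pi_pmf {..<n} 0 (\<lambda>t. encU J (x t))))" for x
    unfolding encU_def by (intro finite_set_Pi_pmf finite_set_cond_law finJ) simp
  show "finite (set_pmf (Pi_pmf {..<n} 0 (\<lambda>t. encV J (u t) (y t))))" for u y
    unfolding encV_def by (intro finite_set_Pi_pmf finite_set_cond_law finJ) simp
  show "measure_pmf.prob (bind_pmf (iid n P) (\<lambda>z. bind_pmf (Pi_pmf {..<n} 0 (\<lambda>t. encU J (seqX z t)))
      (\<lambda>u. map_pmf (\<lambda>v. (u, v, z)) (Pi_pmf {..<n} 0 (\<lambda>t. encV J (u t) (seqY1 z t))))))
      {(u, v, z). \<not> typ3 n \<delta> u v z} \<le> measure_pmf.prob (iid n J) {w. \<not> typical n \<delta> J w}"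
    using joint_code_law_not_typical[OF factorization, of n \<delta>] unfolding joint_code_law_def by simp
  show "pmf (Pi_pmf {..<n} 0 (\<lambda>t. encU J (seqX z t))) u
      \<le> exp (real n * (I1 + \<epsilon>)) * pmf (Pi_pmf {..<n} 0 (\<lambda>_. map_pmf gU J)) u" if "typ3 n \<delta> u v z" for u v z
    by (rule enc_prob_U_le[OF n that \<delta>U])
  show "pmf (Pi_pmf {..<n} 0 (\<lambda>t. encV J (u t) (seqY1 z t))) v
      \<le> exp (real n * (I2 + \<epsilon>)) * pmf (Pi_pmf {..<n} 0 (\<lambda>t. cond_law J gV gU (u t))) v"
    if "typ3 n \<delta> u v z" for u v z
    by (rule enc_prob_V_le[OF n that \<delta>V])
qed (use \<eta> that in auto)

lemma eventually_good_code:
  assumes \<epsilon>: "0 < \<epsilon>" "\<epsilon> < 1"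
  shows "\<forall>\<^sub>F n in sequentially. \<exists>c. good_code \<epsilon> n c"
proof -
  \<comment> \<open>Detector 2 loses e four times: in the Sanov bound, in each of the two codebook
    sizes, and for the polynomial factor. Detector 1 loses 3 e, the rates 2 e.\<close>
  define e where "e = \<epsilon> / 4"
  \<comment> \<open>The covering loss 4 \<eta> is then half of \<epsilon>; the other half is left to
    atypicality divided by \<open>\<eta>\<^sup>2\<close>.\<close>
  define \<eta> where "\<eta> = \<epsilon> / 8"
  have e: "e > 0" and \<eta>: "0 < \<eta>" "\<eta> < 1" using \<epsilon> by (simp_all add: e_def \<eta>_def)
  obtain \<delta>1 k1 where \<delta>1: "\<delta>1 > 0" and accept1: "\<And>n \<delta> u. n > 0 \<Longrightarrow> \<delta> \<le> \<delta>1 \<Longrightarrow>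
    measure_pmf.prob (iid n Pb) (accept1 n \<delta> u) \<le> real ((n + 1) ^ k1) * exp (- real n * (\<theta>1 + I1 - e))"
    by (rule accept1_prob[OF e]) blast
  obtain \<delta>2 k2 where \<delta>2: "\<delta>2 > 0" and accept2: "\<And>n \<delta> u v. n > 0 \<Longrightarrow> \<delta> \<le> \<delta>2 \<Longrightarrow>
    measure_pmf.prob (iid n Pb) (accept2 n \<delta> u v) \<le> real ((n + 1) ^ k2) * exp (- real n * (\<theta>2 + I1 + I2 - e))"
    by (rule accept2_prob[OF e]) blast
  define CU where "CU = (\<Sum>w\<in>set_pmf J. \<bar>ln (condU J (gU w) (gX w) / pr J gU (gU w))\<bar>)"
  define CV where "CV = (\<Sum>w\<in>set_pmf J. \<bar>ln (condV J (gV w) (gY1 w) (gU w) * pr J gU (gU w)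
            / pr J (\<lambda>w. (gV w, gU w)) (gV w, gU w))\<bar>)"
  have C0: "0 \<le> CU" "0 \<le> CV" unfolding CU_def CV_def by (auto intro: sum_nonneg)
  \<comment> \<open>Within the tolerances of both acceptance bounds, and small enough that the
    fluctuation of either information density is at most e. The summand 1 keeps the denominator
    positive.\<close>
  define \<delta> where "\<delta> = min (min \<delta>1 \<delta>2) (e / (CU + CV + 1))"
  have \<delta>: "\<delta> > 0" "\<delta> \<le> \<delta>1" "\<delta> \<le> \<delta>2" using \<delta>1 \<delta>2 e C0 by (auto simp: \<delta>_def)
  have \<delta>C: "\<delta> * c \<le> e" if "0 \<le> c" "c \<le> CU + CV + 1" for c
  proof -
    have "\<delta> * c \<le> e / (CU + CV + 1) * (CU + CV + 1)"
      by (rule mult_mono) (use that C0 e in \<open>auto simp: \<delta>_def\<close>)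
    then show ?thesis using C0 by simp
  qed
  have "\<delta> * CU \<le> e" "\<delta> * CV \<le> e" using C0 by (auto intro: \<delta>C)
  note \<delta>UV = this[unfolded CU_def CV_def]
  have "\<forall>\<^sub>F n in sequentially. measure_pmf.prob (iid n J) {w. \<not> typical n \<delta> J w} < \<eta>\<^sup>2 * (\<epsilon> / 2)"
    by (rule order_tendstoD(2)[OF prob_not_typical_tendsto_0[OF finJ \<delta>(1)]]) (use \<eta> \<epsilon> in simp)
  moreover have "\<forall>\<^sub>F n in sequentially. real ((n + 1) ^ k1) * (1 / \<eta>) \<le> exp (real n * e)"
    by (rule eventually_poly_le_exp) (use e \<eta> in auto)
  moreover have "\<forall>\<^sub>F n in sequentially. real ((n + 1) ^ k2) * (1 / \<eta>\<^sup>2) \<le> exp (real n * e)"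
    by (rule eventually_poly_le_exp) (use e \<eta> in auto)
  moreover have "\<forall>\<^sub>F n in sequentially. real ((n + 1) ^ 0) * (2 / \<eta>) \<le> exp (real n * e)"
    by (rule eventually_poly_le_exp) (use e \<eta> in auto)
  ultimately show ?thesis using eventually_gt_at_top[of 0]
  proof eventually_elim
    case (elim n)
    have n: "n > 0" by fact
    let ?K1 = "exp (real n * (I1 + e)) / \<eta>" and ?K2 = "exp (real n * (I2 + e)) / \<eta>"
    obtain \<phi>1 \<phi>2 where \<phi>:
      "\<And>x u. \<phi>1 x = Some u \<Longrightarrow> \<exists>v z. seqX z = x \<and> typ3 n \<delta> u v z"
      "\<And>u y v. \<phi>2 u y = Some v \<Longrightarrow> \<exists>z. seqY1 z = y \<and> typ3 n \<delta> u v z"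
      "finite (ran \<phi>1)" "real (card (ran \<phi>1)) \<le> ?K1"
      "\<And>u. finite (ran (\<phi>2 u))" "\<And>u. real (card (ran (\<phi>2 u))) \<le> ?K2"
      and fail: "measure_pmf.prob (iid n P)
         {z. \<not> (\<exists>u v. \<phi>1 (seqX z) = Some u \<and> \<phi>2 u (seqY1 z) = Some v \<and> typ3 n \<delta> u v z)}
       \<le> measure_pmf.prob (iid n J) {w. \<not> typical n \<delta> J w} / \<eta>\<^sup>2 + 4 * \<eta>"
      by (rule codebooks[OF n e \<eta> \<delta>UV]) blast
    let ?D1 = "\<lambda>u y. \<exists>v z. seqY1 z = y \<and> typ3 n \<delta> u v z"
    let ?D2 = "\<lambda>u v y. \<exists>z. seqY2 z = y \<and> typ3 n \<delta> u v z"
    have c1: "card (ran \<phi>1) \<le> nat \<lfloor>?K1\<rfloor>" using \<phi>(4) by (simp add: le_nat_floor)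
    have c2: "card (ran (\<phi>2 u)) \<le> nat \<lfloor>?K2\<rfloor>" for u using \<phi>(6)[of u] by (simp add: le_nat_floor)
    obtain f1 f2 g1 g2 where ok: "code_ok (Suc (nat \<lfloor>?K1\<rfloor>)) (Suc (nat \<lfloor>?K2\<rfloor>)) f1 f2 g1 g2"
      and d1: "\<And>w :: nat \<Rightarrow> 'x \<times> 'y1 \<times> 'y2. dec1 f1 g1 w
        = (if \<exists>u. \<phi>1 (seqX w) = Some u \<and> ?D1 u (seqY1 w) then 1 else 2)"
      and d2: "\<And>w. dec2 f1 f2 g2 w
        = (if \<exists>u v. \<phi>1 (seqX w) = Some u \<and> \<phi>2 u (seqY1 w) = Some v \<and> ?D2 u v (seqY2 w) then 1 else 2)"
      by (rule code_of_partial_maps[where ?\<phi>1.0 = \<phi>1 and ?\<phi>2.0 = \<phi>2 and ?D1.0 = ?D1 and ?D2.0 = ?D2,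
            OF \<phi>(3,5) c1 c2]) blast
    define bad where "bad = {z. \<not> (\<exists>u v. \<phi>1 (seqX z) = Some u \<and> \<phi>2 u (seqY1 z) = Some v \<and> typ3 n \<delta> u v z)}"
    have bad: "measure_pmf.prob (iid n P) bad \<le> \<epsilon>"
    proof -
      have "measure_pmf.prob (iid n J) {w. \<not> typical n \<delta> J w} / \<eta>\<^sup>2 \<le> \<epsilon> / 2"
        using elim(1) \<eta> by (simp add: divide_le_eq mult.commute)
      moreover have "4 * \<eta> = \<epsilon> / 2" by (simp add: \<eta>_def)
      ultimately show ?thesis using fail unfolding bad_def by linarith
    qed
    \<comment> \<open>Outside \<open>bad\<close> the sequence w itself is the typical witness, and
      it makes both detectors accept.\<close>
    have "{w. dec1 f1 g1 w \<noteq> 1} \<subseteq> bad" unfolding bad_def d1 by (auto split: if_splits)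
    then have \<alpha>1: "err n P (dec1 f1 g1) 1 \<le> \<epsilon>"
      unfolding err_def by (rule order_trans[OF measure_pmf.finite_measure_mono bad]) simp
    have "{w. dec2 f1 f2 g2 w \<noteq> 1} \<subseteq> bad" unfolding bad_def d2 by (auto split: if_splits)
    then have \<alpha>2: "err n P (dec2 f1 f2 g2) 1 \<le> \<epsilon>"
      unfolding err_def by (rule order_trans[OF measure_pmf.finite_measure_mono bad]) simp
    have "{w. dec1 f1 g1 w \<noteq> 2} \<subseteq> (\<Union>u\<in>ran \<phi>1. accept1 n \<delta> u)"
    proof
      fix w :: "nat \<Rightarrow> 'x \<times> 'y1 \<times> 'y2" assume "w \<in> {w. dec1 f1 g1 w \<noteq> 2}"
      then obtain u where u: "\<phi>1 (seqX w) = Some u" "?D1 u (seqY1 w)" by (auto simp: d1 split: if_splits)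
      \<comment> \<open>The decision supplies the witness for y1, the choice of u by the encoder the
        one for x.\<close>
      then have "w \<in> accept1 n \<delta> u" using \<phi>(1)[OF u(1)] unfolding accept1_def by blast
      then show "w \<in> (\<Union>u\<in>ran \<phi>1. accept1 n \<delta> u)" using u(1) by (auto simp: ran_def)
    qed
    then have "err n Pb (dec1 f1 g1) 2 \<le> measure_pmf.prob (iid n Pb) (\<Union>u\<in>ran \<phi>1. accept1 n \<delta> u)"
      unfolding err_def by (rule measure_pmf.finite_measure_mono) simp
    also have "\<dots> \<le> ?K1 * (real ((n + 1) ^ k1) * exp (- real n * (\<theta>1 + I1 - e)))"
      by (rule prob_UN_le) (use \<phi>(3,4) accept1[OF n \<delta>(2)] in auto)
    also have "\<dots> = (real ((n + 1) ^ k1) * (1 / \<eta>)) * exp (- real n * (\<theta>1 - 2 * e))"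
      by (simp add: exp_add[symmetric] algebra_simps)
    also have "\<dots> \<le> exp (real n * e) * exp (- real n * (\<theta>1 - 2 * e))"
      by (rule mult_right_mono[OF elim(2)]) simp
    also have "\<dots> = exp (- real n * (\<theta>1 - 3 * e))" by (simp add: exp_add[symmetric] algebra_simps)
    also have "\<dots> \<le> exp (- real n * (\<theta>1 - \<epsilon>))" using e by (simp add: e_def mult_left_mono)
    finally have \<beta>1: "err n Pb (dec1 f1 g1) 2 \<le> exp (- real n * (\<theta>1 - \<epsilon>))" .
    have "{w. dec2 f1 f2 g2 w \<noteq> 2} \<subseteq> (\<Union>u\<in>ran \<phi>1. \<Union>v\<in>ran (\<phi>2 u). accept2 n \<delta> u v)"
    proof
      fix w :: "nat \<Rightarrow> 'x \<times> 'y1 \<times> 'y2" assume "w \<in> {w. dec2 f1 f2 g2 w \<noteq> 2}"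
      then obtain u v where u: "\<phi>1 (seqX w) = Some u" and v: "\<phi>2 u (seqY1 w) = Some v"
        and "?D2 u v (seqY2 w)" by (auto simp: d2 split: if_splits)
      then have "w \<in> accept2 n \<delta> u v" using \<phi>(1)[OF u] \<phi>(2)[OF v] unfolding accept2_def by blast
      then show "w \<in> (\<Union>u\<in>ran \<phi>1. \<Union>v\<in>ran (\<phi>2 u). accept2 n \<delta> u v)" using u v by (auto simp: ran_def)
    qed
    then have "err n Pb (dec2 f1 f2 g2) 2
        \<le> measure_pmf.prob (iid n Pb) (\<Union>u\<in>ran \<phi>1. \<Union>v\<in>ran (\<phi>2 u). accept2 n \<delta> u v)"
      unfolding err_def by (rule measure_pmf.finite_measure_mono) simp
    also have "\<dots> \<le> ?K1 * (?K2 * (real ((n + 1) ^ k2) * exp (- real n * (\<theta>2 + I1 + I2 - e))))"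
      by (intro prob_UN_le accept2[OF n \<delta>(3)] \<phi>) (use \<eta> in auto)
    also have "\<dots> = (real ((n + 1) ^ k2) * (1 / \<eta>\<^sup>2)) * exp (- real n * (\<theta>2 - 3 * e))"
    proof -
      have "exp (- real n * (\<theta>2 - 3 * e))
         = exp (real n * (I1 + e)) * (exp (real n * (I2 + e)) * exp (- real n * (\<theta>2 + I1 + I2 - e)))"
        \<comment> \<open>The codebook exponents I1 and I2 cancel the excess of the acceptance
          exponent over \<theta>2; only multiples of e remain.\<close>
        by (simp add: exp_add[symmetric] algebra_simps)
      then show ?thesis by (simp add: power2_eq_square)
    qed
    also have "\<dots> \<le> exp (real n * e) * exp (- real n * (\<theta>2 - 3 * e))"
      by (rule mult_right_mono[OF elim(3)]) simp
    also have "\<dots> = exp (- real n * (\<theta>2 - \<epsilon>))" by (simp add: exp_add[symmetric] algebra_simps e_def)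
    finally have \<beta>2: "err n Pb (dec2 f1 f2 g2) 2 \<le> exp (- real n * (\<theta>2 - \<epsilon>))" .
    have small: "2 / \<eta> \<le> exp (real n * e)" using elim(4) by simp
    have "ln (real (Suc (nat \<lfloor>?K1\<rfloor>))) / real n \<le> R1 + 2 * e"
      by (rule rate_le[OF n \<eta> I1 R1 e small])
    moreover have "ln (real (Suc (nat \<lfloor>?K2\<rfloor>))) / real n \<le> R2 + 2 * e"
      by (rule rate_le[OF n \<eta> I2 R2 e small])
    moreover have "2 * e \<le> \<epsilon>" using \<epsilon> by (simp add: e_def)
    ultimately have "good_code \<epsilon> n (Suc (nat \<lfloor>?K1\<rfloor>), Suc (nat \<lfloor>?K2\<rfloor>), f1, f2, g1, g2)"
      using ok \<alpha>1 \<alpha>2 \<beta>1 \<beta>2 by simp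
    then show ?case by blast
  qed
qed

text \<open>One tolerance governs all requirements, and each weakens as it grows; this is what the
  diagonal choice asks for.\<close>

lemma good_code_mono: "good_code \<epsilon> n c \<Longrightarrow> \<epsilon> \<le> \<epsilon>' \<Longrightarrow> good_code \<epsilon>' n c"
proof (cases c)
  case (fields M1 M2 f1 f2 g1 g2)
  assume g: "good_code \<epsilon> n c" and le: "\<epsilon> \<le> \<epsilon>'"
  have "exp (- real n * (a - \<epsilon>)) \<le> exp (- real n * (a - \<epsilon>'))" for a
    using le by (simp add: mult_left_mono)
  with g le show ?thesis unfolding fields good_code.simps by (smt (verit))
qed

lemma achievable_exponents:
  assumes e: "0 < e1" "0 < e2"
  shows "achievable P Pb R1 R2 e1 e2 (\<theta>1, \<theta>2)"
proof -
  have ok: "valid_code c" if "good_code \<epsilon> n c" for \<epsilon> n c using that by (cases c) auto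
  have ok0: "valid_code (1, 1, \<lambda>_. 1, \<lambda>_ _. 1, \<lambda>_ _. 1, \<lambda>_ _ _. 1)" by (simp add: code_ok_def)
  obtain c where c: "\<And>n. valid_code (c n)" "\<And>\<epsilon>. \<epsilon> > 0 \<Longrightarrow> \<forall>\<^sub>F n in sequentially. good_code \<epsilon> n (c n)"
    by (rule diagonal_choice[where good = good_code and ok = valid_code, OF eventually_good_code good_code_mono ok ok0]) blast+
  define M1 where "M1 n = fst (c n)" for n
  define M2 where "M2 n = fst (snd (c n))" for n
  define f1 where "f1 n = fst (snd (snd (c n)))" for n
  define f2 where "f2 n = fst (snd (snd (snd (c n))))" for n
  define g1 where "g1 n = fst (snd (snd (snd (snd (c n)))))" for n
  define g2 where "g2 n = snd (snd (snd (snd (snd (c n)))))" for n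
  have cn: "c n = (M1 n, M2 n, f1 n, f2 n, g1 n, g2 n)" for n
    by (simp add: M1_def M2_def f1_def f2_def g1_def g2_def)
  note good = c(2)[unfolded cn good_code.simps]
  show ?thesis
    unfolding achievable_def fst_conv snd_conv
  proof (rule exI[of _ M1], rule exI[of _ M2], rule exI[of _ f1], rule exI[of _ f2],
      rule exI[of _ g1], rule exI[of _ g2], intro conjI allI)
    show "code_ok (M1 n) (M2 n) (f1 n) (f2 n) (g1 n) (g2 n)" for n
      using c(1)[of n] by (simp add: cn)
    have "\<forall>\<^sub>F n in sequentially. ereal (err n P (dec1 (f1 n) (g1 n)) 1) \<le> ereal e1"
      using good[OF e(1)] by (rule eventually_mono) simp
    then show "limsup (\<lambda>n. ereal (err n P (dec1 (f1 n) (g1 n)) 1)) \<le> ereal e1" by (rule Limsup_bounded)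
    have "\<forall>\<^sub>F n in sequentially. ereal (err n P (dec2 (f1 n) (f2 n) (g2 n)) 1) \<le> ereal e2"
      using good[OF e(2)] by (rule eventually_mono) simp
    then show "limsup (\<lambda>n. ereal (err n P (dec2 (f1 n) (f2 n) (g2 n)) 1)) \<le> ereal e2" by (rule Limsup_bounded)
    show "ereal \<theta>1 \<le> liminf (\<lambda>n. expo n (err n Pb (dec1 (f1 n) (g1 n)) 2))"
      by (rule liminf_expo_ge, erule eventually_mono[OF good]) (auto simp: err_def)
    show "ereal \<theta>2 \<le> liminf (\<lambda>n. expo n (err n Pb (dec2 (f1 n) (f2 n) (g2 n)) 2))"
      by (rule liminf_expo_ge, erule eventually_mono[OF good]) (auto simp: err_def)
    show "limsup (\<lambda>n. ereal (ln (real (M1 n)) / real n)) \<le> ereal R1"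
      by (rule limsup_le_ereal, erule eventually_mono[OF good]) simp
    show "limsup (\<lambda>n. ereal (ln (real (M2 n)) / real n)) \<le> ereal R2"
      by (rule limsup_le_ereal, erule eventually_mono[OF good]) simp
  qed
qed

end

theorem theorem1:
  fixes P Pb :: "('x::finite \<times> 'y1::finite \<times> 'y2::finite) pmf"
    and R1 R2 e1 e2 \<theta>1 \<theta>2 :: real
  assumes "\<forall>z. pmf Pb z > 0"
    and "R1 \<ge> 0" and "R2 \<ge> 0"
    and "0 < e1" and "e1 < 1" and "0 < e2" and "e2 < 1"
    and "\<theta>1 \<ge> 0" and "\<theta>2 \<ge> 0"
    and "\<exists>J. in_S P R1 R2 J \<and>
           ereal \<theta>1 \<le> (INF T\<in>L1 J. KL T (bar1 Pb J)) \<and>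
           ereal \<theta>2 \<le> (INF T\<in>L2 J. KL T (bar2 Pb J))"
  shows "(\<theta>1, \<theta>2) \<in> region P Pb R1 R2 e1 e2"
proof -
  from assms(10) obtain J where "in_S P R1 R2 J"
    "ereal \<theta>1 \<le> (INF T\<in>L1 J. KL T (bar1 Pb J))" "ereal \<theta>2 \<le> (INF T\<in>L2 J. KL T (bar2 Pb J))"
    by blast
  then interpret relay_testing P Pb R1 R2 \<theta>1 \<theta>2 J
    using assms by unfold_locales auto
  have "achievable P Pb R1 R2 e1 e2 (\<theta>1, \<theta>2)" by (rule achievable_exponents) (use assms in auto)
  then show ?thesis unfolding region_def by (intro subsetD[OF closure_subset]) simp
qed

end
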